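(* Assume conditions [A], [B] and [C2] given in the context. Then, for every $m\in\mathfrak M^c$, as $n\to\infty$, $$\mathbf P\bigl(\mathrm{QBIC}^{(m^* )}_{1,n}<\mathrm{QBIC}^{(m)}_{1,n}\bigr)\to1,\qquad \mathbf P\bigl(\mathrm{QBIC}^{(m^* )}_{2,n}<\mathrm{QBIC}^{(m)}_{2,n}\bigr)\to1.$$
   Context: **True model.** On a stochastic basis $(\Omega,\mathscr F,\{\mathscr F_t\},\mathbf P)$ satisfying the usual conditions, let $W_{1,t},\dots,W_{4,t}$ be independent standard Wiener processes of dimensions $r_1,\dots,r_4$. Fix $p_1,p_2\ge 1$, $k_1\le p_1$, $k_2\le p_2$, and put $p=p_1+p_2$. Let $$\mathbb X_{1,0,t}=\mathbf\Lambda_{x_1,0}\xi_{0,t}+\delta_{0,t},\quad \mathbb X_{2,0,t}=\mathbf\Lambda_{x_2,0}\eta_{0,t}+\varepsilon_{0,t},\quad \eta_{0,t}=\mathbf B_0\eta_{0,t}+\mathbf\Gamma_0\xi_{0,t}+\zeta_{0,t},$$ where $d\xi_{0,t}=B_1(\xi_{0,t})dt+\mathbf S_{1,0}dW_{1,t}$, $\xi_{0,0}=c_1\in\mathbb R^{k_1}$; $d\delta_{0,t}=B_2(\delta_{0,t})dt+\mathbf S_{2,0}dW_{2,t}$, $\delta_{0,0}=c_2\in\mathbb R^{p_1}$; $d\varepsilon_{0,t}=B_3(\varepsilon_{0,t})dt+\mathbf S_{3,0}dW_{3,t}$, $\varepsilon_{0,0}=c_3\in\mathbb R^{p_2}$;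 $d\zeta_{0,t}=B_4(\zeta_{0,t})dt+\mathbf S_{4,0}dW_{4,t}$, $\zeta_{0,0}=c_4\in\mathbb R^{k_2}$. Here $B_1:\mathbb R^{k_1}\to\mathbb R^{k_1}$, $B_2:\mathbb R^{p_1}\to\mathbb R^{p_1}$, $B_3:\mathbb R^{p_2}\to\mathbb R^{p_2}$, $B_4:\mathbb R^{k_2}\to\mathbb R^{k_2}$; $\mathbf S_{1,0}\in\mathbb R^{k_1\times r_1}$, $\mathbf S_{2,0}\in\mathbb R^{p_1\times r_2}$, $\mathbf S_{3,0}\in\mathbb R^{p_2\times r_3}$, $\mathbf S_{4,0}\in\mathbb R^{k_2\times r_4}$, $\mathbf\Lambda_{x_1,0}\in\mathbb R^{p_1\times k_1}$, $\mathbf\Lambda_{x_2,0}\in\mathbb R^{p_2\times k_2}$, $\mathbf\Gamma_0\in\mathbb R^{k_2\times k_1}$ and $\mathbf B_0\in\mathbb R^{k_2\times k_2}$ (with zero diagonal) are constant matrices. Put $\mathbf\Psi_0=\mathbb I_{k_2}-\mathbf B_0$, $\mathbf\Sigma_{\xi\xi,0}=\mathbf S_{1,0}\mathbf S_{1,0}^\top$, $\mathbf\Sigma_{\delta\delta,0}=\mathbf S_{2,0}\mathbf S_{2,0}^\top$, $\mathbf\Sigma_{\varepsilon\varepsilon,0}=\mathbf S_{3,0}\mathbf S_{3,0}^\top$, $\mathbf\Sigma_{\zeta\zeta,0}=\mathbf S_{4,0}\mathbf S_{4,0}^\top$. It is assumed that $\mathbf\Lambda_{x_1,0}$ has full column rank,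 $\mathbf\Psi_0$ is non-singular, and $\mathbf\Sigma_{\delta\delta,0},\mathbf\Sigma_{\varepsilon\varepsilon,0}$ are positive definite. Define $\mathbf\Sigma_0=\begin{pmatrix}\mathbf\Sigma_0^{11}&\mathbf\Sigma_0^{12}\\ \mathbf\Sigma_0^{12\top}&\mathbf\Sigma_0^{22}\end{pmatrix}$ with $\mathbf\Sigma_0^{11}=\mathbf\Lambda_{x_1,0}\mathbf\Sigma_{\xi\xi,0}\mathbf\Lambda_{x_1,0}^\top+\mathbf\Sigma_{\delta\delta,0}$, $\mathbf\Sigma_0^{12}=\mathbf\Lambda_{x_1,0}\mathbf\Sigma_{\xi\xi,0}\mathbf\Gamma_0^\top(\mathbf\Psi_0^{-1})^\top\mathbf\Lambda_{x_2,0}^\top$, $\mathbf\Sigma_0^{22}=\mathbf\Lambda_{x_2,0}\mathbf\Psi_0^{-1}(\mathbf\Gamma_0\mathbf\Sigma_{\xi\xi,0}\mathbf\Gamma_0^\top+\mathbf\Sigma_{\zeta\zeta,0})(\mathbf\Psi_0^{-1})^\top\mathbf\Lambda_{x_2,0}^\top+\mathbf\Sigma_{\varepsilon\varepsilon,0}$. **Observations.** $\mathbb X_t=(\mathbb X_{1,0,t}^\top,\mathbb X_{2,0,t}^\top)^\top$ is observed at $t_i^n=ih_n$, $i=0,\dots,n$, with $h_n=T/n$ and $T>0$ fixed; $\Delta_i\mathbb X=\mathbb X_{t_i^n}-\mathbb X_{t_{i-1}^n}$. **Parametric models.** For $m=1,\dots,M$, Model $m$ has parameter $\theta_m\in\Theta_m$,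 where $\Theta_m\subset\mathbb R^{q_m}$ is convex and compact with locally Lipschitz boundary. It has the same structure, dimensions, drifts $B_i$, Wiener processes $W_{i}$ and initial values $c_i$ as the true model, with the constant matrices replaced by $\theta_m$-dependent matrices $\mathbf\Lambda^\theta_{x_1,m},\mathbf\Lambda^\theta_{x_2,m},\mathbf B^\theta_m$ (zero diagonal), $\mathbf\Gamma^\theta_m,\mathbf S^\theta_{1,m},\dots,\mathbf S^\theta_{4,m}$ of the same sizes. With $\mathbf\Psi^\theta_m,\mathbf\Sigma^\theta_{\xi\xi,m},\mathbf\Sigma^\theta_{\delta\delta,m},\mathbf\Sigma^\theta_{\varepsilon\varepsilon,m},\mathbf\Sigma^\theta_{\zeta\zeta,m}$ defined correspondingly, $\mathbf\Lambda^\theta_{x_1,m}$ has full column rank, $\mathbf\Psi^\theta_m$ is non-singular, $\mathbf\Sigma^\theta_{\delta\delta,m},\mathbf\Sigma^\theta_{\varepsilon\varepsilon,m}$ are positive definite, and $\mathbf\Sigma_m(\theta_m)$ is defined by the same formula as $\mathbf\Sigma_0$ with these matrices. The map $\theta_m\mapsto\mathbf\Sigma_m(\theta_m)$ is twice continuously differentiable on (a neighbourhood of) $\Theta_m$. **Notation.** $A[B]=\mathrm{tr}(AB^\top)$; $A^{\otimes2}=AA^\top$; $|A|=\sqrt{\mathrm{tr}(AA^\top)}$; $A>0$ means positive definite; $\partial^2_{\theta_m}$ is the Hessian. $C^k_\uparrow(\mathbb R^d)$ is the space of $C^k$ functions which, together with all derivatives up to order $k$, are of polynomial growth. **Quasi-likelihood.**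 $$\mathbb L_{m,n}(\theta_m)=\prod_{i=1}^n\frac{1}{(2\pi h_n)^{p/2}\det\mathbf\Sigma_m(\theta_m)^{1/2}}\exp\Bigl(-\frac{1}{2h_n}\mathbf\Sigma_m(\theta_m)^{-1}\bigl[(\Delta_i\mathbb X)^{\otimes2}\bigr]\Bigr),\qquad \mathbb H_{m,n}(\theta_m)=\log\bigl\{(2\pi h_n)^{np/2}\mathbb L_{m,n}(\theta_m)\bigr\}.$$ The quasi-maximum likelihood estimator $\hat\theta_{m,n}$ satisfies $\mathbb L_{m,n}(\hat\theta_{m,n})=\sup_{\theta_m\in\Theta_m}\mathbb L_{m,n}(\theta_m)$. $\pi_{m,n}$ is the prior density of $\theta_m$ on $\Theta_m$. **Information criteria.** Let $J_{m,n}=\{-n^{-1}\partial^2_{\theta_m}\mathbb H_{m,n}(\hat\theta_{m,n})>0\}$, and let $\tilde{\mathbf\Gamma}_{m,n}(\hat\theta_{m,n})$ equal $-n^{-1}\partial^2_{\theta_m}\mathbb H_{m,n}(\hat\theta_{m,n})$ on $J_{m,n}$ and $\mathbb I_{q_m}$ on $J_{m,n}^c$. Set $$\mathrm{QBIC}^{(m)}_{1,n}=-2\mathbb H_{m,n}(\hat\theta_{m,n})+\log\det\bigl\{n\tilde{\mathbf\Gamma}_{m,n}(\hat\theta_{m,n})\bigr\},\qquad \mathrm{QBIC}^{(m)}_{2,n}=-2\mathbb H_{m,n}(\hat\theta_{m,n})+q_m\log n.$$ **Correct specification and optimal model.** $\mathfrak M$ is the set of correctly specified models, i.e. of $m\in\{1,\dots,M\}$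 for which there is $\theta_{m,0}\in\Theta_m$ with $\mathbf\Sigma_0=\mathbf\Sigma_m(\theta_{m,0})$; for $m\in\mathfrak M$ it is assumed that $\theta_{m,0}\in\mathrm{Int}(\Theta_m)$. $\mathfrak M^c=\{1,\dots,M\}\setminus\mathfrak M$ is the set of misspecified models; some, but not all, of the competing models are misspecified. The optimal model $m^*$ is given by $\{m^*\}=\mathrm{argmin}_{m\in\mathfrak M}\dim(\Theta_m)$ with $\dim(\Theta_m)=q_m$, and is assumed to be unique. **Optimal parameter.** Let $$\mathbb H_{m,0}(\theta_m)=-\tfrac12\mathbf\Sigma_m(\theta_m)^{-1}[\mathbf\Sigma_0]-\tfrac12\log\det\mathbf\Sigma_m(\theta_m),$$ and let $\bar\theta_m\in\Theta_m$ satisfy $\mathbb H_{m,0}(\bar\theta_m)=\sup_{\theta_m\in\Theta_m}\mathbb H_{m,0}(\theta_m)$ (for $m\in\mathfrak M$, $\bar\theta_m=\theta_{m,0}$). **[A]** For each pair $(B,Z)\in\{(B_1,\xi_0),(B_2,\delta_0),(B_3,\varepsilon_0),(B_4,\zeta_0)\}$: (i) $B$ is globally Lipschitz; (ii) $\sup_t\mathbf E[|Z_t|^\ell]<\infty$ for all $\ell>0$; (iii) $B\in C^4_\uparrow$. **[B]** For $m\in\mathfrak M$, with $\mathbb U_{m,n}(\theta_{m,0})=\{u_m\in\mathbb R^{q_m}:\theta_{m,0}+n^{-1/2}u_m\in\Theta_m\}$: (a) $\inf_{n}\pi_{m,n}(\theta_{m,0})>0$ and $\sup_{\theta_m\in\Theta_m}\sup_n\pi_{m,n}(\theta_m)<\infty$;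 (b) for each $L>0$, $\sup_{u_m\in\{|u_m|<L\}\cap\mathbb U_{m,n}(\theta_{m,0})}|\pi_{m,n}(\theta_{m,0}+n^{-1/2}u_m)-\pi_{m,n}(\theta_{m,0})|\to0$ as $n\to\infty$. **[C2]** For every $m\in\{1,\dots,M\}$: (a) $\mathbb H_{m,0}(\theta_m)=\mathbb H_{m,0}(\bar\theta_m)$ implies $\theta_m=\bar\theta_m$; (b) $-\partial^2_{\theta_m}\mathbb H_{m,0}(\bar\theta_m)>0$. *)

theory Defs
  imports
    "HOL-Probability.Probability"
    "Jordan_Normal_Form.Determinant"
begin

(* Two matrix libraries are in use. The dimensions p1, p2, k1, k2, r1, ..., r4 are the same for
   all models and are index types (real ^ 'n ^ 'm). The dimension q of the parameter space changes
   with the model; there R^q is the carrier of Euclidean_space q, i.e. the sequences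
   x :: nat => real with x i = 0 for i >= q, and q x q matrices are of the type real mat. *)
no_notation Matrix.vec_index (infixl "$" 100)

section \<open>Calculus on \<open>R^q\<close> for a variable number \<open>q\<close>\<close>

abbreviation Rn :: "nat \<Rightarrow> (nat \<Rightarrow> real) set" where
  "Rn q \<equiv> topspace (Euclidean_space q)"

definition eucl_norm :: "nat \<Rightarrow> (nat \<Rightarrow> real) \<Rightarrow> real" where
  "eucl_norm q x = L2_set x {..<q}"

definition eucl_inner :: "nat \<Rightarrow> (nat \<Rightarrow> real) \<Rightarrow> (nat \<Rightarrow> real) \<Rightarrow> real" where
  "eucl_inner q x y = (\<Sum>i<q. x i * y i)"

definition convex_Rn :: "(nat \<Rightarrow> real) set \<Rightarrow> bool" where
  "convex_Rn A \<longleftrightarrow> (\<forall>x\<in>A. \<forall>y\<in>A. \<forall>u\<in>{0..1}. (\<lambda>i. (1 - u) * x i + u * y i) \<in> A)"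

(* Near each boundary point, A is the part above the graph of a Lipschitz function in some
   orthonormal coordinate system. The last axis of this system is e; the remaining coordinates of
   x are given by the projection of x onto the orthogonal complement of e. *)
definition locally_lipschitz_boundary :: "nat \<Rightarrow> (nat \<Rightarrow> real) set \<Rightarrow> bool" where
  "locally_lipschitz_boundary q A \<longleftrightarrow>
     (\<forall>x0 \<in> Euclidean_space q frontier_of A. \<exists>r>0. \<exists>e\<in>Rn q. \<exists>g L.
        eucl_norm q e = 1 \<and>
        (\<forall>y\<in>Rn q. \<forall>z\<in>Rn q. eucl_inner q y e = 0 \<longrightarrow> eucl_inner q z e = 0 \<longrightarrow>
           \<bar>g y - g z\<bar> \<le> L * eucl_norm q (\<lambda>i. y i - z i)) \<and>
        (\<forall>x\<in>Rn q. eucl_norm q (\<lambda>i. x i - x0 i) < r \<longrightarrow>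
           (x \<in> A \<longleftrightarrow> g (\<lambda>i. x i - eucl_inner q x e * e i) \<le> eucl_inner q x e)))"

definition partial :: "nat \<Rightarrow> ((nat \<Rightarrow> real) \<Rightarrow> real) \<Rightarrow> (nat \<Rightarrow> real) \<Rightarrow> real" where
  "partial i f x = deriv (\<lambda>t. f (x(i := t))) (x i)"

definition has_partial :: "nat \<Rightarrow> ((nat \<Rightarrow> real) \<Rightarrow> real) \<Rightarrow> (nat \<Rightarrow> real) \<Rightarrow> bool" where
  "has_partial i f x \<longleftrightarrow> (\<lambda>t. f (x(i := t))) field_differentiable (at (x i))"

definition C1_on :: "nat \<Rightarrow> (nat \<Rightarrow> real) set \<Rightarrow> ((nat \<Rightarrow> real) \<Rightarrow> real) \<Rightarrow> bool" where
  "C1_on q U f \<longleftrightarrow> continuous_on U f \<and>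
     (\<forall>i<q. (\<forall>x\<in>U. has_partial i f x) \<and> continuous_on U (partial i f))"

definition C2_on :: "nat \<Rightarrow> (nat \<Rightarrow> real) set \<Rightarrow> ((nat \<Rightarrow> real) \<Rightarrow> real) \<Rightarrow> bool" where
  "C2_on q U f \<longleftrightarrow> C1_on q U f \<and> (\<forall>i<q. C1_on q U (partial i f))"

definition hessian :: "nat \<Rightarrow> ((nat \<Rightarrow> real) \<Rightarrow> real) \<Rightarrow> (nat \<Rightarrow> real) \<Rightarrow> real mat" where
  "hessian q f x = Matrix.mat q q (\<lambda>(i, j). partial i (partial j f) x)"

(* Lebesgue measure on R^q *)
definition lborel_Rn :: "nat \<Rightarrow> (nat \<Rightarrow> real) measure" where
  "lborel_Rn q = distr (Pi\<^sub>M {..<q} (\<lambda>_. lborel)) borel (\<lambda>x i. if i < q then x i else 0)"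

definition prior_density :: "nat \<Rightarrow> (nat \<Rightarrow> real) set \<Rightarrow> ((nat \<Rightarrow> real) \<Rightarrow> real) \<Rightarrow> bool" where
  "prior_density q A f \<longleftrightarrow>
     f \<in> borel_measurable (restrict_space borel A) \<and> (\<forall>x\<in>A. 0 \<le> f x) \<and>
     (\<integral>\<^sup>+x\<in>A. ennreal (f x) \<partial>lborel_Rn q) = 1"

section \<open>Matrices\<close>

(* Both notions are only applied to symmetric matrices. *)
definition pos_def :: "real ^ 'n ^ 'n \<Rightarrow> bool" where
  "pos_def A \<longleftrightarrow> (\<forall>x. x \<noteq> 0 \<longrightarrow> 0 < inner x (A *v x))"

definition pos_def_mat :: "nat \<Rightarrow> real mat \<Rightarrow> bool" where
  "pos_def_mat q A \<longleftrightarrow>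
     (\<forall>x\<in>carrier_vec q. x \<noteq> 0\<^sub>v q \<longrightarrow> 0 < scalar_prod x (A *\<^sub>v x))"

(* A[B] = tr (A B^T) *)
definition frob :: "real ^ 'n ^ 'm \<Rightarrow> real ^ 'n ^ 'm \<Rightarrow> real" where
  "frob A B = trace (A ** transpose B)"

(* x x^T for a column vector x *)
definition outer :: "real ^ 'n \<Rightarrow> real ^ 'n ^ 'n" where
  "outer x = (\<chi> i j. x $ i * x $ j)"

definition stack :: "real ^ 'a \<Rightarrow> real ^ 'b \<Rightarrow> real ^ ('a + 'b)" where
  "stack x y = (\<chi> i. case i of Inl a \<Rightarrow> x $ a | Inr b \<Rightarrow> y $ b)"

definition block :: "real ^ 'a ^ 'a \<Rightarrow> real ^ 'b ^ 'a \<Rightarrow> real ^ 'a ^ 'b \<Rightarrow> real ^ 'b ^ 'b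
    \<Rightarrow> real ^ ('a + 'b) ^ ('a + 'b)" where
  "block A B C D = (\<chi> i. case i of Inl a \<Rightarrow> stack (A $ a) (B $ a) | Inr b \<Rightarrow> stack (C $ b) (D $ b))"

section \<open>Stochastic processes\<close>

definition stochastic_basis :: "'w measure \<Rightarrow> (real \<Rightarrow> 'w measure) \<Rightarrow> bool" where
  "stochastic_basis P F \<longleftrightarrow>
     prob_space P \<and> complete_measure P \<and>
     (\<forall>t\<ge>0. subalgebra P (F t)) \<and>
     (\<forall>s t. 0 \<le> s \<longrightarrow> s \<le> t \<longrightarrow> sets (F s) \<subseteq> sets (F t)) \<and>
     null_sets P \<subseteq> sets (F 0) \<and>
     (\<forall>t\<ge>0. sets (F t) = (\<Inter>s\<in>{t<..}. sets (F s)))"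

definition wiener_process ::
    "'w measure \<Rightarrow> (real \<Rightarrow> 'w measure) \<Rightarrow> (real \<Rightarrow> 'w \<Rightarrow> real ^ 'r) \<Rightarrow> bool" where
  "wiener_process P F W \<longleftrightarrow>
     (\<forall>t\<ge>0. W t \<in> borel_measurable (F t)) \<and>
     (AE \<omega> in P. W 0 \<omega> = 0) \<and>
     (AE \<omega> in P. continuous_on {0..} (\<lambda>t. W t \<omega>)) \<and>
     (\<forall>s t. 0 \<le> s \<longrightarrow> s < t \<longrightarrow>
        prob_space.indep_set P (sets (F s))
          {(\<lambda>\<omega>. W t \<omega> - W s \<omega>) -` A \<inter> space P | A. A \<in> sets borel} \<and>
        prob_space.indep_vars P (\<lambda>_. borel) (\<lambda>i \<omega>. (W t \<omega> - W s \<omega>) $ i) UNIV \<and>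
        (\<forall>i. distributed P lborel (\<lambda>\<omega>. (W t \<omega> - W s \<omega>) $ i)
               (\<lambda>x. ennreal (normal_density 0 (sqrt (t - s)) x))))"

definition process_events :: "'w measure \<Rightarrow> (real \<Rightarrow> 'w \<Rightarrow> real ^ 'r) \<Rightarrow> 'w set set" where
  "process_events P W =
     sigma_sets (space P) {W t -` A \<inter> space P | t A. 0 \<le> t \<and> A \<in> sets borel}"

definition indep_processes4 ::
    "'w measure \<Rightarrow> (real \<Rightarrow> 'w \<Rightarrow> real ^ 'r1) \<Rightarrow> (real \<Rightarrow> 'w \<Rightarrow> real ^ 'r2)
      \<Rightarrow> (real \<Rightarrow> 'w \<Rightarrow> real ^ 'r3) \<Rightarrow> (real \<Rightarrow> 'w \<Rightarrow> real ^ 'r4) \<Rightarrow> bool" where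
  "indep_processes4 P W1 W2 W3 W4 \<longleftrightarrow>
     prob_space.indep_sets P
       ((!) [process_events P W1, process_events P W2, process_events P W3, process_events P W4])
       {..<4}"

(* dZ = B(Z) dt + S dW, Z_0 = c. As S is constant, the stochastic integral of S over [0, t] is
   S (W_t - W_0), with W_0 = 0 almost surely. *)
definition sde_solution ::
    "'w measure \<Rightarrow> (real \<Rightarrow> 'w measure) \<Rightarrow> (real \<Rightarrow> 'w \<Rightarrow> real ^ 'r) \<Rightarrow> (real ^ 'd \<Rightarrow> real ^ 'd)
      \<Rightarrow> real ^ 'r ^ 'd \<Rightarrow> real ^ 'd \<Rightarrow> (real \<Rightarrow> 'w \<Rightarrow> real ^ 'd) \<Rightarrow> bool" where
  "sde_solution P F W B S c Z \<longleftrightarrow>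
     (\<forall>t\<ge>0. Z t \<in> borel_measurable (F t)) \<and>
     (AE \<omega> in P. continuous_on {0..} (\<lambda>t. Z t \<omega>) \<and>
        (\<forall>t\<ge>0. (\<lambda>s. B (Z s \<omega>)) integrable_on {0..t} \<and>
           Z t \<omega> = c + integral {0..t} (\<lambda>s. B (Z s \<omega>)) + S *v W t \<omega>))"

fun iter_partial :: "'d list \<Rightarrow> (real ^ 'd \<Rightarrow> real) \<Rightarrow> real ^ 'd \<Rightarrow> real" where
  "iter_partial [] f = f"
| "iter_partial (i # is) f = (\<lambda>x. deriv (\<lambda>t. iter_partial is f (x + t *\<^sub>R axis i 1)) 0)"

definition polynomial_growth :: "(real ^ 'd \<Rightarrow> real) \<Rightarrow> bool" where
  "polynomial_growth f \<longleftrightarrow> (\<exists>C N. \<forall>x. \<bar>f x\<bar> \<le> C * (1 + norm x) ^ N)"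

definition C_poly :: "nat \<Rightarrow> (real ^ 'd \<Rightarrow> real) \<Rightarrow> bool" where
  "C_poly k f \<longleftrightarrow>
     (\<forall>is. length is \<le> k \<longrightarrow>
        continuous_on UNIV (iter_partial is f) \<and> polynomial_growth (iter_partial is f) \<and>
        (length is < k \<longrightarrow>
           (\<forall>x i. (\<lambda>t. iter_partial is f (x + t *\<^sub>R axis i 1)) field_differentiable (at 0))))"

definition condition_A ::
    "'w measure \<Rightarrow> (real ^ 'd \<Rightarrow> real ^ 'd) \<Rightarrow> (real \<Rightarrow> 'w \<Rightarrow> real ^ 'd) \<Rightarrow> bool" where
  "condition_A P B Z \<longleftrightarrow>
     (\<exists>L. L-lipschitz_on UNIV B) \<and>
     (\<forall>l>0. (SUP t\<in>{0..}. \<integral>\<^sup>+\<omega>. ennreal (norm (Z t \<omega>) powr l) \<partial>P) < \<infinity>) \<and>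
     (\<forall>j. C_poly 4 (\<lambda>x. B x $ j))"

section \<open>Structural equation models\<close>

record ('p1::finite, 'p2::finite, 'k1::finite, 'k2::finite,
        'r1::finite, 'r2::finite, 'r3::finite, 'r4::finite) sem =
  Lam1 :: "real ^ 'k1 ^ 'p1"
  Lam2 :: "real ^ 'k2 ^ 'p2"
  Bmat :: "real ^ 'k2 ^ 'k2"
  Gam :: "real ^ 'k1 ^ 'k2"
  S1 :: "real ^ 'r1 ^ 'k1"
  S2 :: "real ^ 'r2 ^ 'p1"
  S3 :: "real ^ 'r3 ^ 'p2"
  S4 :: "real ^ 'r4 ^ 'k2"

definition Psi :: "('p1::finite, 'p2::finite, 'k1::finite, 'k2::finite,
    'r1::finite, 'r2::finite, 'r3::finite, 'r4::finite) sem \<Rightarrow> real ^ 'k2 ^ 'k2" where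
  "Psi \<M> = Finite_Cartesian_Product.mat 1 - Bmat \<M>"

definition sem_regular :: "('p1::finite, 'p2::finite, 'k1::finite, 'k2::finite,
    'r1::finite, 'r2::finite, 'r3::finite, 'r4::finite) sem \<Rightarrow> bool" where
  "sem_regular \<M> \<longleftrightarrow>
     (\<forall>i. Bmat \<M> $ i $ i = 0) \<and>
     rank (Lam1 \<M>) = CARD('k1) \<and>
     invertible (Psi \<M>) \<and>
     pos_def (S2 \<M> ** transpose (S2 \<M>)) \<and>
     pos_def (S3 \<M> ** transpose (S3 \<M>))"

definition sem_Sigma :: "('p1::finite, 'p2::finite, 'k1::finite, 'k2::finite,
    'r1::finite, 'r2::finite, 'r3::finite, 'r4::finite) sem \<Rightarrow> real ^ ('p1 + 'p2) ^ ('p1 + 'p2)" where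
  "sem_Sigma \<M> =
    (let \<Sigma>\<xi> = S1 \<M> ** transpose (S1 \<M>);
         \<Sigma>\<delta> = S2 \<M> ** transpose (S2 \<M>);
         \<Sigma>\<epsilon> = S3 \<M> ** transpose (S3 \<M>);
         \<Sigma>\<zeta> = S4 \<M> ** transpose (S4 \<M>);
         \<Psi>i = matrix_inv (Psi \<M>);
         A11 = Lam1 \<M> ** \<Sigma>\<xi> ** transpose (Lam1 \<M>) + \<Sigma>\<delta>;
         A12 = Lam1 \<M> ** \<Sigma>\<xi> ** transpose (Gam \<M>) ** transpose \<Psi>i ** transpose (Lam2 \<M>);
         A22 = Lam2 \<M> ** \<Psi>i ** (Gam \<M> ** \<Sigma>\<xi> ** transpose (Gam \<M>) + \<Sigma>\<zeta>)
                 ** transpose \<Psi>i ** transpose (Lam2 \<M>) + \<Sigma>\<epsilon>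
     in block A11 A12 (transpose A12) A22)"

(* The model equations of the true model. X is the observable process (X1, X2). *)
definition sem_observation ::
    "'w measure \<Rightarrow> ('p1::finite, 'p2::finite, 'k1::finite, 'k2::finite,
        'r1::finite, 'r2::finite, 'r3::finite, 'r4::finite) sem
      \<Rightarrow> (real \<Rightarrow> 'w \<Rightarrow> real ^ 'k1) \<Rightarrow> (real \<Rightarrow> 'w \<Rightarrow> real ^ 'p1) \<Rightarrow> (real \<Rightarrow> 'w \<Rightarrow> real ^ 'p2)
      \<Rightarrow> (real \<Rightarrow> 'w \<Rightarrow> real ^ 'k2) \<Rightarrow> (real \<Rightarrow> 'w \<Rightarrow> real ^ 'k2)
      \<Rightarrow> (real \<Rightarrow> 'w \<Rightarrow> real ^ ('p1 + 'p2)) \<Rightarrow> bool" where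
  "sem_observation P \<M> \<xi> \<delta> \<epsilon> \<zeta> \<eta> X \<longleftrightarrow>
     (\<forall>t\<ge>0. \<forall>\<omega>\<in>space P.
        \<eta> t \<omega> = Bmat \<M> *v \<eta> t \<omega> + Gam \<M> *v \<xi> t \<omega> + \<zeta> t \<omega> \<and>
        X t \<omega> = stack (Lam1 \<M> *v \<xi> t \<omega> + \<delta> t \<omega>) (Lam2 \<M> *v \<eta> t \<omega> + \<epsilon> t \<omega>))"

(* The map from the parameter to the matrices need not be smooth, only the covariance matrix is.
   The neighbourhood U makes the derivatives at boundary points of the parameter set meaningful. *)
definition parametric_model ::
    "nat \<Rightarrow> (nat \<Rightarrow> real) set \<Rightarrow> ((nat \<Rightarrow> real) \<Rightarrow> ('p1::finite, 'p2::finite, 'k1::finite, 'k2::finite,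
        'r1::finite, 'r2::finite, 'r3::finite, 'r4::finite) sem) \<Rightarrow> bool" where
  "parametric_model q \<Theta> mdl \<longleftrightarrow>
     1 \<le> q \<and> convex_Rn \<Theta> \<and> compactin (Euclidean_space q) \<Theta> \<and> locally_lipschitz_boundary q \<Theta> \<and>
     (\<forall>\<theta>\<in>\<Theta>. sem_regular (mdl \<theta>)) \<and>
     (\<exists>U. openin (Euclidean_space q) U \<and> \<Theta> \<subseteq> U \<and>
        (\<forall>i j. C2_on q U (\<lambda>\<theta>. sem_Sigma (mdl \<theta>) $ i $ j)))"

definition correct_models ::
    "nat \<Rightarrow> (nat \<Rightarrow> (nat \<Rightarrow> real) set) \<Rightarrow> (nat \<Rightarrow> (nat \<Rightarrow> real) \<Rightarrow> ('p1::finite, 'p2::finite,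
        'k1::finite, 'k2::finite, 'r1::finite, 'r2::finite, 'r3::finite, 'r4::finite) sem)
      \<Rightarrow> ('p1, 'p2, 'k1, 'k2, 'r1, 'r2, 'r3, 'r4) sem \<Rightarrow> nat set" where
  "correct_models M \<Theta> mdl \<M>0 =
     {m \<in> {1..M}. \<exists>\<theta>\<in>\<Theta> m. sem_Sigma \<M>0 = sem_Sigma (mdl m \<theta>)}"

section \<open>Quasi-likelihood and information criteria\<close>

(* In this section x is an observed path, Sig the map from the parameter to the covariance matrix *)

definition incr :: "real \<Rightarrow> nat \<Rightarrow> (real \<Rightarrow> real ^ 'p) \<Rightarrow> nat \<Rightarrow> real ^ 'p" where
  "incr T n x i = x (real i * (T / real n)) - x (real (i - 1) * (T / real n))"

definition quasi_lik :: "real \<Rightarrow> nat \<Rightarrow> (real \<Rightarrow> real ^ 'p) \<Rightarrow> ((nat \<Rightarrow> real) \<Rightarrow> real ^ 'p ^ 'p)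
    \<Rightarrow> (nat \<Rightarrow> real) \<Rightarrow> real" where
  "quasi_lik T n x Sig \<theta> =
    (let h = T / real n in
     \<Prod>i=1..n. 1 / ((2 * pi * h) powr (real CARD('p) / 2) * sqrt (Determinants.det (Sig \<theta>)))
        * exp (- (1 / (2 * h)) * frob (matrix_inv (Sig \<theta>)) (outer (incr T n x i))))"

definition quasi_loglik :: "real \<Rightarrow> nat \<Rightarrow> (real \<Rightarrow> real ^ 'p) \<Rightarrow> ((nat \<Rightarrow> real) \<Rightarrow> real ^ 'p ^ 'p)
    \<Rightarrow> (nat \<Rightarrow> real) \<Rightarrow> real" where
  "quasi_loglik T n x Sig \<theta> =
     ln ((2 * pi * (T / real n)) powr (real n * real CARD('p) / 2) * quasi_lik T n x Sig \<theta>)"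

definition limit_loglik :: "real ^ 'p ^ 'p \<Rightarrow> ((nat \<Rightarrow> real) \<Rightarrow> real ^ 'p ^ 'p) \<Rightarrow> (nat \<Rightarrow> real) \<Rightarrow> real" where
  "limit_loglik Sig0 Sig \<theta> =
     - (1 / 2) * frob (matrix_inv (Sig \<theta>)) Sig0 - 1 / 2 * ln (Determinants.det (Sig \<theta>))"

definition obs_information :: "nat \<Rightarrow> real \<Rightarrow> nat \<Rightarrow> (real \<Rightarrow> real ^ 'p)
    \<Rightarrow> ((nat \<Rightarrow> real) \<Rightarrow> real ^ 'p ^ 'p) \<Rightarrow> (nat \<Rightarrow> real) \<Rightarrow> real mat" where
  "obs_information q T n x Sig \<theta> =
     (let J = (- (1 / real n)) \<cdot>\<^sub>m hessian q (quasi_loglik T n x Sig) \<theta>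
      in if pos_def_mat q J then J else 1\<^sub>m q)"

definition QBIC1 :: "nat \<Rightarrow> real \<Rightarrow> nat \<Rightarrow> (real \<Rightarrow> real ^ 'p)
    \<Rightarrow> ((nat \<Rightarrow> real) \<Rightarrow> real ^ 'p ^ 'p) \<Rightarrow> (nat \<Rightarrow> real) \<Rightarrow> real" where
  "QBIC1 q T n x Sig \<theta> =
     - 2 * quasi_loglik T n x Sig \<theta>
     + ln (Determinant.det (real n \<cdot>\<^sub>m obs_information q T n x Sig \<theta>))"

definition QBIC2 :: "nat \<Rightarrow> real \<Rightarrow> nat \<Rightarrow> (real \<Rightarrow> real ^ 'p)
    \<Rightarrow> ((nat \<Rightarrow> real) \<Rightarrow> real ^ 'p ^ 'p) \<Rightarrow> (nat \<Rightarrow> real) \<Rightarrow> real" where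
  "QBIC2 q T n x Sig \<theta> = - 2 * quasi_loglik T n x Sig \<theta> + real q * ln (real n)"

definition QMLE :: "'w measure \<Rightarrow> real \<Rightarrow> (real \<Rightarrow> 'w \<Rightarrow> real ^ 'p) \<Rightarrow> (nat \<Rightarrow> real) set
    \<Rightarrow> ((nat \<Rightarrow> real) \<Rightarrow> real ^ 'p ^ 'p) \<Rightarrow> (nat \<Rightarrow> 'w \<Rightarrow> nat \<Rightarrow> real) \<Rightarrow> bool" where
  "QMLE P T X \<Theta> Sig est \<longleftrightarrow>
     (\<forall>n\<ge>1. est n \<in> borel_measurable P \<and>
        (\<forall>\<omega>\<in>space P. est n \<omega> \<in> \<Theta> \<and>
           quasi_lik T n (\<lambda>t. X t \<omega>) Sig (est n \<omega>) =
             (SUP \<theta>\<in>\<Theta>. quasi_lik T n (\<lambda>t. X t \<omega>) Sig \<theta>)))"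

definition optimal_parameter :: "real ^ 'p ^ 'p \<Rightarrow> (nat \<Rightarrow> real) set
    \<Rightarrow> ((nat \<Rightarrow> real) \<Rightarrow> real ^ 'p ^ 'p) \<Rightarrow> (nat \<Rightarrow> real) \<Rightarrow> bool" where
  "optimal_parameter Sig0 \<Theta> Sig \<theta>bar \<longleftrightarrow> \<theta>bar \<in> \<Theta> \<and>
     limit_loglik Sig0 Sig \<theta>bar = (SUP \<theta>\<in>\<Theta>. limit_loglik Sig0 Sig \<theta>)"

definition condition_B :: "nat \<Rightarrow> (nat \<Rightarrow> real) set \<Rightarrow> (nat \<Rightarrow> real)
    \<Rightarrow> (nat \<Rightarrow> (nat \<Rightarrow> real) \<Rightarrow> real) \<Rightarrow> bool" where
  "condition_B q \<Theta> \<theta>0 prior \<longleftrightarrow>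
     0 < (INF n\<in>{1..}. prior n \<theta>0) \<and>
     bdd_above {prior n \<theta> | n \<theta>. 1 \<le> n \<and> \<theta> \<in> \<Theta>} \<and>
     (\<forall>L>0. (\<lambda>n. SUP u\<in>{u \<in> Rn q. eucl_norm q u < L \<and> (\<lambda>i. \<theta>0 i + u i / sqrt (real n)) \<in> \<Theta>}.
         \<bar>prior n (\<lambda>i. \<theta>0 i + u i / sqrt (real n)) - prior n \<theta>0\<bar>) \<longlonglongrightarrow> 0)"

definition condition_C2 :: "nat \<Rightarrow> real ^ 'p ^ 'p \<Rightarrow> (nat \<Rightarrow> real) set
    \<Rightarrow> ((nat \<Rightarrow> real) \<Rightarrow> real ^ 'p ^ 'p) \<Rightarrow> (nat \<Rightarrow> real) \<Rightarrow> bool" where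
  "condition_C2 q Sig0 \<Theta> Sig \<theta>bar \<longleftrightarrow>
     (\<forall>\<theta>\<in>\<Theta>. limit_loglik Sig0 Sig \<theta> = limit_loglik Sig0 Sig \<theta>bar \<longrightarrow> \<theta> = \<theta>bar) \<and>
     pos_def_mat q (- hessian q (limit_loglik Sig0 Sig) \<theta>bar)"

end

(* Where det Sigma(theta) > 0, the quasi-log-likelihood at theta equals n times the limit
   log-likelihood in which the true covariance matrix is replaced by the realized covariance
   S_n = T^{-1} sum_i (Delta_i X)(Delta_i X)^T (quasi_loglik_eq). All randomness thus enters through
   S_n, linearly. If S_n converges to Sigma_0 along some sequence of n on a fixed path, compactness
   of Theta and uniqueness of the maximizer give theta_hat -> theta_bar, the normalized observed
   information converges to the Hessian of H_0 at theta_bar, which is invertible, and both criteria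
   divided by n converge to -2 H_0(theta_bar). This limit is strictly larger for a misspecified
   model, by the Gibbs inequality for Gaussian laws.
   S_n converges almost surely along subsequences: X minus a linear image of the Wiener processes is
   pathwise Lipschitz, and the realized covariance of the Wiener processes converges in L^2 because
   the summands are centred and orthogonal. The subsequence principle gives the claim. As measure P
   vanishes on non-measurable sets, the compared criteria also have to be shown measurable. *)
theory Submission
  imports Defs
begin

section \<open>Symmetric matrices\<close>


text \<open>The two limits differ by a positive constant, so the difference of the criteria grows
  like \<open>n\<close>, while \<open>q ln n\<close> and the log-determinant of the information are
  \<open>O(ln n)\<close> along a path on which the realized covariance converges. A law of large
  numbers therefore suffices, without expanding the estimator around its limit. Replacing the
  information by the identity does no harm, since the identity has log-determinant 0. Regularity of
  the covariance matrices is known on \<Theta> only, whereas derivatives call for an open set; the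
  neighbourhood of \<Theta> is cut down to the points with positive determinant. There the
  log-likelihood is a finite sum of products, one factor depending on \<open>S\<close> and the other
  a C^2 function of \<theta>. Hence it and its Hessian are jointly continuous in \<open>S\<close>
  and \<theta>, which takes the place of uniform convergence in \<theta>. Independence of an
  increment from the past is given for each Wiener process separately, not for the four jointly;
  products of increments of two different processes need an argument of their own.\<close>

text \<open>Maximize the Rayleigh quotient on the unit sphere of \<open>V\<close>. At a maximizer
  \<open>x\<close>, stationarity makes \<open>f x\<close> orthogonal to every \<open>y\<close> in
  \<open>V\<close> with \<open>y\<close> orthogonal to \<open>x\<close>; the residual
  \<open>f x - l x\<close> is such a \<open>y\<close>, hence orthogonal to itself. A general
  invariant \<open>V\<close> is allowed because the result is applied to successive orthogonal
  complements.\<close>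

lemma eigenvector_of_max:
  fixes f :: "'a::euclidean_space \<Rightarrow> 'a"
  assumes lin: "linear f" and sym: "\<And>x y. inner x (f y) = inner (f x) y"
    and V: "Real_Vector_Spaces.subspace V" and inv: "\<And>v. v \<in> V \<Longrightarrow> f v \<in> V" and nz: "V \<noteq> {0}"
  shows "\<exists>x\<in>V. norm x = 1 \<and> f x = (inner x (f x)) *\<^sub>R x"
proof -
  let ?K = "V \<inter> sphere 0 1"
  obtain v where v: "v \<in> V" "v \<noteq> 0" using nz Real_Vector_Spaces.subspace_0[OF V] by auto
  then have "(1 / norm v) *\<^sub>R v \<in> ?K"
    using Real_Vector_Spaces.subspace_scale[OF V] by auto
  then have ne: "?K \<noteq> {}" by blast
  have cK: "compact ?K"
    using closed_subspace[OF V] by (metis closed_Int_compact compact_sphere)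
  have cf: "continuous_on ?K (\<lambda>x. inner x (f x))"
    using lin by (intro continuous_intros linear_continuous_on) (simp add: linear_conv_bounded_linear)
  obtain x where x: "x \<in> ?K" and xmax: "\<And>y. y \<in> ?K \<Longrightarrow> inner y (f y) \<le> inner x (f x)"
    using continuous_attains_sup[OF cK ne cf] by blast
  define l where "l = inner x (f x)"
  have nx: "inner x x = 1" using x by (simp add: norm_eq_1)
  have bound: "inner y (f y) \<le> l * inner y y" if "y \<in> V" for y
  proof (cases "y = 0")
    case True then show ?thesis using lin by (simp add: linear_0)
  next
    case False
    let ?u = "(1 / norm y) *\<^sub>R y"
    have "?u \<in> ?K" using False that Real_Vector_Spaces.subspace_scale[OF V] by auto
    then have "inner ?u (f ?u) \<le> l" unfolding l_def by (rule xmax)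
    moreover have "inner ?u (f ?u) = inner y (f y) / (norm y)^2"
      using lin by (simp add: linear_cmul power2_eq_square)
    ultimately have "inner y (f y) / (norm y)^2 \<le> l" by metis
    then show ?thesis using False by (simp add: pos_divide_le_eq power2_norm_eq_inner)
  qed
  have orth: "inner y (f x) = 0" if y: "y \<in> V" "inner x y = 0" for y
  proof -
    define a where "a = inner y (f x)"
    define c where "c = l * inner y y - inner y (f y)"
    have c0: "c \<ge> 0" using bound[OF y(1)] by (simp add: c_def)
    have "0 \<le> t^2 * c - 2 * t * a" for t
    proof -
      have "x + t *\<^sub>R y \<in> V"
        using x y V by (intro Real_Vector_Spaces.subspace_add Real_Vector_Spaces.subspace_scale) auto
      from bound[OF this] have "inner (x + t *\<^sub>R y) (f x + t *\<^sub>R f y) \<le> l * (1 + t^2 * inner y y)"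
        using lin y nx by (simp add: linear_add linear_cmul inner_add inner_commute power2_eq_square)
      moreover have "inner (x + t *\<^sub>R y) (f x + t *\<^sub>R f y) = l + 2 * t * a + t^2 * inner y (f y)"
        using sym[of x y] by (simp add: inner_add l_def a_def power2_eq_square inner_commute)
      ultimately show ?thesis by (simp add: c_def algebra_simps)
    qed
    \<comment> \<open>A quadratic \<open>t^2 c - 2 t a\<close> that is nonnegative for all
      \<open>t\<close> has \<open>a = 0\<close>. The minimizer would be \<open>a / c\<close>; adding
      1 covers \<open>c = 0\<close>.\<close>
    from this[of "a / (c + 1)"] have "0 \<le> (a / (c + 1))^2 * c - 2 * (a / (c + 1)) * a" .
    also have "\<dots> = - (a^2 * (c + 2) / (c + 1)^2)"
      using c0 by (simp add: divide_simps power2_eq_square) (simp add: algebra_simps)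
    finally have "a^2 * (c + 2) / (c + 1)^2 \<le> 0" by simp
    then have "a^2 * (c + 2) \<le> 0" using c0 by (simp add: divide_le_0_iff)
    then have "a = 0" using c0 by (simp add: mult_le_0_iff)
    then show ?thesis by (simp add: a_def)
  qed
  define z where "z = f x - l *\<^sub>R x"
  have "z \<in> V" using x inv V unfolding z_def
    by (intro Real_Vector_Spaces.subspace_diff Real_Vector_Spaces.subspace_scale) auto
  moreover have xz: "inner x z = 0" by (simp add: z_def inner_diff_right l_def nx)
  ultimately have "inner z (f x) = 0" by (rule orth)
  moreover have "inner z z = inner z (f x) - l * inner z x" by (simp add: z_def inner_diff_right inner_diff_left)
  ultimately have "inner z z = 0" using xz by (simp add: inner_commute)
  then have "f x = l *\<^sub>R x" by (simp add: z_def)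
  then show ?thesis using x by (auto simp: l_def)
qed

text \<open>Induction on the dimension: split off one unit eigenvector; its orthogonal complement
  inside \<open>V\<close> is again invariant because \<open>f\<close> is self-adjoint.\<close>

lemma selfadjoint_orthonormal_eigenbasis:
  fixes f :: "'a::euclidean_space \<Rightarrow> 'a"
  assumes lin: "linear f" and sym: "\<And>x y. inner x (f y) = inner (f x) y"
  shows "Real_Vector_Spaces.subspace V \<Longrightarrow> (\<And>v. v \<in> V \<Longrightarrow> f v \<in> V) \<Longrightarrow>
    \<exists>B. pairwise real_inner_class.orthogonal B \<and> (\<forall>b\<in>B. norm b = 1 \<and> f b = inner b (f b) *\<^sub>R b) \<and> Real_Vector_Spaces.span B = V"
proof (induction "Real_Vector_Spaces.dim V" arbitrary: V rule: less_induct)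
  case less
  note V = less.prems(1)
  show ?case
  proof (cases "V = {0}")
    case True
    then show ?thesis by (intro exI[of _ "{}"]) auto
  next
    case False
    obtain x where x: "x \<in> V" "norm x = 1" "f x = (inner x (f x)) *\<^sub>R x"
      using eigenvector_of_max[OF lin sym V less.prems(2) False] by blast
    define V' where "V' = V \<inter> {y. inner x y = 0}"
    have V': "Real_Vector_Spaces.subspace V'"
      unfolding V'_def using V by (intro Real_Vector_Spaces.subspace_inter subspace_hyperplane)
    have "inner x x = 1" using x by (simp add: norm_eq_1)
    then have "x \<notin> V'" by (simp add: V'_def)
    then have "V' \<subset> V" using x(1) unfolding V'_def by blast
    then have "Real_Vector_Spaces.dim V' < Real_Vector_Spaces.dim V"
      using dim_psubset[of V' V] V V' by (metis Real_Vector_Spaces.span_eq_iff)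
    moreover have "f v \<in> V'" if "v \<in> V'" for v
    proof -
      have "inner x (f v) = inner x (f x) * inner x v"
        by (subst sym, subst x(3)) simp
      then show ?thesis using that less.prems(2) by (auto simp: V'_def)
    qed
    ultimately obtain B where B: "pairwise real_inner_class.orthogonal B"
      "\<forall>b\<in>B. norm b = 1 \<and> f b = inner b (f b) *\<^sub>R b" "Real_Vector_Spaces.span B = V'"
      using less.hyps[OF _ V'] by blast
    have BV': "B \<subseteq> V'" using B(3) Real_Vector_Spaces.span_superset by blast
    have "pairwise real_inner_class.orthogonal (insert x B)"
      using B(1) BV' by (auto simp: pairwise_insert real_inner_class.orthogonal_def V'_def inner_commute)
    moreover have "Real_Vector_Spaces.span (insert x B) = V"
    proof
      show "Real_Vector_Spaces.span (insert x B) \<subseteq> V"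
        using BV' x V by (intro Real_Vector_Spaces.span_minimal) (auto simp: V'_def)
      show "V \<subseteq> Real_Vector_Spaces.span (insert x B)"
      proof
        fix v assume v: "v \<in> V"
        have "v - inner x v *\<^sub>R x \<in> V'"
          using v x V unfolding V'_def
          by (auto simp: inner_diff_right norm_eq_1 intro!: Real_Vector_Spaces.subspace_diff Real_Vector_Spaces.subspace_scale)
        then show "v \<in> Real_Vector_Spaces.span (insert x B)"
          unfolding Real_Vector_Spaces.span_insert B(3) by blast
      qed
    qed
    ultimately show ?thesis using x B(2) by (intro exI[of _ "insert x B"]) auto
  qed
qed

section \<open>Diagonalization, inverses and determinants\<close>

lemma inner_transpose_mult:
  fixes A :: "real ^ 'm::finite ^ 'n::finite"
  shows "inner (transpose A *v x) y = inner x (A *v y)"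
  by (simp add: dot_lmul_matrix vector_transpose_matrix)

lemma inner_mult_transpose:
  fixes A :: "real ^ 'm::finite ^ 'n::finite"
  shows "inner x (A *v y) = inner (transpose A *v x) y"
  by (rule inner_transpose_mult[symmetric])

text \<open>\<open>matrix_inv\<close> is a choice operator, so a given inverse must be shown to be
  the only possible choice; for square matrices a right inverse is also a left inverse.\<close>

lemma matrix_inv_eqI:
  fixes A B :: "real ^ 'n::finite ^ 'n"
  assumes "A ** B = Finite_Cartesian_Product.mat 1"
  shows "matrix_inv A = B"
proof -
  have BA: "B ** A = Finite_Cartesian_Product.mat 1" using assms matrix_left_right_inverse by blast
  show ?thesis unfolding matrix_inv_def
  proof (rule some_equality)
    show "A ** B = Finite_Cartesian_Product.mat 1 \<and> B ** A = Finite_Cartesian_Product.mat 1"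
      using assms BA by simp
    show "C = B" if "A ** C = Finite_Cartesian_Product.mat 1 \<and> C ** A = Finite_Cartesian_Product.mat 1" for C
      by (metis assms that matrix_mul_assoc matrix_mul_lid matrix_mul_rid)
  qed
qed

lemma matrix_inv_left_invertible:
  fixes A :: "real ^ 'n::finite ^ 'n"
  assumes "invertible A"
  shows "matrix_inv A ** A = Finite_Cartesian_Product.mat 1"
  using assms matrix_inv_eqI by (metis invertible_def)

definition diag_matrix :: "('n \<Rightarrow> real) \<Rightarrow> real ^ 'n ^ 'n" where
  "diag_matrix d = (\<chi> i j. if i = j then d i else 0)"

lemma diag_matrix_mult [simp]:
  fixes a b :: "'n::finite \<Rightarrow> real"
  shows "diag_matrix a ** diag_matrix b = diag_matrix (\<lambda>i. a i * b i)"
  by (simp add: diag_matrix_def matrix_matrix_mult_def Finite_Cartesian_Product.vec_eq_iff if_distrib[of "\<lambda>x. x * _"] if_distrib[of "\<lambda>x. _ * x"] cong: if_cong)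

lemma transpose_diag_matrix [simp]: "transpose (diag_matrix d) = diag_matrix d"
  by (auto simp: diag_matrix_def transpose_def Finite_Cartesian_Product.vec_eq_iff)

lemma diag_matrix_one: "diag_matrix (\<lambda>_. 1) = Finite_Cartesian_Product.mat 1"
  by (simp add: diag_matrix_def Finite_Cartesian_Product.mat_def)

lemma det_diag_matrix [simp]: "Determinants.det (diag_matrix d :: real ^ 'n ^ 'n::finite) = prod d UNIV"
  by (subst det_diagonal) (auto simp: diag_matrix_def)

lemma trace_diag_matrix [simp]: "trace (diag_matrix d :: real ^ 'n ^ 'n::finite) = sum d UNIV"
  by (simp add: trace_def diag_matrix_def)

text \<open>An orthonormal eigenbasis has \<open>CARD('n)\<close> elements, so it can be indexed by
  \<open>'n\<close> itself and used as the columns of \<open>Q\<close>.\<close>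

lemma symmetric_matrix_diagonalization:
  fixes A :: "real ^ 'n::finite ^ 'n"
  assumes "transpose A = A"
  shows "\<exists>Q d. orthogonal_matrix Q \<and> A = Q ** diag_matrix d ** transpose Q"
proof -
  have sym: "inner x (A *v y) = inner (A *v x) y" for x y
    using inner_transpose_mult[of A x y] assms by simp
  obtain B where B: "pairwise real_inner_class.orthogonal B"
      "\<forall>b\<in>B. norm b = 1 \<and> A *v b = inner b (A *v b) *\<^sub>R b" "Real_Vector_Spaces.span B = UNIV"
    using selfadjoint_orthonormal_eigenbasis[of "(*v) A" UNIV, OF _ sym] by auto
  have indep: "Real_Vector_Spaces.independent B"
    using B by (intro pairwise_orthogonal_independent) auto
  have "card B = CARD('n)"
    using Real_Vector_Spaces.dim_eq_card_independent[OF indep] Real_Vector_Spaces.dim_span[of B] B(3) by simp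
  moreover have finB: "finite B" using indep by (rule independent_imp_finite)
  ultimately obtain b :: "'n \<Rightarrow> real ^ 'n" where b: "bij_betw b UNIV B"
    by (metis finite_class.finite_UNIV finite_same_card_bij)
  have b1: "norm (b i) = 1" "A *v b i = inner (b i) (A *v b i) *\<^sub>R b i" for i
    using b B(2) bij_betwE by blast+
  have bo: "inner (b i) (b j) = (if i = j then 1 else 0)" for i j
  proof (cases "i = j")
    case True then show ?thesis using b1(1)[of i] by (simp add: norm_eq_1)
  next
    case False
    then have "b i \<noteq> b j" using b by (metis UNIV_I bij_betw_imp_inj_on inj_on_def)
    then show ?thesis using b B(1) False
      by (metis UNIV_I bij_betwE pairwiseD real_inner_class.orthogonal_def)
  qed
  define Q where "Q = (\<chi> i j. b j $ i)"
  define d where "d = (\<lambda>i. inner (b i) (A *v b i))"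
  have "transpose Q ** Q = Finite_Cartesian_Product.mat 1"
    using bo by (simp add: Finite_Cartesian_Product.vec_eq_iff matrix_matrix_mult_def transpose_def Q_def Finite_Cartesian_Product.mat_def inner_vec_def)
  then have Q: "orthogonal_matrix Q" by (simp add: orthogonal_matrix)
  have "A ** Q = Q ** diag_matrix d"
  proof -
    have "(A ** Q) $ i $ j = (Q ** diag_matrix d) $ i $ j" for i j
    proof -
      have "(A ** Q) $ i $ j = (A *v b j) $ i"
        by (simp add: matrix_matrix_mult_def matrix_vector_mult_def Q_def)
      also have "\<dots> = d j * b j $ i" by (subst b1(2)) (simp add: d_def)
      also have "\<dots> = (Q ** diag_matrix d) $ i $ j"
        by (simp add: matrix_matrix_mult_def diag_matrix_def Q_def if_distrib[of "\<lambda>x. _ * x"] cong: if_cong)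
      finally show ?thesis .
    qed
    then show ?thesis by (simp add: Finite_Cartesian_Product.vec_eq_iff)
  qed
  then have "A ** (Q ** transpose Q) = Q ** diag_matrix d ** transpose Q"
    by (simp add: matrix_mul_assoc)
  then show ?thesis using Q by (auto simp: orthogonal_matrix_def)
qed

lemma orthogonal_matrix_cancel:
  fixes Q A B :: "real ^ 'n::finite ^ 'n"
  assumes "orthogonal_matrix Q"
  shows "(A ** transpose Q) ** (Q ** B) = A ** B"
  using assms by (metis matrix_mul_assoc matrix_mul_rid orthogonal_matrix_def)

lemma det_diagonalized:
  fixes Q :: "real ^ 'n::finite ^ 'n"
  assumes "orthogonal_matrix Q"
  shows "Determinants.det (Q ** diag_matrix d ** transpose Q) = prod d UNIV"
proof -
  have "Determinants.det Q * Determinants.det Q = 1"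
    using det_orthogonal_matrix[OF assms] by auto
  then show ?thesis by (simp add: det_mul det_transpose algebra_simps)
qed

lemma trace_diagonalized:
  fixes Q :: "real ^ 'n::finite ^ 'n"
  assumes "orthogonal_matrix Q"
  shows "trace (Q ** diag_matrix d ** transpose Q) = sum d UNIV"
proof -
  have "trace (Q ** diag_matrix d ** transpose Q) = trace (transpose Q ** (Q ** diag_matrix d))"
    by (rule trace_mul_sym)
  then show ?thesis using assms by (simp add: matrix_mul_assoc orthogonal_matrix_def)
qed

lemma pos_def_diagonalization:
  fixes A :: "real ^ 'n::finite ^ 'n"
  assumes "transpose A = A" "pos_def A"
  shows "\<exists>Q d. orthogonal_matrix Q \<and> A = Q ** diag_matrix d ** transpose Q \<and> (\<forall>i. d i > 0)"
proof -
  obtain Q d where Q: "orthogonal_matrix Q" and A: "A = Q ** diag_matrix d ** transpose Q"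
    using symmetric_matrix_diagonalization[OF assms(1)] by blast
  have "d i > 0" for i
  proof -
    \<comment> \<open>The i-th eigenvector: its quadratic form under \<open>A\<close> is exactly
      \<open>d i\<close>.\<close>
    define x where "x = Q *v axis i 1"
    have tx: "transpose Q *v x = axis i 1"
      using Q by (simp add: x_def matrix_vector_mul_assoc orthogonal_matrix_def)
    then have "x \<noteq> 0" by (metis axis_eq_0_iff matrix_vector_mult_0_right zero_neq_one)
    moreover have "inner x (A *v x) = inner (transpose Q *v x) (diag_matrix d *v (transpose Q *v x))"
      by (simp only: A matrix_vector_mul_assoc[symmetric] inner_mult_transpose)
    moreover have "\<dots> = d i"
      unfolding tx by (simp add: inner_vec_def diag_matrix_def matrix_vector_mult_def axis_def if_distrib[of "\<lambda>x. _ * x"] cong: if_cong)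
    ultimately show ?thesis using assms(2) unfolding pos_def_def by metis
  qed
  then show ?thesis using Q A by blast
qed

lemma pos_def_det_pos:
  fixes A :: "real ^ 'n::finite ^ 'n"
  assumes "transpose A = A" "pos_def A"
  shows "Determinants.det A > 0"
  using pos_def_diagonalization[OF assms] det_diagonalized by (metis prod_pos)

section \<open>Gibbs inequality for centred Gaussian laws\<close>

lemma pos_def_whitening:
  fixes A :: "real ^ 'n::finite ^ 'n"
  assumes "transpose A = A" "pos_def A"
  shows "\<exists>R. transpose R = R \<and> invertible R \<and> R ** A ** R = Finite_Cartesian_Product.mat 1"
proof -
  obtain Q d where Q: "orthogonal_matrix Q" and A: "A = Q ** diag_matrix d ** transpose Q" and d: "\<And>i. d i > 0"
    using pos_def_diagonalization[OF assms] by blast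
  \<comment> \<open>With these eigenvalues \<open>R\<close> is the symmetric inverse square root of
    \<open>A\<close>.\<close>
  define e where "e = (\<lambda>i. 1 / sqrt (d i))"
  define R where "R = Q ** diag_matrix e ** transpose Q"
  have ede: "e i * d i * e i = 1" for i
    using d[of i] by (simp add: e_def field_simps)
  have "transpose R = R" by (simp add: R_def matrix_transpose_mul matrix_mul_assoc)
  moreover have "R ** A ** R = Q ** (diag_matrix e ** diag_matrix d ** diag_matrix e) ** transpose Q"
    unfolding R_def A
    by (metis (no_types, opaque_lifting) Q matrix_mul_assoc orthogonal_matrix_cancel)
  then have "R ** A ** R = Finite_Cartesian_Product.mat 1"
    using Q by (simp add: ede diag_matrix_one orthogonal_matrix_def)
  moreover have "invertible R"
    using calculation(2) by (metis invertible_left_inverse matrix_mul_assoc invertible_def matrix_left_right_inverse)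
  ultimately show ?thesis by blast
qed

text \<open>The difference of the two sides is twice the Kullback-Leibler divergence of N(0, B) from
  N(0, A). Whitening by \<open>R = A^(-1/2)\<close> leaves only the eigenvalues \<open>d i\<close>
  of \<open>R B R\<close>, and the difference becomes the sum of \<open>d i - 1 - ln (d i)\<close>:
  each term is nonnegative and vanishes only at \<open>d i = 1\<close>.\<close>

lemma gaussian_entropy_inequality:
  fixes A B :: "real ^ 'n::finite ^ 'n"
  assumes A: "transpose A = A" "pos_def A" and B: "transpose B = B" "pos_def B"
  shows "real CARD('n) + ln (Determinants.det B) \<le> frob (matrix_inv A) B + ln (Determinants.det A)"
    and "real CARD('n) + ln (Determinants.det B) = frob (matrix_inv A) B + ln (Determinants.det A) \<Longrightarrow> A = B"
proof -
  obtain R where R: "transpose R = R" "invertible R" "R ** A ** R = Finite_Cartesian_Product.mat 1"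
    using pos_def_whitening[OF A] by blast
  define C where "C = R ** B ** R"
  have symC: "transpose C = C" by (simp add: C_def matrix_transpose_mul R B matrix_mul_assoc)
  have "pos_def C"
    unfolding pos_def_def
  proof (intro allI impI)
    fix x :: "real ^ 'n" assume "x \<noteq> 0"
    then have "R *v x \<noteq> 0" using R(2)
      by (metis invertible_def matrix_vector_mul_assoc matrix_vector_mul_lid matrix_vector_mult_0_right)
    moreover have "inner x (C *v x) = inner (R *v x) (B *v (R *v x))"
      using inner_transpose_mult[of R x "B *v (R *v x)"] by (simp add: C_def R(1) matrix_vector_mul_assoc[symmetric] del: matrix_vector_mul_assoc)
    ultimately show "0 < inner x (C *v x)" using B(2) by (simp add: pos_def_def)
  qed
  from pos_def_diagonalization[OF symC this] obtain Q d where
    Q: "orthogonal_matrix Q" and C: "C = Q ** diag_matrix d ** transpose Q" and d: "\<And>i. d i > 0" by blast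
  \<comment> \<open>\<open>R\<close> and \<open>A ** R\<close> are inverse to each other, so they
    may be multiplied in the other order.\<close>
  have "A ** (R ** R) = Finite_Cartesian_Product.mat 1"
    by (metis R(3) matrix_left_right_inverse matrix_mul_assoc)
  then have invA: "matrix_inv A = R ** R"
    by (rule matrix_inv_eqI)
  have tr: "frob (matrix_inv A) B = sum d UNIV"
    unfolding frob_def invA B(1)
    by (metis C C_def Q matrix_mul_assoc trace_diagonalized trace_mul_sym)
  have dA: "Determinants.det A > 0" "Determinants.det B > 0" using A B by (auto intro: pos_def_det_pos)
  have "Determinants.det (R ** A ** R) = 1" using R by simp
  then have "Determinants.det R ^ 2 = 1 / Determinants.det A"
    using dA by (simp add: det_mul field_simps power2_eq_square)
  moreover have "prod d UNIV = Determinants.det R ^ 2 * Determinants.det B"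
    unfolding det_diagonalized[OF Q, of d, symmetric] C[symmetric] by (simp add: C_def det_mul power2_eq_square)
  ultimately have "prod d UNIV = Determinants.det B / Determinants.det A" by simp
  then have "ln (Determinants.det B) - ln (Determinants.det A) = ln (prod d UNIV)"
    using dA by (simp add: ln_div)
  also have "\<dots> = (\<Sum>i\<in>UNIV. ln (d i))"
    using d by (simp add: ln_prod less_imp_neq[THEN not_sym])
  finally have eq: "frob (matrix_inv A) B + ln (Determinants.det A) - (real CARD('n) + ln (Determinants.det B))
      = (\<Sum>i\<in>UNIV. d i - 1 - ln (d i))"
    unfolding tr by (simp add: sum_subtractf)
  have nn: "0 \<le> d i - 1 - ln (d i)" for i using ln_le_minus_one[OF d[of i]] by simp
  show "real CARD('n) + ln (Determinants.det B) \<le> frob (matrix_inv A) B + ln (Determinants.det A)"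
    using eq sum_nonneg[of UNIV "\<lambda>i. d i - 1 - ln (d i)"] nn by simp
  assume "real CARD('n) + ln (Determinants.det B) = frob (matrix_inv A) B + ln (Determinants.det A)"
  then have "(\<Sum>i\<in>UNIV. d i - 1 - ln (d i)) = 0" using eq by simp
  then have "d i - 1 - ln (d i) = 0" for i
    using nn by (subst (asm) sum_nonneg_eq_0_iff) auto
  then have "d i = 1" for i using ln_eq_minus_one[OF d[of i]] by (simp add: algebra_simps)
  then have "d = (\<lambda>_. 1)" by blast
  then have "C = Finite_Cartesian_Product.mat 1" using C Q by (simp add: diag_matrix_one orthogonal_matrix_def)
  then have "R ** B ** R = R ** A ** R" by (simp add: C_def R)
  then show "A = B"
    using R(2) by (metis invertible_def matrix_mul_assoc matrix_mul_lid matrix_mul_rid)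
qed

section \<open>Twice continuously differentiable functions\<close>


text \<open>\<open>U\<close> is open only relative to \<open>R^q\<close> inside the space of all
  sequences. Moving a coordinate with index below \<open>q\<close> does not leave
  \<open>R^q\<close>, so partial derivatives in these directions are local in \<open>U\<close>; this
  underlies all congruence rules below.\<close>

lemma eventually_fun_upd_in_openin:
  assumes "openin (Euclidean_space q) U" "x \<in> U" "i < q"
  shows "\<forall>\<^sub>F t in nhds (x i). x(i := t) \<in> U"
proof -
  obtain W where W: "open W" "U = W \<inter> {x. \<forall>i\<ge>q. x i = 0}"
    using assms(1) unfolding Euclidean_space_def euclidean_product_topology openin_open by blast
  have "continuous_on UNIV (\<lambda>t. x(i := t))"
  proof (rule continuous_on_coordinatewise_then_product)
    show "continuous_on UNIV (\<lambda>t. (x(i := t)) k)" for k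
      by (cases "k = i") auto
  qed
  then have "open ((\<lambda>t. x(i := t)) -` W)"
    using W(1) by (rule open_vimage[rotated])
  then have "\<forall>\<^sub>F t in nhds (x i). t \<in> (\<lambda>t. x(i := t)) -` W"
    by (rule eventually_nhds_in_open) (use assms W in auto)
  then show ?thesis
    by eventually_elim (use assms W in auto)
qed

lemma has_partial_iff:
  "has_partial i f x \<longleftrightarrow> ((\<lambda>t. f (x(i := t))) has_field_derivative partial i f x) (at (x i))"
  unfolding has_partial_def partial_def
  by (metis DERIV_deriv_iff_field_differentiable)

lemma partial_unique:
  assumes "((\<lambda>t. f (x(i := t))) has_field_derivative D) (at (x i))"
  shows "partial i f x = D" and "has_partial i f x"
  using assms unfolding partial_def has_partial_def field_differentiable_def
  by (auto intro: DERIV_imp_deriv)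

lemma partial_cong:
  assumes "openin (Euclidean_space q) U" "\<And>x. x \<in> U \<Longrightarrow> f x = g x" "x \<in> U" "i < q"
  shows "partial i f x = partial i g x"
  unfolding partial_def
proof (rule deriv_cong_ev)
  show "\<forall>\<^sub>F t in nhds (x i). f (x(i := t)) = g (x(i := t))"
    using eventually_fun_upd_in_openin[OF assms(1,3,4)] by eventually_elim (rule assms(2))
qed simp

lemma has_partial_cong:
  assumes "openin (Euclidean_space q) U" "\<And>x. x \<in> U \<Longrightarrow> f x = g x" "x \<in> U" "i < q"
  shows "has_partial i f x \<longleftrightarrow> has_partial i g x"
proof -
  have "has_partial i f x \<longleftrightarrow> ((\<lambda>t. f (x(i := t))) has_field_derivative partial i g x) (at (x i))"
    by (simp add: has_partial_iff partial_cong[OF assms])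
  also have "\<dots> \<longleftrightarrow> has_partial i g x"
    unfolding has_partial_iff
  proof (rule DERIV_cong_ev)
    show "\<forall>\<^sub>F t in nhds (x i). f (x(i := t)) = g (x(i := t))"
      using eventually_fun_upd_in_openin[OF assms(1,3,4)] by eventually_elim (rule assms(2))
  qed auto
  finally show ?thesis .
qed

lemma C1_onI:
  assumes "continuous_on U f" "\<And>i. i < q \<Longrightarrow> continuous_on U (g i)"
    and "\<And>i x. i < q \<Longrightarrow> x \<in> U \<Longrightarrow> ((\<lambda>t. f (x(i := t))) has_field_derivative g i x) (at (x i))"
  shows "C1_on q U f"
  unfolding C1_on_def
proof (intro conjI allI impI ballI)
  show "continuous_on U f" by fact
  fix i assume i: "i < q"
  show "has_partial i f x" if "x \<in> U" for x using assms(3)[OF i that] by (rule partial_unique)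
  have "partial i f x = g i x" if "x \<in> U" for x using assms(3)[OF i that] by (rule partial_unique)
  then show "continuous_on U (partial i f)"
    using assms(2)[OF i] continuous_on_cong[of U U "partial i f" "g i"] by blast
qed

lemma C1_on_cong:
  assumes "openin (Euclidean_space q) U" "C1_on q U g" "\<And>x. x \<in> U \<Longrightarrow> f x = g x"
  shows "C1_on q U f"
  unfolding C1_on_def
proof (intro conjI allI impI ballI)
  show "continuous_on U f"
    using assms(2,3) continuous_on_cong[of U U f g] by (auto simp: C1_on_def)
  fix i assume i: "i < q"
  show "has_partial i f x" if "x \<in> U" for x
    using assms(2) has_partial_cong[OF assms(1,3) that i] that i by (auto simp: C1_on_def)
  show "continuous_on U (partial i f)"
    using assms(2) i continuous_on_cong[of U U "partial i f" "partial i g"] partial_cong[OF assms(1,3) _ i]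
    by (auto simp: C1_on_def)
qed

lemma C1_on_D:
  assumes "C1_on q U f" "i < q" "x \<in> U"
  shows "((\<lambda>t. f (x(i := t))) has_field_derivative partial i f x) (at (x i))"
  using assms unfolding C1_on_def has_partial_iff by blast

lemma C1_on_continuous:
  assumes "C1_on q U f"
  shows "continuous_on U f" and "i < q \<Longrightarrow> continuous_on U (partial i f)"
  using assms unfolding C1_on_def by auto

lemma C1_on_subset: "C1_on q U f \<Longrightarrow> V \<subseteq> U \<Longrightarrow> C1_on q V f"
  unfolding C1_on_def by (blast intro: continuous_on_subset)

lemma C2_on_subset: "C2_on q U f \<Longrightarrow> V \<subseteq> U \<Longrightarrow> C2_on q V f"
  unfolding C2_on_def by (blast intro: C1_on_subset)

lemma C1_on_const [intro]: "C1_on q U (\<lambda>_. c)"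
  by (rule C1_onI[where g = "\<lambda>_ _. 0"]) auto

lemma C1_on_add:
  assumes "C1_on q U f" "C1_on q U g"
  shows "C1_on q U (\<lambda>x. f x + g x)"
proof (rule C1_onI[where g = "\<lambda>i x. partial i f x + partial i g x"])
  fix i x assume "i < q" "x \<in> U"
  from DERIV_add[OF C1_on_D[OF assms(1) this] C1_on_D[OF assms(2) this]]
  show "((\<lambda>t. f (x(i := t)) + g (x(i := t))) has_field_derivative
      partial i f x + partial i g x) (at (x i))" .
qed (auto intro!: continuous_intros C1_on_continuous[OF assms(1)] C1_on_continuous[OF assms(2)])

lemma C1_on_mult:
  assumes "C1_on q U f" "C1_on q U g"
  shows "C1_on q U (\<lambda>x. f x * g x)"
proof (rule C1_onI[where g = "\<lambda>i x. partial i f x * g x + partial i g x * f x"])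
  fix i x assume "i < q" "x \<in> U"
  from DERIV_mult[OF C1_on_D[OF assms(1) this] C1_on_D[OF assms(2) this]]
  show "((\<lambda>t. f (x(i := t)) * g (x(i := t))) has_field_derivative
      partial i f x * g x + partial i g x * f x) (at (x i))" by simp
qed (auto intro!: continuous_intros C1_on_continuous[OF assms(1)] C1_on_continuous[OF assms(2)])

lemma C1_on_inverse:
  assumes "C1_on q U f" "\<And>x. x \<in> U \<Longrightarrow> f x \<noteq> 0"
  shows "C1_on q U (\<lambda>x. inverse (f x))"
proof (rule C1_onI[where g = "\<lambda>i x. - (inverse (f x) * partial i f x * inverse (f x))"])
  fix i x assume x: "i < q" "x \<in> U"
  from DERIV_inverse'[OF C1_on_D[OF assms(1) x]] assms(2)[OF x(2)]
  show "((\<lambda>t. inverse (f (x(i := t)))) has_field_derivative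
      - (inverse (f x) * partial i f x * inverse (f x))) (at (x i))" by simp
qed (auto intro!: continuous_intros C1_on_continuous[OF assms(1)] assms(2))

lemma C1_on_ln:
  assumes "C1_on q U f" "\<And>x. x \<in> U \<Longrightarrow> 0 < f x"
  shows "C1_on q U (\<lambda>x. ln (f x))"
proof (rule C1_onI[where g = "\<lambda>i x. inverse (f x) * partial i f x"])
  fix i x assume x: "i < q" "x \<in> U"
  show "((\<lambda>t. ln (f (x(i := t)))) has_field_derivative inverse (f x) * partial i f x) (at (x i))"
    using C1_on_D[OF assms(1) x] assms(2)[OF x(2)]
    by (auto intro!: derivative_eq_intros simp: inverse_eq_divide)
qed (auto intro!: continuous_intros C1_on_continuous[OF assms(1)] dest: assms(2))

text \<open>The first derivatives are supplied in closed form as \<open>g\<close>. Passing from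
  smoothness of \<open>g i\<close> to that of \<open>partial i f\<close> compares the two functions
  near each point, which is where openness of \<open>U\<close> enters.\<close>

lemma C2_onI:
  assumes U: "openin (Euclidean_space q) U"
    and "C1_on q U f" "\<And>i. i < q \<Longrightarrow> C1_on q U (g i)"
    and "\<And>i x. i < q \<Longrightarrow> x \<in> U \<Longrightarrow> ((\<lambda>t. f (x(i := t))) has_field_derivative g i x) (at (x i))"
  shows "C2_on q U f"
  unfolding C2_on_def
proof (intro conjI allI impI)
  fix i assume i: "i < q"
  show "C1_on q U (partial i f)"
    using partial_unique(1)[OF assms(4)[OF i]] by (rule C1_on_cong[OF U assms(3)[OF i]])
qed fact

lemma C2_on_C1: "C2_on q U f \<Longrightarrow> C1_on q U f" and C2_on_partial: "C2_on q U f \<Longrightarrow> i < q \<Longrightarrow> C1_on q U (partial i f)"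
  unfolding C2_on_def by auto

context
  fixes q :: nat and U :: "(nat \<Rightarrow> real) set"
  assumes U: "openin (Euclidean_space q) U"
begin

lemma C2_on_const: "C2_on q U (\<lambda>_. c)"
  by (rule C2_onI[OF U, where g = "\<lambda>_ _. 0"]) auto

lemma C2_on_add:
  assumes "C2_on q U f" "C2_on q U g"
  shows "C2_on q U (\<lambda>x. f x + g x)"
proof (rule C2_onI[OF U, where g = "\<lambda>i x. partial i f x + partial i g x"])
  fix i x assume "i < q" "x \<in> U"
  from DERIV_add[OF C1_on_D[OF C2_on_C1[OF assms(1)] this] C1_on_D[OF C2_on_C1[OF assms(2)] this]]
  show "((\<lambda>t. f (x(i := t)) + g (x(i := t))) has_field_derivative
      partial i f x + partial i g x) (at (x i))" .
qed (intro C1_on_add C2_on_C1[OF assms(1)] C2_on_C1[OF assms(2)]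
      C2_on_partial[OF assms(1)] C2_on_partial[OF assms(2)]; assumption)+

lemma C2_on_mult:
  assumes "C2_on q U f" "C2_on q U g"
  shows "C2_on q U (\<lambda>x. f x * g x)"
proof (rule C2_onI[OF U, where g = "\<lambda>i x. partial i f x * g x + partial i g x * f x"])
  fix i x assume "i < q" "x \<in> U"
  from DERIV_mult[OF C1_on_D[OF C2_on_C1[OF assms(1)] this] C1_on_D[OF C2_on_C1[OF assms(2)] this]]
  show "((\<lambda>t. f (x(i := t)) * g (x(i := t))) has_field_derivative
      partial i f x * g x + partial i g x * f x) (at (x i))" by simp
qed (intro C1_on_add C1_on_mult C2_on_C1[OF assms(1)] C2_on_C1[OF assms(2)]
      C2_on_partial[OF assms(1)] C2_on_partial[OF assms(2)]; assumption)+

lemma C2_on_inverse: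
  assumes "C2_on q U f" "\<And>x. x \<in> U \<Longrightarrow> f x \<noteq> 0"
  shows "C2_on q U (\<lambda>x. inverse (f x))"
\<comment> \<open>The sign is written as a factor so that the product rule for \<open>C1_on\<close>
  applies to the derivative.\<close>
proof (rule C2_onI[OF U, where g = "\<lambda>i x. -1 * (inverse (f x) * partial i f x * inverse (f x))"])
  fix i x assume x: "i < q" "x \<in> U"
  from DERIV_inverse'[OF C1_on_D[OF C2_on_C1[OF assms(1)] x]] assms(2)[OF x(2)]
  show "((\<lambda>t. inverse (f (x(i := t)))) has_field_derivative
      -1 * (inverse (f x) * partial i f x * inverse (f x))) (at (x i))" by simp
qed (intro C1_on_mult C1_on_const C1_on_inverse C2_on_C1[OF assms(1)] C2_on_partial[OF assms(1)] assms(2); assumption)+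

lemma C2_on_ln:
  assumes "C2_on q U f" "\<And>x. x \<in> U \<Longrightarrow> 0 < f x"
  shows "C2_on q U (\<lambda>x. ln (f x))"
proof (rule C2_onI[OF U, where g = "\<lambda>i x. inverse (f x) * partial i f x"])
  have nz: "f x \<noteq> 0" if "x \<in> U" for x using assms(2)[OF that] by simp
  show "C1_on q U (\<lambda>x. ln (f x))"
    by (intro C1_on_ln C2_on_C1[OF assms(1)] assms(2))
  fix i assume i: "i < q"
  show "C1_on q U (\<lambda>x. inverse (f x) * partial i f x)"
    by (intro C1_on_mult C1_on_inverse C2_on_C1[OF assms(1)] C2_on_partial[OF assms(1) i] nz)
  fix x assume x: "x \<in> U"
  show "((\<lambda>t. ln (f (x(i := t)))) has_field_derivative inverse (f x) * partial i f x) (at (x i))"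
    using C1_on_D[OF C2_on_C1[OF assms(1)] i x] assms(2)[OF x]
    by (auto intro!: derivative_eq_intros simp: inverse_eq_divide)
qed

lemma C2_on_cong:
  assumes "C2_on q U g" "\<And>x. x \<in> U \<Longrightarrow> f x = g x"
  shows "C2_on q U f"
  unfolding C2_on_def
proof (intro conjI allI impI)
  show "C1_on q U f" by (rule C1_on_cong[OF U C2_on_C1[OF assms(1)] assms(2)])
  fix i assume i: "i < q"
  show "C1_on q U (partial i f)"
    by (rule C1_on_cong[OF U C2_on_partial[OF assms(1) i] partial_cong[OF U assms(2) _ i]])
qed

lemma C2_on_sum:
  assumes "\<And>k. k \<in> K \<Longrightarrow> C2_on q U (f k)"
  shows "C2_on q U (\<lambda>x. \<Sum>k\<in>K. f k x)"
  using assms by (induction K rule: infinite_finite_induct) (auto intro: C2_on_const C2_on_add)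

lemma C2_on_prod:
  assumes "\<And>k. k \<in> K \<Longrightarrow> C2_on q U (f k)"
  shows "C2_on q U (\<lambda>x. \<Prod>k\<in>K. f k x)"
  using assms by (induction K rule: infinite_finite_induct) (auto intro: C2_on_const C2_on_mult)

lemma partial_linear_combination:
  assumes "\<And>k. k \<in> K \<Longrightarrow> C1_on q U (f k)" "x \<in> U" "i < q"
  shows "partial i (\<lambda>x. \<Sum>k\<in>K. c k * f k x) x = (\<Sum>k\<in>K. c k * partial i (f k) x)"
proof (rule partial_unique(1), rule DERIV_sum)
  fix k assume "k \<in> K"
  from C1_on_D[OF assms(1)[OF this] assms(3,2)]
  show "((\<lambda>t. c k * f k (x(i := t))) has_field_derivative c k * partial i (f k) x) (at (x i))"
    by (rule DERIV_cmult)
qed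

lemma partial_partial_linear_combination:
  assumes "\<And>k. k \<in> K \<Longrightarrow> C2_on q U (f k)" "x \<in> U" "i < q" "j < q"
  shows "partial i (partial j (\<lambda>x. \<Sum>k\<in>K. c k * f k x)) x = (\<Sum>k\<in>K. c k * partial i (partial j (f k)) x)"
proof -
  have "partial i (partial j (\<lambda>x. \<Sum>k\<in>K. c k * f k x)) x = partial i (\<lambda>x. \<Sum>k\<in>K. c k * partial j (f k) x) x"
    using assms by (intro partial_cong[OF U] partial_linear_combination C2_on_C1) auto
  also have "\<dots> = (\<Sum>k\<in>K. c k * partial i (partial j (f k)) x)"
    using assms by (intro partial_linear_combination C2_on_partial) auto
  finally show ?thesis .
qed

lemma partial_partial_cong:
  assumes "\<And>x. x \<in> U \<Longrightarrow> f x = g x" "x \<in> U" "i < q" "j < q"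
  shows "partial i (partial j f) x = partial i (partial j g) x"
  by (intro partial_cong[OF U] assms)

end

section \<open>The log-likelihood as a function of parameter and covariance\<close>

text \<open>Cramer's rule for the system with right-hand side \<open>axis j 1\<close>. Entries of
  the inverse become quotients of determinants, hence of polynomials in the entries of
  \<open>A\<close>, and smoothness carries over.\<close>

lemma matrix_inv_cofactor:
  fixes A :: "real ^ 'n::finite ^ 'n"
  assumes "Determinants.det A \<noteq> 0"
  shows "matrix_inv A $ i $ j =
    Determinants.det (\<chi> k l. if l = i then (if k = j then 1 else 0) else A $ k $ l) * inverse (Determinants.det A)"
proof -
  have "A ** matrix_inv A = Finite_Cartesian_Product.mat 1"
    using assms by (metis invertible_det_nz matrix_inv_left_invertible matrix_left_right_inverse)
  then have "A *v (matrix_inv A *v axis j 1) = axis j 1"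
    by (simp add: matrix_vector_mul_assoc)
  then have "matrix_inv A *v axis j 1 =
      (\<chi> i. Determinants.det (\<chi> k l. if l = i then axis j 1 $ k else A $ k $ l) / Determinants.det A)"
    using cramer[OF assms] by blast
  then have "(matrix_inv A *v axis j 1) $ i =
      Determinants.det (\<chi> k l. if l = i then axis j 1 $ k else A $ k $ l) / Determinants.det A"
    by simp
  moreover have "(matrix_inv A *v axis j 1) $ i = matrix_inv A $ i $ j"
    by (simp add: matrix_vector_mult_def axis_def if_distrib[of "\<lambda>x. _ * x"] cong: if_cong)
  moreover have "(\<chi> k l. if l = i then axis j 1 $ k else A $ k $ l) =
      (\<chi> k l. if l = i then (if k = j then 1 else 0) else A $ k $ l)"
    by (auto simp: axis_def Finite_Cartesian_Product.vec_eq_iff)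
  ultimately show ?thesis by (simp add: inverse_eq_divide)
qed

lemma C2_on_det:
  fixes A :: "(nat \<Rightarrow> real) \<Rightarrow> real ^ 'n::finite ^ 'n"
  assumes U: "openin (Euclidean_space q) U" and "\<And>i j. C2_on q U (\<lambda>x. A x $ i $ j)"
  shows "C2_on q U (\<lambda>x. Determinants.det (A x))"
  unfolding Determinants.det_def
  by (intro C2_on_sum[OF U] C2_on_mult[OF U] C2_on_const[OF U] C2_on_prod[OF U] assms(2))

text \<open>\<open>V\<close> is to be the part of a neighbourhood of the parameter set on which the
  determinant stays positive: inverse and log-determinant are C^2 there, and likelihood and
  exponential form agree.\<close>

locale smooth_covariance =
  fixes q :: nat and V :: "(nat \<Rightarrow> real) set" and Sig :: "(nat \<Rightarrow> real) \<Rightarrow> real ^ 'p::finite ^ 'p"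
  assumes open_V: "openin (Euclidean_space q) V"
    and det_Sig: "\<And>\<theta>. \<theta> \<in> V \<Longrightarrow> 0 < Determinants.det (Sig \<theta>)"
    and C2_Sig: "\<And>i j. C2_on q V (\<lambda>\<theta>. Sig \<theta> $ i $ j)"
begin

lemma C2_ln_det: "C2_on q V (\<lambda>\<theta>. ln (Determinants.det (Sig \<theta>)))"
  by (intro C2_on_ln[OF open_V] C2_on_det[OF open_V] C2_Sig det_Sig)

lemma C2_inv: "C2_on q V (\<lambda>\<theta>. matrix_inv (Sig \<theta>) $ i $ j)"
proof (rule C2_on_cong[OF open_V])
  show "matrix_inv (Sig x) $ i $ j =
    Determinants.det (\<chi> k l. if l = i then (if k = j then 1 else 0) else Sig x $ k $ l)
      * inverse (Determinants.det (Sig x))" if "x \<in> V" for x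
    using det_Sig[OF that] by (intro matrix_inv_cofactor) auto
  have "C2_on q V (\<lambda>x. (\<chi> k l. if l = i then (if k = j then 1 else 0) else Sig x $ k $ l) $ a $ b)" for a b
    using C2_Sig C2_on_const[OF open_V] by (cases "b = i") auto
  then show "C2_on q V (\<lambda>x. Determinants.det (\<chi> k l. if l = i then (if k = j then 1 else 0) else Sig x $ k $ l)
      * inverse (Determinants.det (Sig x)))"
    using det_Sig by (intro C2_on_mult[OF open_V] C2_on_inverse[OF open_V] C2_on_det[OF open_V] C2_Sig) force+
qed

text \<open>The factors that depend on \<theta> alone: \<open>None\<close> stands for the
  log-determinant, \<open>Some (i, j)\<close> for an entry of the inverse. With \<open>coef\<close>
  holding the dependence on \<open>S\<close>, the log-likelihood is one sum over a finite
  type.\<close>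

definition part :: "('p \<times> 'p) option \<Rightarrow> (nat \<Rightarrow> real) \<Rightarrow> real" where
  "part k \<theta> = (case k of None \<Rightarrow> ln (Determinants.det (Sig \<theta>)) | Some (i, j) \<Rightarrow> matrix_inv (Sig \<theta>) $ i $ j)"

definition coef :: "real ^ 'p ^ 'p \<Rightarrow> ('p \<times> 'p) option \<Rightarrow> real" where
  "coef S k = (case k of None \<Rightarrow> - 1 / 2 | Some (i, j) \<Rightarrow> - 1 / 2 * S $ i $ j)"

lemma C2_part: "C2_on q V (part k)"
  using C2_ln_det C2_inv by (cases k) (auto simp: part_def[abs_def] split: prod.split)

lemma limit_loglik_eq: "limit_loglik S Sig \<theta> = (\<Sum>k\<in>UNIV. coef S k * part k \<theta>)"
proof -
  have "(\<Sum>k\<in>UNIV. coef S k * part k \<theta>) = coef S None * part None \<theta> + (\<Sum>k\<in>UNIV. coef S (Some k) * part (Some k) \<theta>)"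
    by (simp add: UNIV_option_conv sum.reindex)
  also have "(\<Sum>k\<in>UNIV. coef S (Some k) * part (Some k) \<theta>) =
      (\<Sum>i\<in>UNIV. \<Sum>j\<in>UNIV. - 1 / 2 * (matrix_inv (Sig \<theta>) $ i $ j * S $ i $ j))"
    unfolding UNIV_Times_UNIV[symmetric] sum.cartesian_product
    by (intro sum.cong) (auto simp: coef_def part_def)
  also have "\<dots> = - 1 / 2 * frob (matrix_inv (Sig \<theta>)) S"
    by (simp add: frob_def trace_def matrix_matrix_mult_def transpose_def sum_distrib_left)
  finally show ?thesis by (simp add: limit_loglik_def coef_def part_def)
qed

text \<open>The second derivatives of the log-likelihood taken term by term. As \<open>S\<close>
  stays outside the derivatives, it may vary together with \<theta> in limits.\<close>

definition hess_ll :: "real ^ 'p ^ 'p \<Rightarrow> (nat \<Rightarrow> real) \<Rightarrow> nat \<Rightarrow> nat \<Rightarrow> real" where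
  "hess_ll S \<theta> i j = (\<Sum>k\<in>UNIV. coef S k * partial i (partial j (part k)) \<theta>)"

lemma partial_partial_limit_loglik:
  assumes "\<theta> \<in> V" "i < q" "j < q"
  shows "partial i (partial j (\<lambda>\<theta>. c * limit_loglik S Sig \<theta>)) \<theta> = c * hess_ll S \<theta> i j"
  unfolding hess_ll_def limit_loglik_eq sum_distrib_left mult.assoc[symmetric]
  by (rule partial_partial_linear_combination[OF open_V C2_part assms])

lemma continuous_part: "continuous_on V (part k)"
  using C1_on_continuous(1)[OF C2_on_C1[OF C2_part]] .

lemma continuous_part2:
  assumes "i < q" "j < q"
  shows "continuous_on V (partial i (partial j (part k)))"
  using C1_on_continuous(2)[OF C2_on_partial[OF C2_part]] assms by blast

lemma tendsto_coef: "(S \<longlongrightarrow> S0) F \<Longrightarrow> ((\<lambda>n. coef (S n) k) \<longlongrightarrow> coef S0 k) F"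
  by (auto simp: coef_def split: option.split intro!: tendsto_intros)

lemma tendsto_limit_loglik:
  assumes "(S \<longlongrightarrow> S0) F" "(\<theta> \<longlongrightarrow> \<theta>0) F" "\<theta>0 \<in> V" "\<forall>\<^sub>F n in F. \<theta> n \<in> V"
  shows "((\<lambda>n. limit_loglik (S n) Sig (\<theta> n)) \<longlongrightarrow> limit_loglik S0 Sig \<theta>0) F"
  unfolding limit_loglik_eq
  by (intro tendsto_sum tendsto_mult tendsto_coef assms continuous_on_tendsto_compose[OF continuous_part])

lemma tendsto_hess_ll:
  assumes "(S \<longlongrightarrow> S0) F" "(\<theta> \<longlongrightarrow> \<theta>0) F" "\<theta>0 \<in> V" "\<forall>\<^sub>F n in F. \<theta> n \<in> V" "i < q" "j < q"
  shows "((\<lambda>n. hess_ll (S n) (\<theta> n) i j) \<longlongrightarrow> hess_ll S0 \<theta>0 i j) F"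
  unfolding hess_ll_def
  by (intro tendsto_sum tendsto_mult tendsto_coef assms continuous_on_tendsto_compose[OF continuous_part2])

definition info :: "real ^ 'p ^ 'p \<Rightarrow> (nat \<Rightarrow> real) \<Rightarrow> real mat" where
  "info S \<theta> = Matrix.mat q q (\<lambda>(i, j). - hess_ll S \<theta> i j)"

lemma info_eq_hessian: "\<theta> \<in> V \<Longrightarrow> info S \<theta> = - hessian q (limit_loglik S Sig) \<theta>"
  using partial_partial_limit_loglik[of \<theta> _ _ 1]
  by (intro eq_matI) (auto simp: info_def hessian_def)

end

section \<open>Realized covariance and quasi-likelihood\<close>

definition rel_cov :: "real \<Rightarrow> nat \<Rightarrow> (real \<Rightarrow> real ^ 'p) \<Rightarrow> real ^ 'p ^ 'p" where
  "rel_cov T n x = (1 / T) *\<^sub>R (\<Sum>i=1..n. outer (incr T n x i))"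

lemma frob_linear:
  fixes A :: "real ^ 'p::finite ^ 'p"
  shows "frob A (c *\<^sub>R B) = c * frob A B" and "frob A (\<Sum>i\<in>I. C i) = (\<Sum>i\<in>I. frob A (C i))"
  by (simp_all add: frob_def trace_def matrix_matrix_mult_def transpose_def sum_distrib_left algebra_simps)
    (simp add: sum.swap[of _ I])

text \<open>The Gaussian normalization does not involve \<theta> and comes out in front. In the
  exponent, the increments are weighted by \<open>1 / h = n / T\<close>, so their sum is
  \<open>n\<close> times the trace against the realized covariance.\<close>

lemma quasi_lik_eq_exp:
  fixes Sig :: "(nat \<Rightarrow> real) \<Rightarrow> real ^ 'p::finite ^ 'p"
  assumes d: "0 < Determinants.det (Sig \<theta>)" and T: "0 < T" and n: "1 \<le> n"
  shows "quasi_lik T n x Sig \<theta> =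
    exp (real n * limit_loglik (rel_cov T n x) Sig \<theta>) / (2 * pi * (T / real n)) powr (real n * real CARD('p) / 2)"
proof -
  define h where "h = T / real n"
  have h: "h > 0" using T n by (simp add: h_def)
  define P where "P = (2 * pi * h) powr (real CARD('p) / 2)"
  define D where "D = Determinants.det (Sig \<theta>)"
  have P: "P > 0" using h by (simp add: P_def)
  have sD: "1 / sqrt D = exp (- ln D / 2)"
    using d by (simp add: D_def exp_minus ln_sqrt[symmetric] inverse_eq_divide)
  let ?q = "\<lambda>i. frob (matrix_inv (Sig \<theta>)) (outer (incr T n x i))"
  have "quasi_lik T n x Sig \<theta> = (\<Prod>i=1..n. exp (- ln D / 2 - 1 / (2 * h) * ?q i) / P)"
    unfolding quasi_lik_def Let_def h_def[symmetric] P_def[symmetric] D_def[symmetric]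
  proof (intro prod.cong refl)
    fix i
    have "1 / (P * sqrt D) * exp (- (1 / (2 * h)) * ?q i) = (1 / sqrt D) * exp (- (1 / (2 * h)) * ?q i) / P"
      by simp
    also have "\<dots> = exp (- ln D / 2 - 1 / (2 * h) * ?q i) / P"
      unfolding sD by (simp add: exp_add[symmetric])
    finally show "1 / (P * sqrt D) * exp (- (1 / (2 * h)) * ?q i) = exp (- ln D / 2 - 1 / (2 * h) * ?q i) / P" .
  qed
  also have "\<dots> = exp (\<Sum>i=1..n. - ln D / 2 - 1 / (2 * h) * ?q i) / P ^ n"
    by (simp add: prod_dividef exp_sum)
  also have "(\<Sum>i=1..n. - ln D / 2 - 1 / (2 * h) * ?q i) = real n * limit_loglik (rel_cov T n x) Sig \<theta>"
    using n T unfolding limit_loglik_def rel_cov_def frob_linear D_def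
    by (simp add: sum_subtractf h_def right_diff_distrib) (simp add: sum_distrib_left sum_divide_distrib field_simps)
  also have "P ^ n = (2 * pi * h) powr (real n * real CARD('p) / 2)"
    using h by (simp add: P_def powr_realpow[symmetric] powr_powr mult.commute)
  finally show ?thesis by (simp add: h_def)
qed

lemma quasi_loglik_eq:
  fixes Sig :: "(nat \<Rightarrow> real) \<Rightarrow> real ^ 'p::finite ^ 'p"
  assumes "0 < Determinants.det (Sig \<theta>)" "0 < T" "1 \<le> n"
  shows "quasi_loglik T n x Sig \<theta> = real n * limit_loglik (rel_cov T n x) Sig \<theta>"
  using assms by (simp add: quasi_loglik_def quasi_lik_eq_exp)

context smooth_covariance
begin

text \<open>The quasi-log-likelihood is known to equal \<open>n\<close> times the log-likelihood
  only on \<open>V\<close>; since \<open>V\<close> is relatively open, this determines its second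
  derivatives there.\<close>

lemma hessian_quasi_loglik:
  assumes "\<theta> \<in> V" "0 < T" "1 \<le> n"
  shows "(- (1 / real n)) \<cdot>\<^sub>m hessian q (quasi_loglik T n x Sig) \<theta> = info (rel_cov T n x) \<theta>"
proof (rule eq_matI)
  fix i j assume ij: "i < dim_row (info (rel_cov T n x) \<theta>)" "j < dim_col (info (rel_cov T n x) \<theta>)"
  then have ij: "i < q" "j < q" by (auto simp: info_def)
  have "partial i (partial j (quasi_loglik T n x Sig)) \<theta> =
     partial i (partial j (\<lambda>\<theta>. real n * limit_loglik (rel_cov T n x) Sig \<theta>)) \<theta>"
    using assms ij det_Sig by (intro partial_partial_cong[OF open_V] quasi_loglik_eq)
  also have "\<dots> = real n * hess_ll (rel_cov T n x) \<theta> i j"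
    using assms ij by (intro partial_partial_limit_loglik)
  finally show "((- (1 / real n)) \<cdot>\<^sub>m hessian q (quasi_loglik T n x Sig) \<theta>) $$ (i, j) = info (rel_cov T n x) \<theta> $$ (i, j)"
    using ij assms by (simp add: hessian_def info_def)
qed (auto simp: hessian_def info_def)

lemma obs_information_eq:
  assumes "\<theta> \<in> V" "0 < T" "1 \<le> n"
  shows "obs_information q T n x Sig \<theta> =
    (if pos_def_mat q (info (rel_cov T n x) \<theta>) then info (rel_cov T n x) \<theta> else 1\<^sub>m q)"
  unfolding obs_information_def Let_def hessian_quasi_loglik[OF assms] ..

text \<open>The Leibniz expansion turns the determinant into a polynomial in the second derivatives,
  from which both convergence and measurability are read off. A permutation of
  \<open>{0..<q}\<close> keeps the indices below \<open>q\<close>, as the entries demand.\<close>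

lemma det_info:
  "Determinant.det (info S \<theta>) =
    (\<Sum>p | p permutes {0..<q}. signof p * (\<Prod>i = 0..<q. - hess_ll S \<theta> i (p i)))"
proof -
  have "p i < q" if "p permutes {0..<q}" "i < q" for p i
    using that permutes_in_image[of p "{0..<q}" i] by simp
  then show ?thesis
    unfolding info_def by (subst det_def'[OF mat_carrier]) (auto intro!: sum.cong prod.cong)
qed

lemma tendsto_det_info:
  assumes "(S \<longlongrightarrow> S0) F" "(\<theta> \<longlongrightarrow> \<theta>0) F" "\<theta>0 \<in> V" "\<forall>\<^sub>F n in F. \<theta> n \<in> V"
  shows "((\<lambda>n. Determinant.det (info (S n) (\<theta> n))) \<longlongrightarrow> Determinant.det (info S0 \<theta>0)) F"
proof -
  have "p i < q" if "p permutes {0..<q}" "i < q" for p i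
    using that permutes_in_image[of p "{0..<q}" i] by simp
  then show ?thesis
    unfolding det_info by (intro tendsto_intros tendsto_hess_ll assms) auto
qed

end

lemma pos_def_mat_det_nonzero:
  assumes "A \<in> carrier_mat q q" "pos_def_mat q A"
  shows "Determinant.det A \<noteq> 0"
proof
  assume "Determinant.det A = 0"
  then obtain v where "v \<in> carrier_vec q" "v \<noteq> 0\<^sub>v q" "A *\<^sub>v v = 0\<^sub>v q"
    using det_0_iff_vec_prod_zero_field[OF assms(1)] by blast
  then show False using assms(2) by (auto simp: pos_def_mat_def)
qed

section \<open>Limits of the information criteria along a path\<close>


context smooth_covariance
begin

lemma continuous_limit_loglik: "continuous_on V (limit_loglik S Sig)"
  unfolding limit_loglik_eq[abs_def] by (intro continuous_intros continuous_part)

text \<open>A real supremum is an upper bound only for a set that is bounded above; compactness of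
  \<Theta> provides the bound.\<close>

lemma sup_limit_loglik:
  assumes "compact \<Theta>" "\<Theta> \<subseteq> V" "t \<in> \<Theta>"
  shows "limit_loglik S Sig t \<le> (SUP \<theta>\<in>\<Theta>. limit_loglik S Sig \<theta>)"
  using assms
  by (intro cSUP_upper bounded_imp_bdd_above compact_imp_bounded compact_continuous_image
      continuous_on_subset[OF continuous_limit_loglik]) auto

lemma sup_quasi_lik:
  assumes "compact \<Theta>" "\<Theta> \<subseteq> V" "0 < T" "1 \<le> n" "t \<in> \<Theta>"
  shows "quasi_lik T n x Sig t \<le> (SUP \<theta>\<in>\<Theta>. quasi_lik T n x Sig \<theta>)"
proof -
  let ?c = "(2 * pi * (T / real n)) powr (real n * real CARD('p) / 2)"
  have "continuous_on V (\<lambda>\<theta>. exp (real n * limit_loglik (rel_cov T n x) Sig \<theta>) / ?c)"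
    using assms by (intro continuous_intros continuous_limit_loglik) auto
  moreover have "quasi_lik T n x Sig \<theta> = exp (real n * limit_loglik (rel_cov T n x) Sig \<theta>) / ?c"
    if "\<theta> \<in> V" for \<theta>
    using that assms det_Sig by (intro quasi_lik_eq_exp)
  ultimately have "continuous_on V (quasi_lik T n x Sig)"
    using continuous_on_cong[of V V "quasi_lik T n x Sig"] by force
  then show ?thesis
    using assms
    by (intro cSUP_upper bounded_imp_bdd_above compact_imp_bounded compact_continuous_image) (auto intro: continuous_on_subset)
qed

text \<open>The normalization is a positive factor common to all parameters and the exponential is
  increasing, so a maximizer of the quasi-likelihood maximizes the log-likelihood at the realized
  covariance.\<close>

lemma quasi_lik_maximizer:
  assumes "compact \<Theta>" "\<Theta> \<subseteq> V" "0 < T" "1 \<le> n" "s \<in> \<Theta>" "t \<in> \<Theta>"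
    and "quasi_lik T n x Sig s = (SUP \<theta>\<in>\<Theta>. quasi_lik T n x Sig \<theta>)"
  shows "limit_loglik (rel_cov T n x) Sig t \<le> limit_loglik (rel_cov T n x) Sig s"
proof -
  define c where "c = (2 * pi * (T / real n)) powr (real n * real CARD('p) / 2)"
  have c: "c > 0" using assms by (simp add: c_def)
  have eq: "quasi_lik T n x Sig u = exp (real n * limit_loglik (rel_cov T n x) Sig u) / c" if "u \<in> \<Theta>" for u
    unfolding c_def using that assms by (intro quasi_lik_eq_exp det_Sig) auto
  have "quasi_lik T n x Sig t \<le> quasi_lik T n x Sig s"
    using sup_quasi_lik[of \<Theta> T n t x] assms by simp
  then show ?thesis
    unfolding eq[OF assms(5)] eq[OF assms(6)] using c assms(4) by (simp add: divide_le_cancel)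
qed

text \<open>If the maximizers stayed outside a neighbourhood of \<open>tb\<close> infinitely often,
  compactness would give a limit point \<open>t\<close> in \<Theta> outside it. Joint continuity in
  \<open>S\<close> and \<theta> carries the maximum property to the limit, making \<open>t\<close>
  at least as good as \<open>tb\<close>, against uniqueness.\<close>

lemma argmax_tendsto:
  assumes \<Theta>: "compact \<Theta>" "\<Theta> \<subseteq> V" and S: "S \<longlonglongrightarrow> S0" and \<theta>: "\<And>k. \<theta> k \<in> \<Theta>"
    and max: "\<And>k t. t \<in> \<Theta> \<Longrightarrow> limit_loglik (S k) Sig t \<le> limit_loglik (S k) Sig (\<theta> k)"
    and tb: "tb \<in> \<Theta>" "\<And>t. t \<in> \<Theta> \<Longrightarrow> limit_loglik S0 Sig tb \<le> limit_loglik S0 Sig t \<Longrightarrow> t = tb"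
  shows "\<theta> \<longlonglongrightarrow> tb"
proof (rule topological_tendstoI, rule ccontr)
  fix W assume W: "open W" "tb \<in> W" and nW: "\<not> (\<forall>\<^sub>F k in sequentially. \<theta> k \<in> W)"
  obtain r :: "nat \<Rightarrow> nat" where r: "strict_mono r" "\<And>k. \<theta> (r k) \<notin> W"
    using not_eventually_sequentiallyD[OF nW] by blast
  have "compact (\<Theta> - W)" using \<Theta>(1) W(1) by (rule compact_diff)
  moreover have "\<forall>k. (\<theta> \<circ> r) k \<in> \<Theta> - W" using r(2) \<theta> by simp
  ultimately obtain t s where t: "t \<in> \<Theta> - W" and s: "strict_mono s" and lim: "((\<theta> \<circ> r) \<circ> s) \<longlonglongrightarrow> t"
    unfolding compact_def by blast
  have \<theta>V: "\<theta> k \<in> V" for k using \<theta> \<Theta>(2) by blast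
  have rs: "strict_mono (r \<circ> s)" using r(1) s by (rule strict_mono_o)
  have S': "(\<lambda>k. S ((r \<circ> s) k)) \<longlonglongrightarrow> S0" using LIMSEQ_subseq_LIMSEQ[OF S rs] by (simp add: o_def)
  have "(\<lambda>k. limit_loglik (S ((r \<circ> s) k)) Sig (\<theta> ((r \<circ> s) k))) \<longlonglongrightarrow> limit_loglik S0 Sig t"
    using S' lim t \<theta>V \<Theta>(2) by (intro tendsto_limit_loglik) (auto simp: o_def)
  moreover have "(\<lambda>k. limit_loglik (S ((r \<circ> s) k)) Sig tb) \<longlonglongrightarrow> limit_loglik S0 Sig tb"
    using S' tb \<Theta>(2) by (intro tendsto_limit_loglik) auto
  ultimately have "limit_loglik S0 Sig tb \<le> limit_loglik S0 Sig t"
    using max[OF tb(1)] by (intro LIMSEQ_le) auto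
  then show False using tb(2) t W by auto
qed

lemma QBIC_limit:
  assumes \<Theta>: "compact \<Theta>" "\<Theta> \<subseteq> V" and T: "0 < T"
    and n: "\<And>k. 1 \<le> n k" "filterlim n at_top sequentially"
    and S: "(\<lambda>k. rel_cov T (n k) x) \<longlonglongrightarrow> S0" and \<theta>: "\<And>k. \<theta> k \<in> \<Theta>"
    and max: "\<And>k. quasi_lik T (n k) x Sig (\<theta> k) = (SUP t\<in>\<Theta>. quasi_lik T (n k) x Sig t)"
    and opt: "optimal_parameter S0 \<Theta> Sig tb" and C2: "condition_C2 q S0 \<Theta> Sig tb"
  shows "(\<lambda>k. QBIC1 q T (n k) x Sig (\<theta> k) / real (n k)) \<longlonglongrightarrow> - 2 * limit_loglik S0 Sig tb"
    and "(\<lambda>k. QBIC2 q T (n k) x Sig (\<theta> k) / real (n k)) \<longlonglongrightarrow> - 2 * limit_loglik S0 Sig tb"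
proof -
  let ?S = "\<lambda>k. rel_cov T (n k) x"
  have tb: "tb \<in> \<Theta>" using opt by (simp add: optimal_parameter_def)
  have \<theta>V: "\<theta> k \<in> V" for k using \<theta> \<Theta> by auto
  have n0: "n k \<noteq> 0" for k using n(1)[of k] by simp
  have lim\<theta>: "\<theta> \<longlonglongrightarrow> tb"
  proof (rule argmax_tendsto[OF \<Theta> S \<theta> _ tb])
    show "limit_loglik (?S k) Sig t \<le> limit_loglik (?S k) Sig (\<theta> k)" if "t \<in> \<Theta>" for k t
      using quasi_lik_maximizer[OF \<Theta> T n(1) \<theta> that max] .
    \<comment> \<open>\<open>tb\<close> attains the supremum, so a parameter doing at least as well
      has the same value, and [C2](a) identifies it with \<open>tb\<close>.\<close>
    show "t = tb" if "t \<in> \<Theta>" "limit_loglik S0 Sig tb \<le> limit_loglik S0 Sig t" for t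
      using sup_limit_loglik[OF \<Theta> that(1), of S0] that opt C2
      unfolding optimal_parameter_def condition_C2_def by force
  qed
  have ll: "(\<lambda>k. limit_loglik (?S k) Sig (\<theta> k)) \<longlonglongrightarrow> limit_loglik S0 Sig tb"
    using S lim\<theta> tb \<theta>V \<Theta>(2) by (intro tendsto_limit_loglik) auto
  have qll: "quasi_loglik T (n k) x Sig (\<theta> k) = real (n k) * limit_loglik (?S k) Sig (\<theta> k)" for k
    using det_Sig[OF \<theta>V] T n(1) by (rule quasi_loglik_eq)
  have ln_n: "(\<lambda>k. ln (real (n k)) / real (n k)) \<longlonglongrightarrow> 0"
    using filterlim_compose[OF lim_ln_over_n n(2)] by simp
  have inv_n: "(\<lambda>k. 1 / real (n k)) \<longlonglongrightarrow> 0"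
    using filterlim_compose[OF lim_1_over_n n(2)] by simp
  have "(\<lambda>k. - 2 * limit_loglik (?S k) Sig (\<theta> k) + real q * (ln (real (n k)) / real (n k)))
      \<longlonglongrightarrow> - 2 * limit_loglik S0 Sig tb + real q * 0"
    by (intro tendsto_intros ll ln_n)
  moreover have "QBIC2 q T (n k) x Sig (\<theta> k) / real (n k) =
      - 2 * limit_loglik (?S k) Sig (\<theta> k) + real q * (ln (real (n k)) / real (n k))" for k
    using n0[of k] by (simp add: QBIC2_def qll field_simps)
  ultimately show "(\<lambda>k. QBIC2 q T (n k) x Sig (\<theta> k) / real (n k)) \<longlonglongrightarrow> - 2 * limit_loglik S0 Sig tb"
    by simp
  define J where "J = (\<lambda>k. info (?S k) (\<theta> k))"
  define G where "G = (\<lambda>k. obs_information q T (n k) x Sig (\<theta> k))"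
  have G: "G k = (if pos_def_mat q (J k) then J k else 1\<^sub>m q)" for k
    unfolding G_def J_def using \<theta>V T n(1) by (rule obs_information_eq)
  have "pos_def_mat q (info S0 tb)"
    using C2 tb \<Theta>(2) by (simp add: condition_C2_def info_eq_hessian subset_iff)
  \<comment> \<open>A nonzero limit keeps the logarithm of the determinant convergent, so that it
    vanishes after division by \<open>n\<close>.\<close>
  then have det0: "Determinant.det (info S0 tb) \<noteq> 0"
    by (intro pos_def_mat_det_nonzero) (auto simp: info_def)
  have "(\<lambda>k. Determinant.det (J k)) \<longlonglongrightarrow> Determinant.det (info S0 tb)"
    unfolding J_def using S lim\<theta> tb \<theta>V \<Theta>(2) by (intro tendsto_det_info) auto
  then have "(\<lambda>k. ln (Determinant.det (J k))) \<longlonglongrightarrow> ln (Determinant.det (info S0 tb))"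
    using det0 by (rule tendsto_ln)
  then have "(\<lambda>k. \<bar>ln (Determinant.det (J k))\<bar> * (1 / real (n k))) \<longlonglongrightarrow> \<bar>ln (Determinant.det (info S0 tb))\<bar> * 0"
    by (intro tendsto_mult[OF tendsto_rabs inv_n])
  then have lnJ: "(\<lambda>k. \<bar>ln (Determinant.det (J k))\<bar> * (1 / real (n k))) \<longlonglongrightarrow> 0" by simp
  \<comment> \<open>In either case of its definition \<open>G k\<close> has a log-determinant no
    larger in absolute value than that of \<open>J k\<close>: the identity contributes 0.\<close>
  have ln_G: "(\<lambda>k. ln (Determinant.det (G k)) / real (n k)) \<longlonglongrightarrow> 0"
  proof (rule Lim_null_comparison[OF _ lnJ])
    show "\<forall>\<^sub>F k in sequentially. norm (ln (Determinant.det (G k)) / real (n k)) \<le> \<bar>ln (Determinant.det (J k))\<bar> * (1 / real (n k))"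
      by (intro always_eventually allI) (simp add: G divide_right_mono)
  qed
  have "Determinant.det (G k) \<noteq> 0" for k
    using pos_def_mat_det_nonzero[of "J k" q] by (auto simp: G J_def info_def)
  moreover have "dim_col (G k) = q" for k by (simp add: G J_def info_def)
  ultimately have "ln (Determinant.det (real (n k) \<cdot>\<^sub>m G k)) = real q * ln (real (n k)) + ln (Determinant.det (G k))" for k
    using n0[of k] by (simp add: ln_mult ln_realpow)
  then have "QBIC1 q T (n k) x Sig (\<theta> k) / real (n k) =
      - 2 * limit_loglik (?S k) Sig (\<theta> k) + (real q * (ln (real (n k)) / real (n k)) + ln (Determinant.det (G k)) / real (n k))" for k
    using n0[of k] by (simp add: QBIC1_def qll G_def field_simps)
  moreover have "(\<lambda>k. - 2 * limit_loglik (?S k) Sig (\<theta> k) + (real q * (ln (real (n k)) / real (n k)) + ln (Determinant.det (G k)) / real (n k)))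
      \<longlonglongrightarrow> - 2 * limit_loglik S0 Sig tb + (real q * 0 + 0)"
    by (intro tendsto_intros ll ln_n ln_G)
  ultimately show "(\<lambda>k. QBIC1 q T (n k) x Sig (\<theta> k) / real (n k)) \<longlonglongrightarrow> - 2 * limit_loglik S0 Sig tb"
    by simp
qed

end

section \<open>Measurability of the information criteria\<close>


text \<open>Quadratic forms are taken on sequences, where the product topology is at hand for the
  compactness and density arguments below.\<close>

definition qform :: "nat \<Rightarrow> (nat \<Rightarrow> nat \<Rightarrow> real) \<Rightarrow> (nat \<Rightarrow> real) \<Rightarrow> real" where
  "qform q a x = (\<Sum>i<q. \<Sum>j<q. x i * (a i j * x j))"

definition unit_sphere :: "nat \<Rightarrow> (nat \<Rightarrow> real) set" where
  "unit_sphere q = {x. (\<forall>i\<ge>q. x i = 0) \<and> (\<Sum>i<q. (x i)\<^sup>2) = 1}"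

text \<open>A closed subset of a product of compact factors, namely \<open>{-1..1}\<close> for
  indices below \<open>q\<close> and \<open>{0}\<close> from \<open>q\<close> on.\<close>

lemma compact_unit_sphere: "compact (unit_sphere q)"
proof -
  let ?C = "Pi\<^sub>E UNIV (\<lambda>i. if i < q then {-1..1::real} else {0})"
  have "compactin (product_topology (\<lambda>_. euclidean) UNIV) ?C"
    by (subst compactin_PiE) auto
  then have C: "compact ?C" by (simp add: euclidean_product_topology)
  have "closed {x::nat \<Rightarrow> real. (\<Sum>i<q. (x i)\<^sup>2) = 1}"
    by (intro closed_Collect_eq continuous_intros continuous_on_product_coordinates)
  with C have "compact (?C \<inter> {x. (\<Sum>i<q. (x i)\<^sup>2) = 1})" by (rule compact_Int_closed)
  moreover have "unit_sphere q = ?C \<inter> {x. (\<Sum>i<q. (x i)\<^sup>2) = 1}"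
  proof (intro equalityI subsetI)
    fix x assume x: "x \<in> unit_sphere q"
    have "\<bar>x i\<bar> \<le> 1" if "i < q" for i
    proof -
      have "(x i)\<^sup>2 \<le> (\<Sum>i<q. (x i)\<^sup>2)" using that by (intro member_le_sum) auto
      then show ?thesis using x by (simp add: unit_sphere_def abs_le_square_iff[of _ 1, simplified])
    qed
    then have "-1 \<le> x i \<and> x i \<le> 1" if "i < q" for i using that by (metis abs_le_iff minus_le_iff)
    then show "x \<in> ?C \<inter> {x. (\<Sum>i<q. (x i)\<^sup>2) = 1}"
      using x by (simp add: unit_sphere_def PiE_iff)
  next
    fix x assume x: "x \<in> ?C \<inter> {x. (\<Sum>i<q. (x i)\<^sup>2) = 1}"
    have "x i = 0" if "q \<le> i" for i
    proof -
      have "x i \<in> (if i < q then {-1..1} else {0})" using x by blast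
      then show ?thesis using that by simp
    qed
    then show "x \<in> unit_sphere q" using x by (simp add: unit_sphere_def)
  qed
  ultimately show ?thesis by simp
qed

lemma continuous_qform: "continuous_on A (qform q a)"
  unfolding qform_def[abs_def]
  by (intro continuous_intros continuous_on_subset[OF continuous_on_product_coordinates subset_UNIV])

lemma pos_def_mat_iff_sphere:
  "pos_def_mat q (Matrix.mat q q (\<lambda>(i, j). a i j)) \<longleftrightarrow> (\<forall>x\<in>unit_sphere q. 0 < qform q a x)"
proof -
  have q: "scalar_prod (Matrix.vec q x) (Matrix.mat q q (\<lambda>(i, j). a i j) *\<^sub>v Matrix.vec q x) = qform q a x" for x
    by (simp add: scalar_prod_def qform_def sum_distrib_left lessThan_atLeast0 mult.assoc)
  show ?thesis
  proof (intro iffI ballI)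
    fix x assume pd: "pos_def_mat q (Matrix.mat q q (\<lambda>(i, j). a i j))" and x: "x \<in> unit_sphere q"
    have "Matrix.vec q x \<noteq> 0\<^sub>v q"
    proof
      assume "Matrix.vec q x = 0\<^sub>v q"
      then have "x i = 0" if "i < q" for i using that by (metis index_vec index_zero_vec(1))
      then show False using x by (simp add: unit_sphere_def)
    qed
    then show "0 < qform q a x" using pd q[of x] unfolding pos_def_mat_def by (metis vec_carrier)
  next
    assume pos: "\<forall>x\<in>unit_sphere q. 0 < qform q a x"
    show "pos_def_mat q (Matrix.mat q q (\<lambda>(i, j). a i j))"
      unfolding pos_def_mat_def
    proof (intro ballI impI)
      fix v :: "real Matrix.vec" assume v: "v \<in> carrier_vec q" "v \<noteq> 0\<^sub>v q"
      define y where "y = (\<lambda>i. if i < q then vec_index v i else 0)"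
      have vy: "v = Matrix.vec q y" using v(1) by (intro eq_vecI) (auto simp: y_def)
      define s where "s = (\<Sum>i<q. (y i)\<^sup>2)"
      have "\<exists>i<q. y i \<noteq> 0" using v(2) vy by (metis eq_vecI dim_vec index_vec index_zero_vec)
      then have s: "s > 0" unfolding s_def by (auto intro: sum_pos2)
      define x where "x = (\<lambda>i. y i / sqrt s)"
      have "(\<Sum>i<q. (x i)\<^sup>2) = s / s" using s
        by (simp add: x_def power_divide sum_divide_distrib[symmetric] s_def[symmetric])
      then have "x \<in> unit_sphere q" using s by (auto simp: unit_sphere_def x_def y_def)
      then have "0 < s * qform q a x" using pos s by simp
      also have "s * qform q a x = qform q a y"
        using s by (simp add: qform_def x_def sum_distrib_left field_simps)
      finally show "0 < scalar_prod v (Matrix.mat q q (\<lambda>(i, j). a i j) *\<^sub>v v)"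
        unfolding vy q .
    qed
  qed
qed

text \<open>Positivity of a quadratic form on the compact unit sphere is a countable condition:
  it is bounded away from 0 on a countable dense subset.\<close>

lemma pred_pos_def_mat:
  assumes [measurable]: "\<And>i j. i < q \<Longrightarrow> j < q \<Longrightarrow> (\<lambda>\<omega>. a \<omega> i j) \<in> borel_measurable M"
  shows "Measurable.pred M (\<lambda>\<omega>. pos_def_mat q (Matrix.mat q q (\<lambda>(i, j). a \<omega> i j)))"
proof -
  obtain D :: "(nat \<Rightarrow> real) set" where D: "countable D" "D \<subseteq> unit_sphere q" "unit_sphere q \<subseteq> closure D"
    using separable[of "unit_sphere q"] by blast
  have "pos_def_mat q (Matrix.mat q q (\<lambda>(i, j). b i j)) \<longleftrightarrow> (\<exists>k. \<forall>x\<in>D. inverse (real (Suc k)) \<le> qform q b x)" for b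
    unfolding pos_def_mat_iff_sphere
  proof
    assume pos: "\<forall>x\<in>unit_sphere q. 0 < qform q b x"
    show "\<exists>k. \<forall>x\<in>D. inverse (real (Suc k)) \<le> qform q b x"
    \<comment> \<open>\<open>D\<close> is empty only together with the sphere, that is for
      \<open>q = 0\<close>; then every \<open>k\<close> will do.\<close>
    proof (cases "D = {}")
      case False
      with D(2) have "unit_sphere q \<noteq> {}" by auto
      from continuous_attains_inf[OF compact_unit_sphere this continuous_qform]
      obtain x where x: "x \<in> unit_sphere q" "\<forall>y\<in>unit_sphere q. qform q b x \<le> qform q b y" by blast
      then obtain k where "inverse (real (Suc k)) < qform q b x" using pos reals_Archimedean by blast
      then show ?thesis using x D(2) by (meson less_le_trans less_imp_le subsetD)
    qed auto
  next
    assume "\<exists>k. \<forall>x\<in>D. inverse (real (Suc k)) \<le> qform q b x"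
    then obtain k where k: "D \<subseteq> {x. inverse (real (Suc k)) \<le> qform q b x}" by blast
    have "closed {x. inverse (real (Suc k)) \<le> qform q b x}"
      by (intro closed_Collect_le continuous_intros continuous_qform)
    with k have "closure D \<subseteq> {x. inverse (real (Suc k)) \<le> qform q b x}" by (rule closure_minimal)
    moreover have "0 < inverse (real (Suc k))" by simp
    ultimately show "\<forall>x\<in>unit_sphere q. 0 < qform q b x"
      using D(3) by (metis (mono_tags, lifting) less_le_trans mem_Collect_eq subset_eq)
  qed
  moreover have "Measurable.pred M (\<lambda>\<omega>. \<exists>k. \<forall>x\<in>D. inverse (real (Suc k)) \<le> qform q (a \<omega>) x)"
  proof -
    have [measurable]: "(\<lambda>\<omega>. qform q (a \<omega>) x) \<in> borel_measurable M" for x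
      unfolding qform_def by (intro borel_measurable_sum borel_measurable_times borel_measurable_const assms) auto
    have "Measurable.pred M (\<lambda>\<omega>. \<forall>x\<in>D. inverse (real (Suc k)) \<le> qform q (a \<omega>) x)" for k
      by (intro measurable_pred_countable[OF D(1)]) measurable
    then show ?thesis by (intro pred_intros_countable)
  qed
  ultimately show ?thesis by simp
qed

lemma borel_measurable_vec_nth [measurable (raw)]:
  fixes f :: "'a \<Rightarrow> real ^ 'n::finite"
  assumes "f \<in> borel_measurable M"
  shows "(\<lambda>x. f x $ i) \<in> borel_measurable M"
  by (rule borel_measurable_continuous_on[OF _ assms]) (intro continuous_intros)

context smooth_covariance
begin

text \<open>\<open>f\<close> is continuous only on \<open>V\<close>, so the composition runs through
  the Borel sets of \<Theta>, in which the estimator takes its values.\<close>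

lemma measurable_continuous_est:
  assumes "continuous_on V f" "est \<in> borel_measurable P" "\<And>\<omega>. \<omega> \<in> space P \<Longrightarrow> est \<omega> \<in> \<Theta>" "\<Theta> \<subseteq> V"
  shows "(\<lambda>\<omega>. f (est \<omega>)) \<in> borel_measurable P"
proof -
  have "est \<in> P \<rightarrow>\<^sub>M restrict_space borel \<Theta>"
    using assms by (intro measurable_restrict_space2) auto
  moreover have "f \<in> borel_measurable (restrict_space borel \<Theta>)"
    using assms by (intro borel_measurable_continuous_on_restrict) (rule continuous_on_subset)
  ultimately show ?thesis by (rule measurable_compose)
qed

lemma measurable_rel_cov:
  assumes "\<And>t. 0 \<le> t \<Longrightarrow> X t \<in> borel_measurable P" "0 < T"
  shows "(\<lambda>\<omega>. rel_cov T n (\<lambda>t. X t \<omega>) $ a $ b) \<in> borel_measurable P"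
proof -
  have [measurable]: "(\<lambda>\<omega>. X (real i * (T / real n)) \<omega>) \<in> borel_measurable P" for i
    using assms by simp
  have [measurable]: "(\<lambda>\<omega>. incr T n (\<lambda>t. X t \<omega>) i $ a) \<in> borel_measurable P" for i a
    unfolding incr_def by measurable
  show ?thesis unfolding rel_cov_def outer_def by simp
qed

lemma measurable_QBIC:
  assumes X: "\<And>t. 0 \<le> t \<Longrightarrow> X t \<in> borel_measurable P" and T: "0 < T" and n: "1 \<le> n"
    and est: "est \<in> borel_measurable P" "\<And>\<omega>. \<omega> \<in> space P \<Longrightarrow> est \<omega> \<in> \<Theta>" and \<Theta>: "\<Theta> \<subseteq> V"
  shows "(\<lambda>\<omega>. QBIC1 q T n (\<lambda>t. X t \<omega>) Sig (est \<omega>)) \<in> borel_measurable P"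
    and "(\<lambda>\<omega>. QBIC2 q T n (\<lambda>t. X t \<omega>) Sig (est \<omega>)) \<in> borel_measurable P"
proof -
  let ?S = "\<lambda>\<omega>. rel_cov T n (\<lambda>t. X t \<omega>)"
  have V: "est \<omega> \<in> V" if "\<omega> \<in> space P" for \<omega> using est(2)[OF that] \<Theta> by auto
  have coef [measurable]: "(\<lambda>\<omega>. coef (?S \<omega>) k) \<in> borel_measurable P" for k
    using measurable_rel_cov[OF X T] by (cases k) (auto simp: coef_def split: prod.split)
  have [measurable]: "(\<lambda>\<omega>. part k (est \<omega>)) \<in> borel_measurable P" for k
    by (rule measurable_continuous_est[OF continuous_part est \<Theta>])
  have [measurable]: "(\<lambda>\<omega>. limit_loglik (?S \<omega>) Sig (est \<omega>)) \<in> borel_measurable P"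
    unfolding limit_loglik_eq by measurable
  have hess: "(\<lambda>\<omega>. hess_ll (?S \<omega>) (est \<omega>) i j) \<in> borel_measurable P" if "i < q" "j < q" for i j
    unfolding hess_ll_def using that
    by (intro borel_measurable_sum borel_measurable_times coef measurable_continuous_est[OF continuous_part2 est \<Theta>])
  have [measurable]: "(\<lambda>\<omega>. Determinant.det (info (?S \<omega>) (est \<omega>))) \<in> borel_measurable P"
  proof -
    have "p i < q" if "p permutes {0..<q}" "i < q" for p i
      using that permutes_in_image[of p "{0..<q}" i] by simp
    then show ?thesis
      unfolding det_info
      by (intro borel_measurable_sum borel_measurable_times borel_measurable_const borel_measurable_prod borel_measurable_uminus hess) auto
  qed
  have [measurable]: "Measurable.pred P (\<lambda>\<omega>. pos_def_mat q (info (?S \<omega>) (est \<omega>)))"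
    unfolding info_def by (intro pred_pos_def_mat borel_measurable_uminus hess)
  have qll: "quasi_loglik T n (\<lambda>t. X t \<omega>) Sig (est \<omega>) = real n * limit_loglik (?S \<omega>) Sig (est \<omega>)" if "\<omega> \<in> space P" for \<omega>
    using det_Sig[OF V[OF that]] T n by (rule quasi_loglik_eq)
  show "(\<lambda>\<omega>. QBIC2 q T n (\<lambda>t. X t \<omega>) Sig (est \<omega>)) \<in> borel_measurable P"
    unfolding QBIC2_def by (subst measurable_cong[OF arg_cong2[where f = "(+)", OF arg_cong[where f = "\<lambda>x. - 2 * x", OF qll] refl]]) measurable
  \<comment> \<open>The determinant of \<open>n G\<close> with the case distinction pulled out:
    \<open>real n ^ q\<close> comes from the scalar factor, 1 is the determinant of the identity.
    The condition is measurable by \<open>pred_pos_def_mat\<close>.\<close>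
  have "QBIC1 q T n (\<lambda>t. X t \<omega>) Sig (est \<omega>) = - 2 * (real n * limit_loglik (?S \<omega>) Sig (est \<omega>)) +
      ln (real n ^ q * (if pos_def_mat q (info (?S \<omega>) (est \<omega>)) then Determinant.det (info (?S \<omega>) (est \<omega>)) else 1))"
    if "\<omega> \<in> space P" for \<omega>
    using obs_information_eq[OF V[OF that] T n] by (simp add: QBIC1_def qll[OF that] info_def)
  then show "(\<lambda>\<omega>. QBIC1 q T n (\<lambda>t. X t \<omega>) Sig (est \<omega>)) \<in> borel_measurable P"
    by (subst measurable_cong) (assumption, measurable)
qed

end

section \<open>Increments of Wiener processes\<close>


context prob_space
begin

text \<open>Converts the independence hypotheses, which concern families of events, into
  independence of real random variables, where expectations of products factor.\<close>

lemma indep_var_of_indep_set: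
  assumes ind: "indep_set \<A> \<B>"
    and X: "random_variable borel X" "\<And>A. A \<in> sets borel \<Longrightarrow> X -` A \<inter> space M \<in> \<A>"
    and Y: "random_variable borel Y" "\<And>A. A \<in> sets borel \<Longrightarrow> Y -` A \<inter> space M \<in> \<B>"
  shows "indep_var borel X borel Y"
proof -
  have "indep_sets (case_bool {X -` A \<inter> space M |A. A \<in> sets borel} {Y -` A \<inter> space M |A. A \<in> sets borel}) UNIV"
    by (rule indep_sets_mono_sets[OF ind[unfolded indep_set_def]]) (use X(2) Y(2) in \<open>auto split: bool.splits\<close>)
  moreover have "case_bool {X -` A \<inter> space M |A. A \<in> sets borel} {Y -` A \<inter> space M |A. A \<in> sets borel} =
      (\<lambda>i. {case_bool X Y i -` A \<inter> space M |A. A \<in> sets (case_bool borel borel i)})"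
    by (intro ext) (auto split: bool.split)
  ultimately show ?thesis
    using X(1) Y(1) unfolding indep_var_def indep_vars_def2 by (auto split: bool.split)
qed

lemma indep_set_of_indep_sets:
  assumes "indep_sets E I" "i \<in> I" "j \<in> I" "i \<noteq> j"
  shows "indep_set (E i) (E j)"
  unfolding indep_sets2_eq
proof (intro conjI ballI)
  show "E i \<subseteq> events" "E j \<subseteq> events" using assms unfolding indep_sets_def by auto
  fix a b assume "a \<in> E i" "b \<in> E j"
  then have "prob (\<Inter>k\<in>{i, j}. if k = i then a else b) = (\<Prod>k\<in>{i, j}. prob (if k = i then a else b))"
    using assms by (intro indep_setsD[OF assms(1)]) auto
  then show "prob (a \<inter> b) = prob a * prob b" using assms(4) by (auto simp: Int_commute)
qed

end

lemma stochastic_basis_subalgebra: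
  assumes "stochastic_basis P F" "0 \<le> s" "s \<le> t"
  shows "subalgebra P (F s)" "subalgebra (F t) (F s)"
proof -
  have sub: "subalgebra P (F r)" if "0 \<le> r" for r
    using assms(1) that by (simp add: stochastic_basis_def)
  then show "subalgebra P (F s)" using assms(2) .
  have "sets (F s) \<subseteq> sets (F t)"
    using assms(1)[unfolded stochastic_basis_def, THEN conjunct2, THEN conjunct2, THEN conjunct2, THEN conjunct1]
      assms(2,3) by simp
  moreover have "space (F s) = space (F t)"
    using sub[OF assms(2)] sub[of t] assms by (simp add: subalgebra_def)
  ultimately show "subalgebra (F t) (F s)" by (simp add: subalgebra_def)
qed

lemma measurable_stochastic_basis:
  assumes "stochastic_basis P F" "0 \<le> s" "f \<in> measurable (F s) N"
  shows "f \<in> measurable P N" and "s \<le> t \<Longrightarrow> f \<in> measurable (F t) N"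
proof -
  show "f \<in> measurable P N"
    by (rule measurable_from_subalg[OF stochastic_basis_subalgebra(1)[OF assms(1,2) order_refl] assms(3)])
  show "f \<in> measurable (F t) N" if "s \<le> t"
    by (rule measurable_from_subalg[OF stochastic_basis_subalgebra(2)[OF assms(1,2) that] assms(3)])
qed

context
  fixes P :: "'w measure" and F :: "real \<Rightarrow> 'w measure" and W :: "real \<Rightarrow> 'w \<Rightarrow> real ^ 'r::finite"
  assumes sb: "stochastic_basis P F" and W: "wiener_process P F W"
begin

interpretation prob_space P using sb by (simp add: stochastic_basis_def)

lemma wiener_measurable:
  assumes "0 \<le> s"
  shows "W s \<in> borel_measurable P" and "s \<le> t \<Longrightarrow> W s \<in> borel_measurable (F t)"
proof -
  have "W s \<in> borel_measurable (F s)" using W assms by (simp add: wiener_process_def)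
  from measurable_stochastic_basis[OF sb assms this]
  show "W s \<in> borel_measurable P" and "s \<le> t \<Longrightarrow> W s \<in> borel_measurable (F t)" .
qed

text \<open>The fourth moment is needed because the realized variance is a sum of squares whose own
  variance has to be bounded.\<close>

lemma wiener_increment_moments:
  assumes "0 \<le> s" "s < t"
  shows "integrable P (\<lambda>\<omega>. ((W t \<omega> - W s \<omega>) $ i) ^ k)"
    and "(\<integral>\<omega>. (W t \<omega> - W s \<omega>) $ i \<partial>P) = 0"
    and "(\<integral>\<omega>. ((W t \<omega> - W s \<omega>) $ i)\<^sup>2 \<partial>P) = t - s"
    and "(\<integral>\<omega>. ((W t \<omega> - W s \<omega>) $ i) ^ 4 \<partial>P) = 3 * (t - s)\<^sup>2"
proof -
  let ?\<sigma> = "sqrt (t - s)"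
  have \<sigma>: "0 < ?\<sigma>" using assms by simp
  have d: "distributed P lborel (\<lambda>\<omega>. (W t \<omega> - W s \<omega>) $ i) (\<lambda>x. ennreal (normal_density 0 ?\<sigma> x))"
    using W assms unfolding wiener_process_def by blast
  show "integrable P (\<lambda>\<omega>. ((W t \<omega> - W s \<omega>) $ i) ^ k)"
    using integrable_normal_moment[OF \<sigma>, of 0 k]
      distributed_integrable[OF d, of "\<lambda>x. x ^ k"] by (simp add: normal_density_nonneg)
  have m: "(\<integral>\<omega>. ((W t \<omega> - W s \<omega>) $ i) ^ k \<partial>P) = (\<integral>x. normal_density 0 ?\<sigma> x * x ^ k \<partial>lborel)" for k
    using distributed_integral[OF d, of "\<lambda>x. x ^ k"] by (simp add: normal_density_nonneg)
  show "(\<integral>\<omega>. (W t \<omega> - W s \<omega>) $ i \<partial>P) = 0"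
    using m[of 1] integral_normal_moment_odd[OF \<sigma>, of 0 0] by simp
  show "(\<integral>\<omega>. ((W t \<omega> - W s \<omega>) $ i)\<^sup>2 \<partial>P) = t - s"
    using m[of 2] integral_normal_moment_even[OF \<sigma>, of 0 1] assms by (simp add: fact_2)
  have "(\<integral>x. normal_density 0 ?\<sigma> x * x ^ 4 \<partial>lborel) = fact 4 / ((2 / ?\<sigma>\<^sup>2)\<^sup>2 * fact 2)"
    using integral_normal_moment_even[OF \<sigma>, of 0 2] by simp
  also have "\<dots> = 3 * (t - s)\<^sup>2"
    using assms by (simp add: fact_numeral power2_eq_square divide_simps)
  finally show "(\<integral>\<omega>. ((W t \<omega> - W s \<omega>) $ i) ^ 4 \<partial>P) = 3 * (t - s)\<^sup>2"
    by (simp only: m)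
qed

text \<open>The source of orthogonality over disjoint intervals: anything known at time
  \<open>s\<close> is independent of functions of a later increment.\<close>

lemma wiener_future_indep:
  fixes G :: "'w \<Rightarrow> real" and g :: "real ^ 'r \<Rightarrow> real"
  assumes "0 \<le> s" "s < t" "G \<in> borel_measurable (F s)" "g \<in> borel_measurable borel"
  shows "indep_var borel G borel (\<lambda>\<omega>. g (W t \<omega> - W s \<omega>))"
proof -
  have [measurable]: "W t \<in> borel_measurable P" "W s \<in> borel_measurable P" "g \<in> borel_measurable borel"
    using wiener_measurable assms by auto
  have sp: "space (F s) = space P" using stochastic_basis_subalgebra(1)[OF sb assms(1) order_refl] by (simp add: subalgebra_def)
  show ?thesis
  proof (rule indep_var_of_indep_set)
    show "indep_set (sets (F s)) {(\<lambda>\<omega>. W t \<omega> - W s \<omega>) -` A \<inter> space P |A. A \<in> sets borel}"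
      using W assms unfolding wiener_process_def by blast
    show "random_variable borel G" by (rule measurable_stochastic_basis(1)[OF sb assms(1,3)])
    show "G -` A \<inter> space P \<in> sets (F s)" if "A \<in> sets borel" for A
      using measurable_sets[OF assms(3) that] by (simp add: sp)
    fix A :: "real set" assume "A \<in> sets borel"
    then have "g -` A \<in> sets borel" using measurable_sets[OF assms(4)] by simp
    moreover have "(\<lambda>\<omega>. g (W t \<omega> - W s \<omega>)) -` A \<inter> space P = (\<lambda>\<omega>. W t \<omega> - W s \<omega>) -` (g -` A) \<inter> space P" by auto
    ultimately show "(\<lambda>\<omega>. g (W t \<omega> - W s \<omega>)) -` A \<inter> space P \<in> {(\<lambda>\<omega>. W t \<omega> - W s \<omega>) -` A \<inter> space P |A. A \<in> sets borel}"
      by blast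
  qed measurable
qed

lemma wiener_components_indep:
  assumes "0 \<le> s" "s < t" "c \<noteq> d"
  shows "indep_var borel (\<lambda>\<omega>. (W t \<omega> - W s \<omega>) $ c) borel (\<lambda>\<omega>. (W t \<omega> - W s \<omega>) $ d)"
proof -
  have iv: "indep_vars (\<lambda>_. borel) (\<lambda>i \<omega>. (W t \<omega> - W s \<omega>) $ i) UNIV"
    using W assms unfolding wiener_process_def by blast
  then have ind: "indep_sets (\<lambda>i. {(\<lambda>\<omega>. (W t \<omega> - W s \<omega>) $ i) -` A \<inter> space P |A. A \<in> sets borel}) UNIV"
    and rv: "\<And>i. random_variable borel (\<lambda>\<omega>. (W t \<omega> - W s \<omega>) $ i)"
    unfolding indep_vars_def2 by auto
  show ?thesis
    by (rule indep_var_of_indep_set[OF indep_set_of_indep_sets[OF ind UNIV_I UNIV_I assms(3)]]) (use rv in auto)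
qed

text \<open>Independence of different Wiener processes is a statement about the sigma-algebras they
  generate, not about \<open>F\<close>; functionals of one process therefore have to be measurable
  with respect to its own history.\<close>

lemma wiener_process_events:
  fixes G :: "'w \<Rightarrow> real"
  assumes "G \<in> borel_measurable (sigma (space P) {W t -` A \<inter> space P | t A. 0 \<le> t \<and> A \<in> sets borel})"
    and "A \<in> sets borel"
  shows "G -` A \<inter> space P \<in> process_events P W"
proof -
  have "{W t -` A \<inter> space P | t A. 0 \<le> t \<and> A \<in> sets borel} \<subseteq> Pow (space P)" by auto
  then show ?thesis
    using measurable_sets[OF assms] by (simp add: process_events_def space_measure_of_conv)
qed

lemma wiener_measurable_natural:
  assumes "0 \<le> t"
  shows "W t \<in> borel_measurable (sigma (space P) {W t -` A \<inter> space P | t A. 0 \<le> t \<and> A \<in> sets borel})"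
proof (rule measurableI)
  let ?G = "{W t -` A \<inter> space P | t A. 0 \<le> t \<and> A \<in> sets borel}"
  fix A :: "(real ^ 'r) set" assume "A \<in> sets borel"
  then have "W t -` A \<inter> space P \<in> ?G" using assms by blast
  then have "W t -` A \<inter> space P \<in> sigma_sets (space P) ?G" by (rule sigma_sets.Basic)
  moreover have "?G \<subseteq> Pow (space P)" by auto
  ultimately show "W t -` A \<inter> space (sigma (space P) ?G) \<in> sets (sigma (space P) ?G)"
    by (simp add: space_measure_of_conv)
qed simp

end

section \<open>Centred products of increments\<close>

text \<open>What an L^2 law of large numbers asks of products of increments, with \<open>c\<close>
  the covariance per unit of time: square integrability, a second moment of order
  \<open>(t - s)^2\<close>, and orthogonality on non-overlapping intervals. The constant 2 is
  attained by squares of a single Wiener component and also covers products of independent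
  components.\<close>

definition orthogonal_increments :: "'w measure \<Rightarrow> (real \<Rightarrow> 'w \<Rightarrow> real) \<Rightarrow> (real \<Rightarrow> 'w \<Rightarrow> real) \<Rightarrow> real \<Rightarrow> bool" where
  "orthogonal_increments P A B c \<longleftrightarrow>
    (\<forall>s t. 0 \<le> s \<longrightarrow> s < t \<longrightarrow>
      (\<lambda>\<omega>. (A t \<omega> - A s \<omega>) * (B t \<omega> - B s \<omega>) - c * (t - s)) \<in> borel_measurable P \<and>
      integrable P (\<lambda>\<omega>. ((A t \<omega> - A s \<omega>) * (B t \<omega> - B s \<omega>) - c * (t - s))\<^sup>2) \<and>
      (\<integral>\<omega>. ((A t \<omega> - A s \<omega>) * (B t \<omega> - B s \<omega>) - c * (t - s))\<^sup>2 \<partial>P) \<le> 2 * (t - s)\<^sup>2 \<and>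
      (\<forall>u v. t \<le> u \<longrightarrow> u < v \<longrightarrow>
        (\<integral>\<omega>. ((A t \<omega> - A s \<omega>) * (B t \<omega> - B s \<omega>) - c * (t - s)) *
              ((A v \<omega> - A u \<omega>) * (B v \<omega> - B u \<omega>) - c * (v - u)) \<partial>P) = 0))"

lemma orthogonal_increments_commute: "orthogonal_increments P A B c \<Longrightarrow> orthogonal_increments P B A c"
  unfolding orthogonal_increments_def by (simp add: mult.commute)

lemma integrable_mult_of_squares:
  fixes f g :: "'a \<Rightarrow> real"
  assumes [measurable]: "f \<in> borel_measurable M" "g \<in> borel_measurable M"
    and "integrable M (\<lambda>x. (f x)\<^sup>2)" "integrable M (\<lambda>x. (g x)\<^sup>2)"
  shows "integrable M (\<lambda>x. f x * g x)"
proof (rule Bochner_Integration.integrable_bound)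
  show "integrable M (\<lambda>x. (f x)\<^sup>2 + (g x)\<^sup>2)" using assms by simp
  have "\<bar>f x * g x\<bar> \<le> (f x)\<^sup>2 + (g x)\<^sup>2" for x
  proof -
    have "0 \<le> (\<bar>f x\<bar> - \<bar>g x\<bar>)\<^sup>2" by simp
    then have "2 * (\<bar>f x\<bar> * \<bar>g x\<bar>) \<le> (f x)\<^sup>2 + (g x)\<^sup>2" by (simp add: power2_diff)
    moreover have "0 \<le> \<bar>f x\<bar> * \<bar>g x\<bar>" by simp
    ultimately show ?thesis unfolding abs_mult by linarith
  qed
  then show "AE x in M. norm (f x * g x) \<le> norm ((f x)\<^sup>2 + (g x)\<^sup>2)"
    by (auto intro: order_trans[OF _ abs_ge_self])
qed measurable

text \<open>For equal components, the centred square has second moment \<open>3 - 2 + 1 = 2\<close>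
  times \<open>(t - s)^2\<close>; for different components, independence gives
  \<open>(t - s)^2\<close>. On disjoint intervals the later factor is centred and independent of the
  earlier one.\<close>

lemma orthogonal_increments_wiener:
  fixes W :: "real \<Rightarrow> 'w \<Rightarrow> real ^ 'r::finite"
  assumes sb: "stochastic_basis P F" and W: "wiener_process P F W"
  shows "orthogonal_increments P (\<lambda>t \<omega>. W t \<omega> $ c) (\<lambda>t \<omega>. W t \<omega> $ d) (if c = d then 1 else 0)"
proof -
  interpret prob_space P using sb by (simp add: stochastic_basis_def)
  note mom = wiener_increment_moments[OF sb W]
  let ?D = "\<lambda>s t i \<omega>. (W t \<omega> - W s \<omega>) $ i"
  let ?\<delta> = "if c = d then 1 else 0 :: real"
  define Y where "Y = (\<lambda>s t \<omega>. ?D s t c \<omega> * ?D s t d \<omega> - ?\<delta> * (t - s))"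
  have Dm: "?D s t i \<in> borel_measurable P" if "0 \<le> s" "s < t" for s t i
  proof -
    have [measurable]: "W s \<in> borel_measurable P" "W t \<in> borel_measurable P"
      using that by (auto intro: wiener_measurable(1)[OF sb W])
    show ?thesis by measurable
  qed
  have prod: "integrable P (\<lambda>\<omega>. ?D s t c \<omega> * ?D s t d \<omega>)" if "0 \<le> s" "s < t" for s t
    using Dm that mom(1)[OF that, of _ 2] by (intro integrable_mult_of_squares) auto
  have mean: "(\<integral>\<omega>. ?D s t c \<omega> * ?D s t d \<omega> \<partial>P) = ?\<delta> * (t - s)" if "0 \<le> s" "s < t" for s t
  proof (cases "c = d")
    case True then show ?thesis using mom(3)[OF that, of d] by (simp add: power2_eq_square)
  next
    case False
    then show ?thesis
      using indep_var_lebesgue_integral[OF wiener_components_indep[OF sb W that False]] mom(1)[OF that, of _ 1] mom(2)[OF that]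
      by simp
  qed
  have Y1: "integrable P (Y s t)" "(\<integral>\<omega>. Y s t \<omega> \<partial>P) = 0" if "0 \<le> s" "s < t" for s t
    unfolding Y_def using prod[OF that] mean[OF that] by (simp_all add: prob_space)
  have Y2: "integrable P (\<lambda>\<omega>. (Y s t \<omega>)\<^sup>2) \<and> (\<integral>\<omega>. (Y s t \<omega>)\<^sup>2 \<partial>P) \<le> 2 * (t - s)\<^sup>2" if st: "0 \<le> s" "s < t" for s t
  proof (cases "c = d")
    case True
    have eq: "(Y s t \<omega>)\<^sup>2 = (?D s t d \<omega>) ^ 4 - 2 * (t - s) * (?D s t d \<omega>)\<^sup>2 + (t - s)\<^sup>2" for \<omega>
      unfolding Y_def True by (simp add: power2_eq_square power4_eq_xxxx algebra_simps)
    show ?thesis unfolding eq using mom[OF st, of d]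
      by (simp add: prob_space power2_eq_square[of "t - s"]) (simp add: algebra_simps)
  next
    case False
    have eq: "(Y s t \<omega>)\<^sup>2 = (?D s t c \<omega>)\<^sup>2 * (?D s t d \<omega>)\<^sup>2" for \<omega>
      unfolding Y_def using False by (simp add: power_mult_distrib)
    have "indep_var borel ((\<lambda>x. x\<^sup>2) \<circ> ?D s t c) borel ((\<lambda>x. x\<^sup>2) \<circ> ?D s t d)"
      by (rule indep_var_compose[OF wiener_components_indep[OF sb W st False]]) measurable
    then have ind: "indep_var borel (\<lambda>\<omega>. (?D s t c \<omega>)\<^sup>2) borel (\<lambda>\<omega>. (?D s t d \<omega>)\<^sup>2)" by (simp add: comp_def)
    show ?thesis unfolding eq
      using indep_var_lebesgue_integral[OF ind] indep_var_integrable[OF ind] mom[OF st] st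
      by (simp add: power2_eq_square[of "t - s"])
  qed
  have Yo: "(\<integral>\<omega>. Y s t \<omega> * Y u v \<omega> \<partial>P) = 0" if "0 \<le> s" "s < t" "t \<le> u" "u < v" for s t u v
  proof -
    define g where "g = (\<lambda>x::real ^ 'r. x $ c * x $ d - ?\<delta> * (v - u))"
    have [measurable]: "W s \<in> borel_measurable (F u)" "W t \<in> borel_measurable (F u)"
      using wiener_measurable(2)[OF sb W] that by auto
    have "Y s t \<in> borel_measurable (F u)" unfolding Y_def by measurable
    moreover have "g \<in> borel_measurable borel" unfolding g_def by measurable
    ultimately have "indep_var borel (Y s t) borel (\<lambda>\<omega>. g (W v \<omega> - W u \<omega>))"
      using that by (intro wiener_future_indep[OF sb W]) auto
    moreover have "(\<lambda>\<omega>. g (W v \<omega> - W u \<omega>)) = Y u v" by (simp add: g_def Y_def)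
    ultimately show ?thesis
      using indep_var_lebesgue_integral[of "Y s t" "Y u v"] Y1[of s t] Y1[of u v] that by simp
  qed
  have "Y s t \<in> borel_measurable P" if "0 \<le> s" "s < t" for s t
    unfolding Y_def using Dm[OF that] by measurable
  with Y2 Yo show ?thesis
    unfolding orthogonal_increments_def Y_def by simp
qed

text \<open>The increments of \<open>W\<close> and \<open>W'\<close> are independent of the past one
  at a time, not as a pair, so the later product cannot be split off as a whole. The four factors
  are regrouped by process instead: independence of the processes factors the expectation, and the
  increments of \<open>W\<close> alone are already uncorrelated.\<close>

lemma orthogonal_increments_indep_wiener:
  fixes W :: "real \<Rightarrow> 'w \<Rightarrow> real ^ 'r::finite" and W' :: "real \<Rightarrow> 'w \<Rightarrow> real ^ 'q::finite"
  assumes sb: "stochastic_basis P F" and W: "wiener_process P F W" and W': "wiener_process P F W'"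
    and ind: "prob_space.indep_set P (process_events P W) (process_events P W')"
  shows "orthogonal_increments P (\<lambda>t \<omega>. W t \<omega> $ c) (\<lambda>t \<omega>. W' t \<omega> $ d) 0"
proof -
  interpret prob_space P using sb by (simp add: stochastic_basis_def)
  let ?N = "sigma (space P) {W t -` A \<inter> space P | t A. 0 \<le> t \<and> A \<in> sets borel}"
  let ?N' = "sigma (space P) {W' t -` A \<inter> space P | t A. 0 \<le> t \<and> A \<in> sets borel}"
  let ?D = "\<lambda>s t \<omega>. (W t \<omega> - W s \<omega>) $ c" and ?E = "\<lambda>s t \<omega>. (W' t \<omega> - W' s \<omega>) $ d"
  note mom = wiener_increment_moments[OF sb W, where i = c] and mom' = wiener_increment_moments[OF sb W', where i = d]
  have Dm: "?D s t \<in> borel_measurable P" "?D s t \<in> borel_measurable ?N" if "0 \<le> s" "s < t" for s t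
  proof -
    have [measurable]: "W s \<in> borel_measurable P" "W t \<in> borel_measurable P"
        "W s \<in> borel_measurable ?N" "W t \<in> borel_measurable ?N"
      using that by (auto intro: wiener_measurable(1)[OF sb W] wiener_measurable_natural[OF sb W])
    show "?D s t \<in> borel_measurable P" "?D s t \<in> borel_measurable ?N" by measurable
  qed
  have Em: "?E s t \<in> borel_measurable P" "?E s t \<in> borel_measurable ?N'" if "0 \<le> s" "s < t" for s t
  proof -
    have [measurable]: "W' s \<in> borel_measurable P" "W' t \<in> borel_measurable P"
        "W' s \<in> borel_measurable ?N'" "W' t \<in> borel_measurable ?N'"
      using that by (auto intro: wiener_measurable(1)[OF sb W'] wiener_measurable_natural[OF sb W'])
    show "?E s t \<in> borel_measurable P" "?E s t \<in> borel_measurable ?N'" by measurable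
  qed
  have indep: "indep_var borel f borel g"
    if "f \<in> borel_measurable P" "f \<in> borel_measurable ?N" "g \<in> borel_measurable P" "g \<in> borel_measurable ?N'"
    for f g :: "'w \<Rightarrow> real"
    using that by (intro indep_var_of_indep_set[OF ind] wiener_process_events[OF sb W] wiener_process_events[OF sb W'])
  have Y2: "integrable P (\<lambda>\<omega>. (?D s t \<omega> * ?E s t \<omega>)\<^sup>2) \<and> (\<integral>\<omega>. (?D s t \<omega> * ?E s t \<omega>)\<^sup>2 \<partial>P) \<le> 2 * (t - s)\<^sup>2"
    if st: "0 \<le> s" "s < t" for s t
  proof -
    have i: "indep_var borel (\<lambda>\<omega>. (?D s t \<omega>)\<^sup>2) borel (\<lambda>\<omega>. (?E s t \<omega>)\<^sup>2)"
      by (intro indep borel_measurable_power Dm[OF st] Em[OF st])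
    show ?thesis unfolding power_mult_distrib
      using indep_var_lebesgue_integral[OF i] indep_var_integrable[OF i] mom[OF st] mom'[OF st] st
      by (simp add: power2_eq_square[of "t - s"])
  qed
  have Yo: "(\<integral>\<omega>. (?D s t \<omega> * ?E s t \<omega>) * (?D u v \<omega> * ?E u v \<omega>) \<partial>P) = 0"
    if st: "0 \<le> s" "s < t" and tu: "t \<le> u" and uv': "u < v" for s t u v
  proof -
    have uv: "0 \<le> u" "u < v" using st tu uv' by auto
    \<comment> \<open>Regrouping by process rather than by time interval.\<close>
    have i: "indep_var borel (\<lambda>\<omega>. ?D s t \<omega> * ?D u v \<omega>) borel (\<lambda>\<omega>. ?E s t \<omega> * ?E u v \<omega>)"
      by (intro indep borel_measurable_times Dm[OF st] Em[OF st] Dm[OF uv] Em[OF uv])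
    have int: "integrable P (\<lambda>\<omega>. ?D s t \<omega> * ?D u v \<omega>)" "integrable P (\<lambda>\<omega>. ?E s t \<omega> * ?E u v \<omega>)"
      by (intro integrable_mult_of_squares Dm[OF st] Em[OF st] Dm[OF uv] Em[OF uv] mom(1)[OF st] mom(1)[OF uv] mom'(1)[OF st] mom'(1)[OF uv])+
    have [measurable]: "W s \<in> borel_measurable (F u)" "W t \<in> borel_measurable (F u)"
      using wiener_measurable(2)[OF sb W] st tu by auto
    have "?D s t \<in> borel_measurable (F u)" by measurable
    then have "indep_var borel (?D s t) borel (\<lambda>\<omega>. (\<lambda>x. x $ c) (W v \<omega> - W u \<omega>))"
      using uv by (intro wiener_future_indep[OF sb W]) auto
    then have "(\<integral>\<omega>. ?D s t \<omega> * ?D u v \<omega> \<partial>P) = 0"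
      using indep_var_lebesgue_integral[of "?D s t" "?D u v"] mom(1)[OF st, of 1] mom(1)[OF uv, of 1] mom(2)[OF st] by simp
    then have "(\<integral>\<omega>. (?D s t \<omega> * ?D u v \<omega>) * (?E s t \<omega> * ?E u v \<omega>) \<partial>P) = 0"
      using indep_var_lebesgue_integral[OF i int] by simp
    then show ?thesis by (simp add: mult_ac)
  qed
  have "(\<lambda>\<omega>. ?D s t \<omega> * ?E s t \<omega>) \<in> borel_measurable P" if "0 \<le> s" "s < t" for s t
    using Dm(1)[OF that] Em(1)[OF that] by (rule borel_measurable_times)
  with Y2 Yo show ?thesis unfolding orthogonal_increments_def by simp
qed

text \<open>The error is \<open>1 / T\<close> times a sum of \<open>n\<close> orthogonal terms with
  second moment at most \<open>2 h^2\<close>, where \<open>h = T / n\<close>; altogether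
  \<open>n * 2 h^2 / T^2 = 2 / n\<close>.\<close>

lemma orthogonal_increments_L2:
  assumes P: "prob_space P" and o: "orthogonal_increments P A B c" and T: "0 < T" and n: "1 \<le> n"
  defines "V \<equiv> \<lambda>\<omega>. (1 / T) * (\<Sum>i=1..n. (A (real i * (T / real n)) \<omega> - A (real (i - 1) * (T / real n)) \<omega>) *
       (B (real i * (T / real n)) \<omega> - B (real (i - 1) * (T / real n)) \<omega>))"
  shows "integrable P (\<lambda>\<omega>. (V \<omega> - c)\<^sup>2)" and "(\<integral>\<omega>. (V \<omega> - c)\<^sup>2 \<partial>P) \<le> 2 / real n"
proof -
  interpret prob_space P by fact
  define h where "h = T / real n"
  have h: "h > 0" using T n by (simp add: h_def)
  define Y where "Y = (\<lambda>i \<omega>. (A (real i * h) \<omega> - A (real (i - 1) * h) \<omega>) * (B (real i * h) \<omega> - B (real (i - 1) * h) \<omega>) - c * h)"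
  let ?I = "{1..n}"
  have len: "real i * h - real (i - 1) * h = h" if "i \<in> ?I" for i
    using that by (auto simp: of_nat_diff algebra_simps)
  have lt: "real (i - 1) * h < real i * h" if "i \<in> ?I" for i using len[OF that] h by linarith
  have pos: "0 \<le> real (i - 1) * h" for i using h by simp
  have Y1: "Y i \<in> borel_measurable P" "integrable P (\<lambda>\<omega>. (Y i \<omega>)\<^sup>2)" "(\<integral>\<omega>. (Y i \<omega>)\<^sup>2 \<partial>P) \<le> 2 * h\<^sup>2"
    if "i \<in> ?I" for i
    using o[unfolded orthogonal_increments_def, THEN spec, THEN spec, THEN mp[OF _ pos], THEN mp[OF _ lt[OF that]]]
    unfolding len[OF that] Y_def by simp_all
  have Ylt: "(\<integral>\<omega>. Y i \<omega> * Y j \<omega> \<partial>P) = 0" if "i \<in> ?I" "j \<in> ?I" "i < j" for i j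
  proof -
    \<comment> \<open>Interval \<open>i\<close> ends at \<open>i h\<close> and interval
      \<open>j\<close> starts at \<open>(j - 1) h\<close>; for \<open>i < j\<close> they share at
      most an endpoint.\<close>
    have "real i \<le> real (j - 1)" using that by simp
    then have "real i * h \<le> real (j - 1) * h" using h by simp
    note le = this
    note oi = o[unfolded orthogonal_increments_def, THEN spec, THEN spec, THEN mp[OF _ pos], THEN mp[OF _ lt[OF that(1)]]]
    note oij = oi[THEN conjunct2, THEN conjunct2, THEN conjunct2, THEN spec, THEN spec, THEN mp[OF _ le], THEN mp[OF _ lt[OF that(2)]]]
    show ?thesis using oij unfolding len[OF that(1)] len[OF that(2)] Y_def .
  qed
  have Yij: "(\<integral>\<omega>. Y i \<omega> * Y j \<omega> \<partial>P) = (if i = j then (\<integral>\<omega>. (Y i \<omega>)\<^sup>2 \<partial>P) else 0)" if "i \<in> ?I" "j \<in> ?I" for i j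
    using Ylt[of i j] Ylt[of j i] that by (cases i j rule: linorder_cases) (auto simp: mult.commute power2_eq_square)
  have int: "integrable P (\<lambda>\<omega>. Y i \<omega> * Y j \<omega>)" if "i \<in> ?I" "j \<in> ?I" for i j
    using that Y1 by (intro integrable_mult_of_squares)
  have Vc: "(V \<omega> - c)\<^sup>2 = (1 / T)\<^sup>2 * (\<Sum>i\<in>?I. \<Sum>j\<in>?I. Y i \<omega> * Y j \<omega>)" for \<omega>
  proof -
    have "(\<Sum>i\<in>?I. Y i \<omega>) = T * V \<omega> - T * c"
      unfolding Y_def V_def h_def[symmetric] using T n by (simp add: sum_subtractf) (simp add: h_def)
    then have "V \<omega> - c = (1 / T) * (\<Sum>i\<in>?I. Y i \<omega>)" using T by (simp add: field_simps)
    then show ?thesis by (simp add: power_mult_distrib power_divide power2_eq_square[of "sum _ _"] sum_product)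
  qed
  show "integrable P (\<lambda>\<omega>. (V \<omega> - c)\<^sup>2)"
    unfolding Vc by (intro Bochner_Integration.integrable_mult_right Bochner_Integration.integrable_sum int)
  have "(\<integral>\<omega>. (V \<omega> - c)\<^sup>2 \<partial>P) = (1 / T)\<^sup>2 * (\<Sum>i\<in>?I. \<Sum>j\<in>?I. (\<integral>\<omega>. Y i \<omega> * Y j \<omega> \<partial>P))"
  proof -
    have "(\<integral>\<omega>. (\<Sum>i\<in>?I. \<Sum>j\<in>?I. Y i \<omega> * Y j \<omega>) \<partial>P) = (\<Sum>i\<in>?I. (\<integral>\<omega>. (\<Sum>j\<in>?I. Y i \<omega> * Y j \<omega>) \<partial>P))"
      by (intro Bochner_Integration.integral_sum Bochner_Integration.integrable_sum int)
    also have "\<dots> = (\<Sum>i\<in>?I. \<Sum>j\<in>?I. (\<integral>\<omega>. Y i \<omega> * Y j \<omega> \<partial>P))"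
      by (intro sum.cong refl Bochner_Integration.integral_sum int)
    finally show ?thesis unfolding Vc by simp
  qed
  also have "(\<Sum>i\<in>?I. \<Sum>j\<in>?I. (\<integral>\<omega>. Y i \<omega> * Y j \<omega> \<partial>P)) = (\<Sum>i\<in>?I. (\<integral>\<omega>. (Y i \<omega>)\<^sup>2 \<partial>P))"
  proof (rule sum.cong[OF refl])
    fix i assume i: "i \<in> ?I"
    have "(\<Sum>j\<in>?I. (\<integral>\<omega>. Y i \<omega> * Y j \<omega> \<partial>P)) = (\<Sum>j\<in>?I. if i = j then (\<integral>\<omega>. (Y i \<omega>)\<^sup>2 \<partial>P) else 0)"
      using i by (intro sum.cong Yij) auto
    also have "\<dots> = (\<integral>\<omega>. (Y i \<omega>)\<^sup>2 \<partial>P)" using i by (simp add: sum.delta' del: atLeastAtMost_iff)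
    finally show "(\<Sum>j\<in>?I. (\<integral>\<omega>. Y i \<omega> * Y j \<omega> \<partial>P)) = (\<integral>\<omega>. (Y i \<omega>)\<^sup>2 \<partial>P)" .
  qed
  also have "\<dots> \<le> (\<Sum>i\<in>?I. 2 * h\<^sup>2)" by (intro sum_mono Y1)
  also have "(1 / T)\<^sup>2 * (\<Sum>i\<in>?I. 2 * h\<^sup>2) = 2 / real n"
    using T n by (simp add: h_def power_divide power2_eq_square)
  finally show "(\<integral>\<omega>. (V \<omega> - c)\<^sup>2 \<partial>P) \<le> 2 / real n" using T by (simp add: mult_left_mono)
qed

section \<open>Realized covariance of the observations\<close>


lemma sum_UNIV_Plus:
  fixes f :: "'a::finite + 'b::finite \<Rightarrow> real"
  shows "(\<Sum>i\<in>UNIV. f i) = (\<Sum>a\<in>UNIV. f (Inl a)) + (\<Sum>b\<in>UNIV. f (Inr b))"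
  by (simp add: UNIV_Plus_UNIV[symmetric] sum.Plus del: UNIV_Plus_UNIV)

lemma stack_nth [simp]: "stack x y $ Inl a = x $ a" "stack x y $ Inr b = y $ b"
  by (simp_all add: stack_def)

lemma inner_stack [simp]:
  fixes x x' :: "real ^ 'a::finite" and y y' :: "real ^ 'b::finite"
  shows "inner (stack x y) (stack x' y') = inner x x' + inner y y'"
  by (simp add: inner_vec_def sum_UNIV_Plus)

lemma mult_transpose_nth:
  fixes A :: "real ^ 'k::finite ^ 'm::finite" and B :: "real ^ 'k ^ 'n::finite"
  shows "(A ** transpose B) $ i $ j = inner (A $ i) (B $ j)"
  by (simp add: matrix_matrix_mult_def transpose_def inner_vec_def)

lemma matrix_mult_add_right:
  fixes A B :: "real ^ 'k::finite ^ 'm::finite" and C :: "real ^ 'n::finite ^ 'k"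
  shows "(A + B) ** C = A ** C + B ** C"
  by (simp add: matrix_matrix_mult_def Finite_Cartesian_Product.vec_eq_iff distrib_right sum.distrib)

text \<open>The matrix through which the stacked Wiener processes \<open>(W1, W2, W3, W4)\<close>
  enter the observation \<open>(X1, X2)\<close> once the structural equation is solved for \<eta>.
  One factor serves two purposes: it carries the limit of the realized covariance, and it exhibits
  the model covariance as a Gram matrix.\<close>

definition sem_factor :: "('p1::finite, 'p2::finite, 'k1::finite, 'k2::finite,
    'r1::finite, 'r2::finite, 'r3::finite, 'r4::finite) sem \<Rightarrow> real ^ ('r1 + ('r2 + ('r3 + 'r4))) ^ ('p1 + 'p2)" where
  "sem_factor \<M> = (\<chi> i. case i of
      Inl a \<Rightarrow> stack ((Lam1 \<M> ** S1 \<M>) $ a) (stack (S2 \<M> $ a) (stack 0 0))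
    | Inr b \<Rightarrow> stack ((Lam2 \<M> ** matrix_inv (Psi \<M>) ** Gam \<M> ** S1 \<M>) $ b)
        (stack 0 (stack (S3 \<M> $ b) ((Lam2 \<M> ** matrix_inv (Psi \<M>) ** S4 \<M>) $ b))))"

lemma sem_Sigma_factor: "sem_Sigma \<M> = sem_factor \<M> ** transpose (sem_factor \<M>)"
proof -
  have "sem_Sigma \<M> $ i $ j = inner (sem_factor \<M> $ i) (sem_factor \<M> $ j)" for i j
    by (cases i; cases j)
      (simp_all add: sem_Sigma_def Let_def block_def sem_factor_def mult_transpose_nth[symmetric]
        matrix_transpose_mul matrix_mul_assoc transpose_transpose matrix_add_ldistrib matrix_mult_add_right)
  then show ?thesis by (simp add: Finite_Cartesian_Product.vec_eq_iff mult_transpose_nth)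
qed

lemma transpose_sem_Sigma: "transpose (sem_Sigma \<M>) = sem_Sigma \<M>"
  by (simp add: sem_Sigma_factor matrix_transpose_mul)

lemma pos_def_mult_transpose:
  fixes A :: "real ^ 'k::finite ^ 'm::finite"
  shows "pos_def (A ** transpose A) \<longleftrightarrow> (\<forall>x. x \<noteq> 0 \<longrightarrow> transpose A *v x \<noteq> 0)"
proof -
  have "inner x ((A ** transpose A) *v x) = inner (transpose A *v x) (transpose A *v x)" for x
    by (simp only: matrix_vector_mul_assoc[symmetric] inner_mult_transpose)
  then show ?thesis by (simp add: pos_def_def)
qed

text \<open>The transposed factor is injective: its \<open>W2\<close> block sees only the first part
  of \<open>x\<close>, through \<open>S2\<close>, and its \<open>W3\<close> block only the second
  part, through \<open>S3\<close>. Positive definiteness of the two error covariances makes both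
  parts vanish.\<close>

lemma pos_def_sem_Sigma:
  assumes "sem_regular \<M>"
  shows "pos_def (sem_Sigma \<M>)"
  unfolding sem_Sigma_factor pos_def_mult_transpose
proof (intro allI impI notI)
  fix x assume x: "x \<noteq> 0" and 0: "transpose (sem_factor \<M>) *v x = 0"
  define u where "u = (\<chi> a. x $ Inl a)"
  define v where "v = (\<chi> b. x $ Inr b)"
  have comp: "(transpose (sem_factor \<M>) *v x) $ k =
      (\<Sum>a\<in>UNIV. sem_factor \<M> $ Inl a $ k * u $ a) + (\<Sum>b\<in>UNIV. sem_factor \<M> $ Inr b $ k * v $ b)" for k
    by (simp add: matrix_vector_mult_def transpose_def sum_UNIV_Plus u_def v_def)
  have "(transpose (S2 \<M>) *v u) $ c = 0" for c
    using comp[of "Inr (Inl c)"] unfolding 0 by (simp add: sem_factor_def matrix_vector_mult_def transpose_def)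
  then have "transpose (S2 \<M>) *v u = 0" by (simp add: Finite_Cartesian_Product.vec_eq_iff)
  then have "u = 0" using assms unfolding sem_regular_def pos_def_mult_transpose by blast
  have "(transpose (S3 \<M>) *v v) $ c = 0" for c
    using comp[of "Inr (Inr (Inl c))"] unfolding 0 by (simp add: sem_factor_def matrix_vector_mult_def transpose_def)
  then have "transpose (S3 \<M>) *v v = 0" by (simp add: Finite_Cartesian_Product.vec_eq_iff)
  then have "v = 0" using assms unfolding sem_regular_def pos_def_mult_transpose by blast
  have "x $ i = 0" for i
    using \<open>u = 0\<close> \<open>v = 0\<close> by (cases i) (simp_all add: u_def v_def Finite_Cartesian_Product.vec_eq_iff)
  then show False using x by (simp add: Finite_Cartesian_Product.vec_eq_iff)
qed

lemma det_sem_Sigma_pos: "sem_regular \<M> \<Longrightarrow> 0 < Determinants.det (sem_Sigma \<M>)"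
  by (intro pos_def_det_pos transpose_sem_Sigma pos_def_sem_Sigma)

text \<open>The right-hand side is the value of the limit log-likelihood at the true covariance. By
  the Gibbs inequality it is the maximum over all covariances and is reached only by the true
  one.\<close>

lemma limit_loglik_truth:
  assumes "sem_regular \<M>0" "sem_regular (mdl \<theta>)"
  shows "sem_Sigma (mdl \<theta>) \<noteq> sem_Sigma (\<M>0 :: ('p1::finite, 'p2::finite, 'k1::finite, 'k2::finite,
        'r1::finite, 'r2::finite, 'r3::finite, 'r4::finite) sem) \<Longrightarrow>
      limit_loglik (sem_Sigma \<M>0) (\<lambda>\<theta>. sem_Sigma (mdl \<theta>)) \<theta>
        < - 1 / 2 * real CARD('p1 + 'p2) - 1 / 2 * ln (Determinants.det (sem_Sigma \<M>0))"
    and "sem_Sigma (mdl \<theta>) = sem_Sigma \<M>0 \<Longrightarrow>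
      limit_loglik (sem_Sigma \<M>0) (\<lambda>\<theta>. sem_Sigma (mdl \<theta>)) \<theta>
        = - 1 / 2 * real CARD('p1 + 'p2) - 1 / 2 * ln (Determinants.det (sem_Sigma \<M>0))"
proof -
  note g = gaussian_entropy_inequality[OF transpose_sem_Sigma pos_def_sem_Sigma[OF assms(2)]
      transpose_sem_Sigma pos_def_sem_Sigma[OF assms(1)]]
  show "limit_loglik (sem_Sigma \<M>0) (\<lambda>\<theta>. sem_Sigma (mdl \<theta>)) \<theta>
        < - 1 / 2 * real CARD('p1 + 'p2) - 1 / 2 * ln (Determinants.det (sem_Sigma \<M>0))"
    if "sem_Sigma (mdl \<theta>) \<noteq> sem_Sigma \<M>0"
    using g that unfolding limit_loglik_def by argo
  have "invertible (sem_Sigma \<M>0)"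
    using det_sem_Sigma_pos[OF assms(1)] by (simp add: invertible_det_nz)
  then have "frob (matrix_inv (sem_Sigma \<M>0)) (sem_Sigma \<M>0) = real CARD('p1 + 'p2)"
    by (simp add: frob_def transpose_sem_Sigma matrix_inv_left_invertible trace_I)
  then show "limit_loglik (sem_Sigma \<M>0) (\<lambda>\<theta>. sem_Sigma (mdl \<theta>)) \<theta>
        = - 1 / 2 * real CARD('p1 + 'p2) - 1 / 2 * ln (Determinants.det (sem_Sigma \<M>0))"
    if "sem_Sigma (mdl \<theta>) = sem_Sigma \<M>0"
    using that by (simp add: limit_loglik_def)
qed

text \<open>The models are regular on \<Theta> only, and the determinant may vanish elsewhere in the
  given neighbourhood. Continuity of the determinant makes the subset where it is positive
  relatively open, and this subset still contains \<Theta>.\<close>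

lemma parametric_model_smooth_covariance:
  assumes "parametric_model q \<Theta> mdl"
  shows "compact \<Theta>" and "\<exists>V. smooth_covariance q V (\<lambda>\<theta>. sem_Sigma (mdl \<theta>)) \<and> \<Theta> \<subseteq> V"
proof -
  \<comment> \<open>\<open>R^q\<close> carries the subspace topology of the sequence space, so
    compactness in it is ordinary compactness.\<close>
  have E: "Euclidean_space q = top_of_set {x. \<forall>i\<ge>q. x i = 0}"
    by (simp add: Euclidean_space_def euclidean_product_topology)
  show "compact \<Theta>"
    using assms unfolding parametric_model_def E compactin_subtopology by simp
  obtain U where U: "openin (Euclidean_space q) U" "\<Theta> \<subseteq> U"
      and C2: "\<And>i j. C2_on q U (\<lambda>\<theta>. sem_Sigma (mdl \<theta>) $ i $ j)"
    using assms unfolding parametric_model_def by blast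
  define V where "V = U \<inter> (\<lambda>\<theta>. Determinants.det (sem_Sigma (mdl \<theta>))) -` {0<..}"
  have "continuous_on U (\<lambda>\<theta>. Determinants.det (sem_Sigma (mdl \<theta>)))"
    by (rule C1_on_continuous(1)[OF C2_on_C1[OF C2_on_det[OF U(1) C2]]])
  then have "openin (top_of_set U) V"
    unfolding V_def by (intro continuous_openin_preimage_gen) auto
  then have "openin (Euclidean_space q) V" using U(1) unfolding E by (rule openin_trans)
  moreover have "C2_on q V (\<lambda>\<theta>. sem_Sigma (mdl \<theta>) $ i $ j)" for i j
    by (rule C2_on_subset[OF C2]) (auto simp: V_def)
  ultimately have "smooth_covariance q V (\<lambda>\<theta>. sem_Sigma (mdl \<theta>))"
    by unfold_locales (auto simp: V_def)
  moreover have "\<Theta> \<subseteq> V"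
    using U(2) assms det_sem_Sigma_pos unfolding V_def parametric_model_def by blast
  ultimately show "\<exists>V. smooth_covariance q V (\<lambda>\<theta>. sem_Sigma (mdl \<theta>)) \<and> \<Theta> \<subseteq> V" by blast
qed

section \<open>Realized covariance under linear maps and Lipschitz perturbations\<close>

lemma rel_cov_nth: "rel_cov T n x $ a $ b = (1 / T) * (\<Sum>i=1..n. incr T n x i $ a * incr T n x i $ b)"
  by (simp add: rel_cov_def outer_def)

lemma rel_cov_mult:
  fixes F :: "real ^ 'r::finite ^ 'p::finite"
  shows "rel_cov T n (\<lambda>t. F *v w t) $ a $ b =
    (\<Sum>c\<in>UNIV. \<Sum>d\<in>UNIV. F $ a $ c * F $ b $ d * rel_cov T n w $ c $ d)"
proof -
  have "incr T n (\<lambda>t. F *v w t) i = F *v incr T n w i" for i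
    by (simp add: incr_def matrix_vector_mult_diff_distrib)
  then have "rel_cov T n (\<lambda>t. F *v w t) $ a $ b =
      (1 / T) * (\<Sum>i=1..n. \<Sum>c\<in>UNIV. \<Sum>d\<in>UNIV. F $ a $ c * F $ b $ d * (incr T n w i $ c * incr T n w i $ d))"
    unfolding rel_cov_nth by (simp add: matrix_vector_mult_def sum_product mult_ac)
  also have "\<dots> = (1 / T) * (\<Sum>c\<in>UNIV. \<Sum>d\<in>UNIV. \<Sum>i=1..n. F $ a $ c * F $ b $ d * (incr T n w i $ c * incr T n w i $ d))"
    by (subst sum.swap, subst (2) sum.swap) simp
  also have "\<dots> = (\<Sum>c\<in>UNIV. \<Sum>d\<in>UNIV. F $ a $ c * F $ b $ d * rel_cov T n w $ c $ d)"
    unfolding rel_cov_nth by (simp add: sum_distrib_left mult_ac)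
  finally show ?thesis .
qed

lemma tendsto_rel_cov_mult:
  fixes F :: "real ^ 'r::finite ^ 'p::finite"
  assumes "((\<lambda>k. rel_cov T (n k) w) \<longlongrightarrow> Finite_Cartesian_Product.mat 1) G"
  shows "((\<lambda>k. rel_cov T (n k) (\<lambda>t. F *v w t)) \<longlongrightarrow> F ** transpose F) G"
proof (intro vec_tendstoI)
  fix a b
  have "((\<lambda>k. rel_cov T (n k) (\<lambda>t. F *v w t) $ a $ b) \<longlongrightarrow>
     (\<Sum>c\<in>UNIV. \<Sum>d\<in>UNIV. F $ a $ c * F $ b $ d * (Finite_Cartesian_Product.mat 1 :: real ^ 'r ^ 'r) $ c $ d)) G"
    unfolding rel_cov_mult by (intro tendsto_intros assms)
  also have "(\<Sum>c\<in>UNIV. \<Sum>d\<in>UNIV. F $ a $ c * F $ b $ d * (Finite_Cartesian_Product.mat 1 :: real ^ 'r ^ 'r) $ c $ d)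
      = (F ** transpose F) $ a $ b"
    by (simp add: mult_transpose_nth inner_vec_def Finite_Cartesian_Product.mat_def if_distrib[of "\<lambda>x. _ * x"] cong: if_cong)
  finally show "((\<lambda>k. rel_cov T (n k) (\<lambda>t. F *v w t) $ a $ b) \<longlongrightarrow> (F ** transpose F) $ a $ b) G" .
qed

text \<open>Increments of the Lipschitz difference are \<open>O(1/n)\<close>, so the l^2 norm of
  \<open>n\<close> of them is \<open>O(n^(-1/2))\<close>. The corresponding norm for
  \<open>y\<close> stays bounded because its realized covariance converges, and Cauchy-Schwarz
  removes the mixed terms.\<close>

lemma tendsto_rel_cov_perturb:
  fixes x y :: "real \<Rightarrow> real ^ 'p::finite"
  assumes T: "0 < T" and n: "\<And>k. 1 \<le> n k" "filterlim n at_top sequentially"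
    and lip: "\<And>a. \<exists>C. C-lipschitz_on {0..T} (\<lambda>t. (x t - y t) $ a)"
    and S: "(\<lambda>k. rel_cov T (n k) y) \<longlonglongrightarrow> S"
  shows "(\<lambda>k. rel_cov T (n k) x) \<longlonglongrightarrow> S"
proof (intro vec_tendstoI)
  fix a b
  obtain C where C: "\<And>a. (C a)-lipschitz_on {0..T} (\<lambda>t. (x t - y t) $ a)" using lip by metis
  have C0: "0 \<le> C a" for a using lipschitz_on_nonneg[OF C] .
  define D where "D = (\<lambda>k i. incr T (n k) x i - incr T (n k) y i)"
  let ?I = "\<lambda>k. {1..n k}" and ?h = "\<lambda>k. T / real (n k)"
  have D: "\<bar>D k i $ a\<bar> \<le> C a * ?h k" if i: "i \<in> ?I k" for k i a
  proof -
    have j: "real j * ?h k \<in> {0..T}" if "j \<le> n k" for j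
      using that T n(1)[of k] by (auto simp: field_simps)
    have "real i * ?h k \<in> {0..T}" "real (i - 1) * ?h k \<in> {0..T}"
      using i j[of i] j[of "i - 1"] by fastforce+
    from lipschitz_onD[OF C this, of a] have "\<bar>D k i $ a\<bar> \<le> C a * \<bar>real i * ?h k - real (i - 1) * ?h k\<bar>"
      by (simp add: D_def incr_def dist_real_def algebra_simps)
    also have "real i * ?h k - real (i - 1) * ?h k = ?h k"
      using i by (simp add: left_diff_distrib[symmetric] of_nat_diff del: times_divide_eq_right)
    finally show ?thesis using T by simp
  qed
  have DL2: "L2_set (\<lambda>i. D k i $ a) (?I k) \<le> C a * T * (1 / sqrt (real (n k)))" for k a
  proof -
    have "L2_set (\<lambda>i. D k i $ a) (?I k) \<le> sqrt (\<Sum>i\<in>?I k. (C a * ?h k)\<^sup>2)"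
      unfolding L2_set_def using D by (intro real_sqrt_le_mono sum_mono) (metis abs_ge_zero power2_abs power_mono)
    also have "\<dots> = sqrt (real (n k)) * (C a * ?h k)"
      using C0[of a] T by (simp add: real_sqrt_mult)
    also have "\<dots> = C a * T * (1 / sqrt (real (n k)))"
      using n(1)[of k] by (simp add: field_simps)
    finally show ?thesis .
  qed
  have yL2: "L2_set (\<lambda>i. incr T (n k) y i $ a) (?I k) = sqrt (T * rel_cov T (n k) y $ a $ a)" for k a
    using T unfolding L2_set_def rel_cov_nth by (simp add: power2_eq_square)
  \<comment> \<open>Cauchy-Schwarz bounds for the three error terms of the product expansion:
    \<open>y D\<close>, \<open>D y\<close> and \<open>D D\<close>.\<close>
  define R where "R = (\<lambda>k. (1 / T) * (sqrt (T * rel_cov T (n k) y $ a $ a) * (C b * T * (1 / sqrt (real (n k))))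
      + C a * T * (1 / sqrt (real (n k))) * sqrt (T * rel_cov T (n k) y $ b $ b)
      + C a * T * (1 / sqrt (real (n k))) * (C b * T * (1 / sqrt (real (n k))))))"
  have CS: "\<bar>\<Sum>i\<in>I. f i * g i\<bar> \<le> L2_set f I * L2_set g I" for f g :: "nat \<Rightarrow> real" and I
    by (rule order_trans[OF sum_abs]) (simp add: abs_mult L2_set_mult_ineq)
  have bound: "norm (rel_cov T (n k) x $ a $ b - rel_cov T (n k) y $ a $ b) \<le> R k" for k
  proof -
    let ?y = "\<lambda>a i. incr T (n k) y i $ a" and ?D = "\<lambda>a i. D k i $ a"
    have "incr T (n k) x i $ a = ?y a i + ?D a i" for i a by (simp add: D_def)
    then have "rel_cov T (n k) x $ a $ b - rel_cov T (n k) y $ a $ b =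
       (1 / T) * ((\<Sum>i\<in>?I k. ?y a i * ?D b i) + (\<Sum>i\<in>?I k. ?D a i * ?y b i) + (\<Sum>i\<in>?I k. ?D a i * ?D b i))"
      unfolding rel_cov_nth right_diff_distrib[symmetric] by (simp add: sum.distrib algebra_simps)
    then have "norm (rel_cov T (n k) x $ a $ b - rel_cov T (n k) y $ a $ b) =
       (1 / T) * \<bar>(\<Sum>i\<in>?I k. ?y a i * ?D b i) + (\<Sum>i\<in>?I k. ?D a i * ?y b i) + (\<Sum>i\<in>?I k. ?D a i * ?D b i)\<bar>"
      using T by (simp add: abs_mult)
    also have "\<dots> \<le> (1 / T) * (L2_set (?y a) (?I k) * L2_set (?D b) (?I k) + L2_set (?D a) (?I k) * L2_set (?y b) (?I k)
        + L2_set (?D a) (?I k) * L2_set (?D b) (?I k))"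
      using T CS[of "?y a" "?D b" "?I k"] CS[of "?D a" "?y b" "?I k"] CS[of "?D a" "?D b" "?I k"]
      by (intro mult_left_mono) auto
    also have "\<dots> \<le> R k"
      unfolding R_def yL2 using T C0[of a]
      by (intro mult_left_mono add_mono mult_mono DL2 order_refl mult_nonneg_nonneg L2_set_nonneg)
        (auto simp: L2_set_nonneg yL2[symmetric])
    finally show ?thesis .
  qed
  have "filterlim (\<lambda>k. sqrt (real (n k))) at_top sequentially"
    by (intro filterlim_compose[OF sqrt_at_top] filterlim_compose[OF filterlim_real_sequentially] n(2))
  then have z: "(\<lambda>k. 1 / sqrt (real (n k))) \<longlonglongrightarrow> 0"
    by (intro tendsto_divide_0[OF tendsto_const]) (rule filterlim_at_top_imp_at_infinity)
  have "R \<longlonglongrightarrow> (1 / T) * (sqrt (T * S $ a $ a) * (C b * T * 0) + C a * T * 0 * sqrt (T * S $ b $ b) + C a * T * 0 * (C b * T * 0))"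
    unfolding R_def by (intro tendsto_intros S z)
  then have "R \<longlonglongrightarrow> 0" by simp
  from Lim_null_comparison[OF always_eventually[OF allI[OF bound]] this]
  have "(\<lambda>k. rel_cov T (n k) x $ a $ b - rel_cov T (n k) y $ a $ b) \<longlonglongrightarrow> 0" .
  moreover have "(\<lambda>k. rel_cov T (n k) y $ a $ b) \<longlonglongrightarrow> S $ a $ b" by (intro tendsto_intros S)
  ultimately have "(\<lambda>k. (rel_cov T (n k) x $ a $ b - rel_cov T (n k) y $ a $ b) + rel_cov T (n k) y $ a $ b) \<longlonglongrightarrow> 0 + S $ a $ b"
    by (rule tendsto_add)
  then show "(\<lambda>k. rel_cov T (n k) x $ a $ b) \<longlonglongrightarrow> S $ a $ b" by simp
qed

section \<open>Pathwise decomposition of the observations\<close>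

text \<open>Apart from \<open>S w\<close>, the path is a constant plus the integral of a continuous
  function, which is bounded on the compact interval.\<close>

lemma sde_lipschitz_part:
  fixes z :: "real \<Rightarrow> real ^ 'd::finite"
  assumes B: "\<exists>L. L-lipschitz_on UNIV B" and z: "continuous_on {0..} z"
    and eq: "\<And>t. 0 \<le> t \<Longrightarrow> z t = c + integral {0..t} (\<lambda>s. B (z s)) + S *v w t"
  shows "\<exists>C. C-lipschitz_on {0..T} (\<lambda>t. z t - S *v w t)"
proof -
  have "continuous_on UNIV B" using B lipschitz_on_continuous_on by blast
  then have cB: "continuous_on A (\<lambda>s. B (z s))" if "A \<subseteq> {0..}" for A
    by (rule continuous_on_compose2[OF _ continuous_on_subset[OF z that]]) auto
  then have "compact ((\<lambda>s. B (z s)) ` {0..T})" by (intro compact_continuous_image) auto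
  then obtain C where C: "\<And>s. s \<in> {0..T} \<Longrightarrow> norm (B (z s)) \<le> C"
    using compact_imp_bounded bounded_iff by (metis imageI)
  \<comment> \<open>The absolute value makes the constant nonnegative; if \<open>{0..T}\<close> is
    empty, \<open>C\<close> may be anything.\<close>
  have main: "norm ((z t - S *v w t) - (z s - S *v w s)) \<le> \<bar>C\<bar> * (t - s)" if "0 \<le> s" "s \<le> t" "t \<le> T" for s t
  proof -
    have "integral {0..s} (\<lambda>s. B (z s)) + integral {s..t} (\<lambda>s. B (z s)) = integral {0..t} (\<lambda>s. B (z s))"
      using that by (intro Henstock_Kurzweil_Integration.integral_combine integrable_continuous_real cB) auto
    then have "(z t - S *v w t) - (z s - S *v w s) = integral {s..t} (\<lambda>s. B (z s))"
      using that eq[of s] eq[of t] by (simp add: algebra_simps)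
    moreover have "norm (integral {s..t} (\<lambda>s. B (z s))) \<le> \<bar>C\<bar> * (t - s)"
      using that C by (intro integral_bound cB) (force intro: order_trans[OF _ abs_ge_self])+
    ultimately show ?thesis by simp
  qed
  have "\<bar>C\<bar>-lipschitz_on {0..T} (\<lambda>t. z t - S *v w t)"
  proof (rule lipschitz_onI)
    fix s t assume "s \<in> {0..T}" "t \<in> {0..T}"
    then show "dist (z s - S *v w s) (z t - S *v w t) \<le> \<bar>C\<bar> * dist s t"
      using main[of s t] main[of t s] by (cases "s \<le> t") (auto simp: dist_norm norm_minus_commute)
  qed simp
  then show ?thesis by blast
qed

lemma lipschitz_ex_add:
  fixes f g :: "real \<Rightarrow> 'a::real_normed_vector"
  assumes "\<exists>C. C-lipschitz_on U f" "\<exists>C. C-lipschitz_on U g"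
  shows "\<exists>C. C-lipschitz_on U (\<lambda>t. f t + g t)"
  using assms lipschitz_on_add by blast

lemma lipschitz_ex_linear:
  fixes f :: "real \<Rightarrow> 'a::real_normed_vector"
  assumes "\<exists>C. C-lipschitz_on U f" "bounded_linear h"
  shows "\<exists>C. C-lipschitz_on U (\<lambda>t. h (f t))"
proof -
  obtain K where "K-lipschitz_on (f ` U) h" using bounded_linear.lipschitz_boundE[OF assms(2)] by blast
  then show ?thesis using assms(1) lipschitz_on_compose2 by blast
qed

lemma bounded_linear_matrix_vector_mult:
  fixes A :: "real ^ 'm::finite ^ 'n::finite"
  shows "bounded_linear ((*v) A)"
  by (simp add: linear_conv_bounded_linear[symmetric])

lemma sem_observation_eq:
  assumes "invertible (Psi \<M>)" "\<eta> = Bmat \<M> *v \<eta> + Gam \<M> *v \<xi> + \<zeta>"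
  shows "\<eta> = matrix_inv (Psi \<M>) *v (Gam \<M> *v \<xi> + \<zeta>)"
proof -
  have "Psi \<M> *v \<eta> = Gam \<M> *v \<xi> + \<zeta>"
    using assms(2) by (simp add: Psi_def matrix_vector_mult_diff_rdistrib algebra_simps)
  then have "matrix_inv (Psi \<M>) *v (Psi \<M> *v \<eta>) = matrix_inv (Psi \<M>) *v (Gam \<M> *v \<xi> + \<zeta>)" by simp
  then show ?thesis using assms(1) by (simp add: matrix_vector_mul_assoc matrix_inv_left_invertible)
qed

lemma sem_factor_mult:
  "sem_factor \<M> *v stack w1 (stack w2 (stack w3 w4)) =
    stack (Lam1 \<M> *v (S1 \<M> *v w1) + S2 \<M> *v w2)
      (Lam2 \<M> *v (matrix_inv (Psi \<M>) *v (Gam \<M> *v (S1 \<M> *v w1) + S4 \<M> *v w4)) + S3 \<M> *v w3)"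
proof -
  have "(sem_factor \<M> *v stack w1 (stack w2 (stack w3 w4))) $ i =
    stack (Lam1 \<M> *v (S1 \<M> *v w1) + S2 \<M> *v w2)
      (Lam2 \<M> *v (matrix_inv (Psi \<M>) *v (Gam \<M> *v (S1 \<M> *v w1) + S4 \<M> *v w4)) + S3 \<M> *v w3) $ i" for i
    by (cases i) (simp_all add: sem_factor_def matrix_vector_mul_component matrix_vector_mul_assoc matrix_vector_right_distrib matrix_mul_assoc)
  then show ?thesis by (simp add: Finite_Cartesian_Product.vec_eq_iff)
qed

text \<open>Observation and \<open>sem_factor\<close> are built from the latent processes and their
  Wiener parts by the same linear maps, so their difference is linear in the four Lipschitz
  remainders.\<close>

lemma sem_path_lipschitz:
  fixes T :: real
  assumes inv: "invertible (Psi \<M>)"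
    and x: "\<And>t. 0 \<le> t \<Longrightarrow> e t = Bmat \<M> *v e t + Gam \<M> *v z1 t + z4 t \<and>
        x t = stack (Lam1 \<M> *v z1 t + z2 t) (Lam2 \<M> *v e t + z3 t)"
    and l1: "\<exists>C. C-lipschitz_on {0..T} (\<lambda>t. z1 t - S1 \<M> *v w1 t)"
    and l2: "\<exists>C. C-lipschitz_on {0..T} (\<lambda>t. z2 t - S2 \<M> *v w2 t)"
    and l3: "\<exists>C. C-lipschitz_on {0..T} (\<lambda>t. z3 t - S3 \<M> *v w3 t)"
    and l4: "\<exists>C. C-lipschitz_on {0..T} (\<lambda>t. z4 t - S4 \<M> *v w4 t)"
  shows "\<exists>C. C-lipschitz_on {0..T} (\<lambda>t. (x t - sem_factor \<M> *v stack (w1 t) (stack (w2 t) (stack (w3 t) (w4 t)))) $ i)"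
proof -
  note mult = lipschitz_ex_linear[OF _ bounded_linear_matrix_vector_mult]
  let ?d1 = "\<lambda>t. z1 t - S1 \<M> *v w1 t" and ?d2 = "\<lambda>t. z2 t - S2 \<M> *v w2 t"
  let ?d3 = "\<lambda>t. z3 t - S3 \<M> *v w3 t" and ?d4 = "\<lambda>t. z4 t - S4 \<M> *v w4 t"
  let ?g1 = "\<lambda>t. Lam1 \<M> *v ?d1 t + ?d2 t"
  let ?g2 = "\<lambda>t. Lam2 \<M> *v (matrix_inv (Psi \<M>) *v (Gam \<M> *v ?d1 t + ?d4 t)) + ?d3 t"
  have g1: "\<exists>C. C-lipschitz_on {0..T} (\<lambda>t. ?g1 t $ a)" for a
  proof -
    have x: "\<exists>C. C-lipschitz_on {0..T} ?g1"
      by (intro lipschitz_ex_add mult l1 l2)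
    show ?thesis using lipschitz_ex_linear[OF x bounded_linear_vec_nth, of a] .
  qed
  have g2: "\<exists>C. C-lipschitz_on {0..T} (\<lambda>t. ?g2 t $ b)" for b
    by (rule lipschitz_ex_linear[of _ _ "\<lambda>v. v $ b", OF _ bounded_linear_vec_nth], intro lipschitz_ex_add mult l1 l3 l4)
  have eq: "(x t - sem_factor \<M> *v stack (w1 t) (stack (w2 t) (stack (w3 t) (w4 t)))) $ i =
      (case i of Inl a \<Rightarrow> ?g1 t $ a | Inr b \<Rightarrow> ?g2 t $ b)" if "t \<in> {0..T}" for t
  proof -
    have "x t = stack (Lam1 \<M> *v z1 t + z2 t) (Lam2 \<M> *v (matrix_inv (Psi \<M>) *v (Gam \<M> *v z1 t + z4 t)) + z3 t)"
      using x[of t] that sem_observation_eq[OF inv, of "e t" "z1 t" "z4 t"] by simp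
    then show ?thesis unfolding sem_factor_mult
      by (cases i) (simp_all add: matrix_vector_mult_diff_distrib matrix_vector_right_distrib algebra_simps)
  qed
  have "\<exists>C. C-lipschitz_on {0..T} (\<lambda>t. case i of Inl a \<Rightarrow> ?g1 t $ a | Inr b \<Rightarrow> ?g2 t $ b)"
    using g1 g2 by (cases i) auto
  then obtain C where "C-lipschitz_on {0..T} (\<lambda>t. case i of Inl a \<Rightarrow> ?g1 t $ a | Inr b \<Rightarrow> ?g2 t $ b)" ..
  then have "C-lipschitz_on {0..T} (\<lambda>t. (x t - sem_factor \<M> *v stack (w1 t) (stack (w2 t) (stack (w3 t) (w4 t)))) $ i)"
    by (rule lipschitz_on_transform) (rule eq)
  then show ?thesis ..
qed

section \<open>Selection of the optimal model\<close>


text \<open>Bridges the two modes of convergence: L^2 bounds give almost sure limits only along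
  subsequences, while the claim is about the whole sequence of probabilities.\<close>

lemma tendsto_subseqI:
  assumes "\<And>r :: nat \<Rightarrow> nat. strict_mono r \<Longrightarrow> \<exists>s :: nat \<Rightarrow> nat. strict_mono s \<and> (\<lambda>k. a (r (s k))) \<longlonglongrightarrow> l"
  shows "a \<longlonglongrightarrow> l"
proof (rule topological_tendstoI, rule ccontr)
  fix S assume S: "open S" "l \<in> S" and ev: "\<not> (\<forall>\<^sub>F n in sequentially. a n \<in> S)"
  obtain r :: "nat \<Rightarrow> nat" where r: "strict_mono r" "\<And>n. a (r n) \<notin> S"
    using not_eventually_sequentiallyD[OF ev] by blast
  obtain s :: "nat \<Rightarrow> nat" where "(\<lambda>k. a (r (s k))) \<longlonglongrightarrow> l" using assms[OF r(1)] by blast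
  from topological_tendstoD[OF this S] have "\<forall>\<^sub>F k in sequentially. False" using r(2) by simp
  then show False by simp
qed

text \<open>Dominated convergence for the indicators of the events.\<close>

lemma (in prob_space) prob_tendsto_1:
  assumes "\<And>k. E k \<in> events" "AE \<omega> in M. \<forall>\<^sub>F k in sequentially. \<omega> \<in> E k"
  shows "(\<lambda>k. prob (E k)) \<longlonglongrightarrow> 1"
proof -
  have "(\<lambda>k. \<integral>\<omega>. indicator (E k) \<omega> \<partial>M) \<longlonglongrightarrow> (\<integral>\<omega>. (1::real) \<partial>M)"
  proof (rule integral_dominated_convergence[where w = "\<lambda>_. 1"])
    show "AE \<omega> in M. (\<lambda>k. indicator (E k) \<omega> :: real) \<longlonglongrightarrow> 1"
      using assms(2)
    proof eventually_elim
      case (elim \<omega>)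
      then show ?case by (intro tendsto_eventually) (auto elim: eventually_mono)
    qed
  qed (use assms(1) in \<open>auto simp: indicator_def\<close>)
  then show ?thesis using assms(1) by (simp add: prob_space)
qed

lemma borel_measurable_vecI:
  fixes f :: "'a \<Rightarrow> real ^ 'n::finite"
  assumes "\<And>i. (\<lambda>x. f x $ i) \<in> borel_measurable M"
  shows "f \<in> borel_measurable M"
  using assms by (subst borel_measurable_euclidean_space) (auto simp: Basis_vec_def inner_axis)

lemma borel_measurable_matrix_vector_mult [measurable (raw)]:
  fixes A :: "real ^ 'm::finite ^ 'n::finite"
  assumes [measurable]: "f \<in> borel_measurable M"
  shows "(\<lambda>x. A *v f x) \<in> borel_measurable M"
  by (rule borel_measurable_vecI) (simp add: matrix_vector_mult_def)

lemma borel_measurable_stack [measurable (raw)]: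
  fixes f :: "'a \<Rightarrow> real ^ 'm::finite" and g :: "'a \<Rightarrow> real ^ 'n::finite"
  assumes [measurable]: "f \<in> borel_measurable M" "g \<in> borel_measurable M"
  shows "(\<lambda>x. stack (f x) (g x)) \<in> borel_measurable M"
proof (rule borel_measurable_vecI)
  show "(\<lambda>x. stack (f x) (g x) $ i) \<in> borel_measurable M" for i
    by (cases i) simp_all
qed

text \<open>The facts about one model needed for the comparison, with the auxiliary neighbourhood
  \<open>V\<close> eliminated.\<close>

lemma model_QBIC:
  fixes mdl :: "(nat \<Rightarrow> real) \<Rightarrow> ('p1::finite, 'p2::finite, 'k1::finite, 'k2::finite,
        'r1::finite, 'r2::finite, 'r3::finite, 'r4::finite) sem"
  assumes mdl: "parametric_model q \<Theta> mdl" and T: "0 < T"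
    and X: "\<And>t. 0 \<le> t \<Longrightarrow> X t \<in> borel_measurable P"
    and est: "QMLE P T X \<Theta> (\<lambda>\<theta>. sem_Sigma (mdl \<theta>)) est"
  shows "1 \<le> n \<Longrightarrow> (\<lambda>\<omega>. QBIC1 q T n (\<lambda>t. X t \<omega>) (\<lambda>\<theta>. sem_Sigma (mdl \<theta>)) (est n \<omega>)) \<in> borel_measurable P"
    and "1 \<le> n \<Longrightarrow> (\<lambda>\<omega>. QBIC2 q T n (\<lambda>t. X t \<omega>) (\<lambda>\<theta>. sem_Sigma (mdl \<theta>)) (est n \<omega>)) \<in> borel_measurable P"
    and "\<lbrakk>optimal_parameter S0 \<Theta> (\<lambda>\<theta>. sem_Sigma (mdl \<theta>)) tb; condition_C2 q S0 \<Theta> (\<lambda>\<theta>. sem_Sigma (mdl \<theta>)) tb;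
        \<And>k. 1 \<le> N k; filterlim N at_top sequentially; \<omega> \<in> space P; (\<lambda>k. rel_cov T (N k) (\<lambda>t. X t \<omega>)) \<longlonglongrightarrow> S0\<rbrakk> \<Longrightarrow>
      (\<lambda>k. QBIC1 q T (N k) (\<lambda>t. X t \<omega>) (\<lambda>\<theta>. sem_Sigma (mdl \<theta>)) (est (N k) \<omega>) / real (N k))
        \<longlonglongrightarrow> - 2 * limit_loglik S0 (\<lambda>\<theta>. sem_Sigma (mdl \<theta>)) tb"
    and "\<lbrakk>optimal_parameter S0 \<Theta> (\<lambda>\<theta>. sem_Sigma (mdl \<theta>)) tb; condition_C2 q S0 \<Theta> (\<lambda>\<theta>. sem_Sigma (mdl \<theta>)) tb;
        \<And>k. 1 \<le> N k; filterlim N at_top sequentially; \<omega> \<in> space P; (\<lambda>k. rel_cov T (N k) (\<lambda>t. X t \<omega>)) \<longlonglongrightarrow> S0\<rbrakk> \<Longrightarrow>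
      (\<lambda>k. QBIC2 q T (N k) (\<lambda>t. X t \<omega>) (\<lambda>\<theta>. sem_Sigma (mdl \<theta>)) (est (N k) \<omega>) / real (N k))
        \<longlonglongrightarrow> - 2 * limit_loglik S0 (\<lambda>\<theta>. sem_Sigma (mdl \<theta>)) tb"
proof -
  obtain V where V: "smooth_covariance q V (\<lambda>\<theta>. sem_Sigma (mdl \<theta>))" "\<Theta> \<subseteq> V"
    using parametric_model_smooth_covariance(2)[OF mdl] by blast
  have c: "compact \<Theta>" by (rule parametric_model_smooth_covariance(1)[OF mdl])
  have est1: "est n \<in> borel_measurable P" "\<omega> \<in> space P \<Longrightarrow> est n \<omega> \<in> \<Theta>"
    "\<omega> \<in> space P \<Longrightarrow> quasi_lik T n (\<lambda>t. X t \<omega>) (\<lambda>\<theta>. sem_Sigma (mdl \<theta>)) (est n \<omega>) =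
        (SUP \<theta>\<in>\<Theta>. quasi_lik T n (\<lambda>t. X t \<omega>) (\<lambda>\<theta>. sem_Sigma (mdl \<theta>)) \<theta>)"
    if "1 \<le> n" for n \<omega>
    using est that unfolding QMLE_def by auto
  show "(\<lambda>\<omega>. QBIC1 q T n (\<lambda>t. X t \<omega>) (\<lambda>\<theta>. sem_Sigma (mdl \<theta>)) (est n \<omega>)) \<in> borel_measurable P" if "1 \<le> n"
    by (rule smooth_covariance.measurable_QBIC(1)[OF V(1) X T that est1(1,2)[OF that] V(2)])
  show "(\<lambda>\<omega>. QBIC2 q T n (\<lambda>t. X t \<omega>) (\<lambda>\<theta>. sem_Sigma (mdl \<theta>)) (est n \<omega>)) \<in> borel_measurable P" if "1 \<le> n"
    by (rule smooth_covariance.measurable_QBIC(2)[OF V(1) X T that est1(1,2)[OF that] V(2)])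
  assume a: "optimal_parameter S0 \<Theta> (\<lambda>\<theta>. sem_Sigma (mdl \<theta>)) tb" "condition_C2 q S0 \<Theta> (\<lambda>\<theta>. sem_Sigma (mdl \<theta>)) tb"
    and N: "\<And>k. 1 \<le> N k" "filterlim N at_top sequentially"
    and \<omega>: "\<omega> \<in> space P" "(\<lambda>k. rel_cov T (N k) (\<lambda>t. X t \<omega>)) \<longlonglongrightarrow> S0"
  show "(\<lambda>k. QBIC1 q T (N k) (\<lambda>t. X t \<omega>) (\<lambda>\<theta>. sem_Sigma (mdl \<theta>)) (est (N k) \<omega>) / real (N k))
        \<longlonglongrightarrow> - 2 * limit_loglik S0 (\<lambda>\<theta>. sem_Sigma (mdl \<theta>)) tb"
    by (rule smooth_covariance.QBIC_limit(1)[OF V(1) c V(2) T N \<omega>(2) est1(2)[OF N(1) \<omega>(1)] est1(3)[OF N(1) \<omega>(1)] a])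
  show "(\<lambda>k. QBIC2 q T (N k) (\<lambda>t. X t \<omega>) (\<lambda>\<theta>. sem_Sigma (mdl \<theta>)) (est (N k) \<omega>) / real (N k))
        \<longlonglongrightarrow> - 2 * limit_loglik S0 (\<lambda>\<theta>. sem_Sigma (mdl \<theta>)) tb"
    by (rule smooth_covariance.QBIC_limit(2)[OF V(1) c V(2) T N \<omega>(2) est1(2)[OF N(1) \<omega>(1)] est1(3)[OF N(1) \<omega>(1)] a])
qed

lemma eventually_less_of_ratio:
  fixes f g :: "nat \<Rightarrow> real"
  assumes "(\<lambda>k. f k / real (N k)) \<longlonglongrightarrow> a" "(\<lambda>k. g k / real (N k)) \<longlonglongrightarrow> b" "a < b" "\<And>k. 1 \<le> N k"
  shows "\<forall>\<^sub>F k in sequentially. f k < g k"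
proof -
  obtain c where c: "a < c" "c < b" using dense[OF assms(3)] by blast
  from order_tendstoD(2)[OF assms(1) c(1)] order_tendstoD(1)[OF assms(2) c(2)]
  show ?thesis
  proof eventually_elim
    case (elim k)
    then have "f k / real (N k) < g k / real (N k)" by linarith
    then show ?case using assms(4)[of k] by (simp add: divide_less_cancel)
  qed
qed

section \<open>Realized covariance of the four Wiener processes\<close>

lemma orthogonal_increments_stack:
  assumes "\<And>c d. orthogonal_increments P (\<lambda>t \<omega>. u t \<omega> $ c) (\<lambda>t \<omega>. u t \<omega> $ d) (if c = d then 1 else 0)"
    and "\<And>c d. orthogonal_increments P (\<lambda>t \<omega>. v t \<omega> $ c) (\<lambda>t \<omega>. v t \<omega> $ d) (if c = d then 1 else 0)"
    and "\<And>c d. orthogonal_increments P (\<lambda>t \<omega>. u t \<omega> $ c) (\<lambda>t \<omega>. v t \<omega> $ d) 0"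
  shows "orthogonal_increments P (\<lambda>t \<omega>. stack (u t \<omega>) (v t \<omega>) $ c) (\<lambda>t \<omega>. stack (u t \<omega>) (v t \<omega>) $ d) (if c = d then 1 else 0)"
proof (cases c)
  case (Inl a)
  then show ?thesis using assms(1)[of a] assms(3)[of a] by (cases d) auto
next
  case (Inr b)
  then show ?thesis
    using assms(2)[of b] orthogonal_increments_commute[OF assms(3)] by (cases d) auto
qed

lemma orthogonal_increments_stack_right:
  assumes "\<And>d. orthogonal_increments P A (\<lambda>t \<omega>. u t \<omega> $ d) 0" "\<And>d. orthogonal_increments P A (\<lambda>t \<omega>. v t \<omega> $ d) 0"
  shows "orthogonal_increments P A (\<lambda>t \<omega>. stack (u t \<omega>) (v t \<omega>) $ d) 0"
  using assms by (cases d) auto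

text \<open>L^1 convergence to 0 yields an almost surely convergent subsequence. Applied to the sum
  of the squared errors over all entries, it gives one subsequence that serves the whole matrix.
  \<open>Suc\<close> keeps the number of observations positive.\<close>

lemma wiener_rel_cov_AE_subseq:
  fixes W1 :: "real \<Rightarrow> 'w \<Rightarrow> real ^ 'r1::finite" and W2 :: "real \<Rightarrow> 'w \<Rightarrow> real ^ 'r2::finite"
    and W3 :: "real \<Rightarrow> 'w \<Rightarrow> real ^ 'r3::finite" and W4 :: "real \<Rightarrow> 'w \<Rightarrow> real ^ 'r4::finite"
    and r :: "nat \<Rightarrow> nat"
  assumes sb: "stochastic_basis P F"
    and W: "wiener_process P F W1" "wiener_process P F W2" "wiener_process P F W3" "wiener_process P F W4"
    and ind: "indep_processes4 P W1 W2 W3 W4" and T: "0 < T" and r: "strict_mono r"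
  shows "\<exists>s :: nat \<Rightarrow> nat. strict_mono s \<and> (AE \<omega> in P.
    (\<lambda>k. rel_cov T (Suc (r (s k))) (\<lambda>t. stack (W1 t \<omega>) (stack (W2 t \<omega>) (stack (W3 t \<omega>) (W4 t \<omega>)))))
      \<longlonglongrightarrow> Finite_Cartesian_Product.mat 1)"
proof -
  interpret prob_space P using sb by (simp add: stochastic_basis_def)
  define w where "w = (\<lambda>t \<omega>. stack (W1 t \<omega>) (stack (W2 t \<omega>) (stack (W3 t \<omega>) (W4 t \<omega>))))"
  let ?E = "[process_events P W1, process_events P W2, process_events P W3, process_events P W4]"
  have pair: "indep_set (?E ! i) (?E ! j)" if "i < 4" "j < 4" "i \<noteq> j" for i j
    by (rule indep_set_of_indep_sets[OF ind[unfolded indep_processes4_def]]) (use that in auto)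
  have ij: "indep_set (process_events P W1) (process_events P W2)" "indep_set (process_events P W1) (process_events P W3)"
      "indep_set (process_events P W1) (process_events P W4)" "indep_set (process_events P W2) (process_events P W3)"
      "indep_set (process_events P W2) (process_events P W4)" "indep_set (process_events P W3) (process_events P W4)"
    using pair[of 0 1] pair[of 0 2] pair[of 0 3] pair[of 1 2] pair[of 1 3] pair[of 2 3] by simp_all
  note same = orthogonal_increments_wiener[OF sb]
  note cross = orthogonal_increments_indep_wiener[OF sb]
  have orth: "orthogonal_increments P (\<lambda>t \<omega>. w t \<omega> $ c) (\<lambda>t \<omega>. w t \<omega> $ d) (if c = d then 1 else 0)" for c d
    unfolding w_def
    by (intro orthogonal_increments_stack orthogonal_increments_stack_right same W cross ij)
  define I where "I = (Finite_Cartesian_Product.mat 1 :: real ^ ('r1 + ('r2 + ('r3 + 'r4))) ^ ('r1 + ('r2 + ('r3 + 'r4))))"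
  let ?V = "\<lambda>n c d \<omega>. (rel_cov T n (\<lambda>t. w t \<omega>) $ c $ d - I $ c $ d)\<^sup>2"
  have V: "integrable P (?V n c d)" "(\<integral>\<omega>. ?V n c d \<omega> \<partial>P) \<le> 2 / real n" if "1 \<le> n" for n c d
    using orthogonal_increments_L2[OF prob_space_axioms orth[of c d] T that]
    by (simp_all add: rel_cov_nth incr_def I_def Finite_Cartesian_Product.mat_def)
  define u where "u = (\<lambda>k \<omega>. \<Sum>c\<in>UNIV. \<Sum>d\<in>UNIV. ?V (Suc (r k)) c d \<omega>)"
  let ?C = "real CARD('r1 + ('r2 + ('r3 + 'r4)))"
  have u: "integrable P (u k)" for k
    unfolding u_def by (intro Bochner_Integration.integrable_sum V) simp
  have u0: "0 \<le> u k \<omega>" for k \<omega> unfolding u_def by (intro sum_nonneg) simp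
  have bound: "(\<integral>\<omega>. u k \<omega> \<partial>P) \<le> ?C * ?C * 2 * inverse (real (Suc k))" for k
  proof -
    have "(\<integral>\<omega>. u k \<omega> \<partial>P) = (\<Sum>c\<in>UNIV. \<Sum>d\<in>UNIV. (\<integral>\<omega>. ?V (Suc (r k)) c d \<omega> \<partial>P))"
      unfolding u_def
      by (subst Bochner_Integration.integral_sum, (intro Bochner_Integration.integrable_sum V; simp))
        (intro sum.cong refl Bochner_Integration.integral_sum V, simp)
    also have "\<dots> \<le> (\<Sum>c\<in>(UNIV :: ('r1 + ('r2 + ('r3 + 'r4))) set). \<Sum>d\<in>(UNIV :: ('r1 + ('r2 + ('r3 + 'r4))) set). 2 * inverse (real (Suc k)))"
    proof (intro sum_mono order_trans[OF V(2)])
      \<comment> \<open>A strictly increasing \<open>r\<close> satisfies \<open>k \<le> r k\<close>,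
        so the bound no longer refers to the subsequence.\<close>
      show "2 / real (Suc (r k)) \<le> 2 * inverse (real (Suc k))"
        using strict_mono_imp_increasing[OF r, of k] by (simp add: field_simps)
    qed simp
    finally show ?thesis by (simp add: mult_ac)
  qed
  have L1: "(\<lambda>k. \<integral>\<omega>. norm (u k \<omega>) \<partial>P) \<longlonglongrightarrow> 0"
  proof (rule Lim_null_comparison)
    show "\<forall>\<^sub>F k in sequentially. norm (\<integral>\<omega>. norm (u k \<omega>) \<partial>P) \<le> ?C * ?C * 2 * inverse (real (Suc k))"
      using bound u0 by (simp add: abs_of_nonneg integral_nonneg_AE)
    show "(\<lambda>k. ?C * ?C * 2 * inverse (real (Suc k))) \<longlonglongrightarrow> 0"
      by (intro tendsto_mult_right_zero LIMSEQ_inverse_real_of_nat)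
  qed
  obtain s :: "nat \<Rightarrow> nat" where s: "strict_mono s" "AE \<omega> in P. (\<lambda>k. u (s k) \<omega>) \<longlonglongrightarrow> 0"
    using tendsto_L1_AE_subseq[OF u L1] by blast
  have "AE \<omega> in P. (\<lambda>k. rel_cov T (Suc (r (s k))) (\<lambda>t. w t \<omega>)) \<longlonglongrightarrow> I"
    using s(2)
  proof eventually_elim
    case (elim \<omega>)
    show ?case
    proof (intro vec_tendstoI)
      fix c d
      let ?x = "\<lambda>k. rel_cov T (Suc (r (s k))) (\<lambda>t. w t \<omega>) $ c $ d - I $ c $ d"
      have "(?x k)\<^sup>2 \<le> u (s k) \<omega>" for k
      proof -
        have "(?x k)\<^sup>2 \<le> (\<Sum>d\<in>UNIV. ?V (Suc (r (s k))) c d \<omega>)" by (rule member_le_sum) auto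
        also have "\<dots> \<le> u (s k) \<omega>"
          unfolding u_def by (rule member_le_sum[where f = "\<lambda>c. \<Sum>d\<in>UNIV. ?V (Suc (r (s k))) c d \<omega>"]) (auto intro: sum_nonneg)
        finally show ?thesis .
      qed
      then have "(\<lambda>k. (?x k)\<^sup>2) \<longlonglongrightarrow> 0"
        by (intro Lim_null_comparison[OF _ elim] always_eventually allI) simp
      from tendsto_real_sqrt[OF this] have "(\<lambda>k. \<bar>?x k\<bar>) \<longlonglongrightarrow> 0" by simp
      then have "?x \<longlonglongrightarrow> 0" by (rule tendsto_rabs_zero_cancel)
      then show "(\<lambda>k. rel_cov T (Suc (r (s k))) (\<lambda>t. w t \<omega>) $ c $ d) \<longlonglongrightarrow> I $ c $ d"
        by (simp add: LIM_zero_iff)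
    qed
  qed
  then show ?thesis using s(1) unfolding w_def I_def by blast
qed

section \<open>Comparison of the criteria\<close>

theorem theorem3:
  fixes P :: "'w measure" and F :: "real \<Rightarrow> 'w measure"
    and W1 :: "real \<Rightarrow> 'w \<Rightarrow> real ^ 'r1" and W2 :: "real \<Rightarrow> 'w \<Rightarrow> real ^ 'r2"
    and W3 :: "real \<Rightarrow> 'w \<Rightarrow> real ^ 'r3" and W4 :: "real \<Rightarrow> 'w \<Rightarrow> real ^ 'r4"
    and B1 :: "real ^ 'k1 \<Rightarrow> real ^ 'k1" and B2 :: "real ^ 'p1 \<Rightarrow> real ^ 'p1"
    and B3 :: "real ^ 'p2 \<Rightarrow> real ^ 'p2" and B4 :: "real ^ 'k2 \<Rightarrow> real ^ 'k2"
    and c1 :: "real ^ 'k1" and c2 :: "real ^ 'p1" and c3 :: "real ^ 'p2" and c4 :: "real ^ 'k2"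
    and \<M>0 :: "('p1, 'p2, 'k1, 'k2, 'r1, 'r2, 'r3, 'r4) sem"
    and \<xi> :: "real \<Rightarrow> 'w \<Rightarrow> real ^ 'k1" and \<delta> :: "real \<Rightarrow> 'w \<Rightarrow> real ^ 'p1"
    and \<epsilon> :: "real \<Rightarrow> 'w \<Rightarrow> real ^ 'p2" and \<zeta> :: "real \<Rightarrow> 'w \<Rightarrow> real ^ 'k2"
    and \<eta> :: "real \<Rightarrow> 'w \<Rightarrow> real ^ 'k2" and X :: "real \<Rightarrow> 'w \<Rightarrow> real ^ ('p1 + 'p2)"
    and T :: real and M :: nat and q :: "nat \<Rightarrow> nat" and \<Theta> :: "nat \<Rightarrow> (nat \<Rightarrow> real) set"
    and mdl :: "nat \<Rightarrow> (nat \<Rightarrow> real) \<Rightarrow> ('p1, 'p2, 'k1, 'k2, 'r1, 'r2, 'r3, 'r4) sem"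
    and \<theta>hat :: "nat \<Rightarrow> nat \<Rightarrow> 'w \<Rightarrow> nat \<Rightarrow> real"
    and prior :: "nat \<Rightarrow> nat \<Rightarrow> (nat \<Rightarrow> real) \<Rightarrow> real"
    and \<theta>0 \<theta>bar :: "nat \<Rightarrow> nat \<Rightarrow> real" and mopt :: nat
    \<comment> \<open>stochastic basis, true model, observation horizon\<close>
  assumes "stochastic_basis P F"
    and "wiener_process P F W1" and "wiener_process P F W2"
    and "wiener_process P F W3" and "wiener_process P F W4"
    and "indep_processes4 P W1 W2 W3 W4"
    and "CARD('k1) \<le> CARD('p1)" and "CARD('k2) \<le> CARD('p2)"
    and "sem_regular \<M>0"
    and "sde_solution P F W1 B1 (S1 \<M>0) c1 \<xi>"
    and "sde_solution P F W2 B2 (S2 \<M>0) c2 \<delta>"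
    and "sde_solution P F W3 B3 (S3 \<M>0) c3 \<epsilon>"
    and "sde_solution P F W4 B4 (S4 \<M>0) c4 \<zeta>"
    and "sem_observation P \<M>0 \<xi> \<delta> \<epsilon> \<zeta> \<eta> X"
    and "0 < T"
    \<comment> \<open>parametric models, priors, estimators, optimal parameters\<close>
    and "\<forall>m\<in>{1..M}. parametric_model (q m) (\<Theta> m) (mdl m)"
    and "\<forall>m\<in>{1..M}. \<forall>n\<ge>1. prior_density (q m) (\<Theta> m) (prior m n)"
    and "\<forall>m\<in>{1..M}. QMLE P T X (\<Theta> m) (\<lambda>\<theta>. sem_Sigma (mdl m \<theta>)) (\<theta>hat m)"
    and "\<forall>m\<in>{1..M}. optimal_parameter (sem_Sigma \<M>0) (\<Theta> m) (\<lambda>\<theta>. sem_Sigma (mdl m \<theta>)) (\<theta>bar m)"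
    \<comment> \<open>correctly specified models and the optimal model\<close>
    and "\<forall>m\<in>correct_models M \<Theta> mdl \<M>0.
           sem_Sigma \<M>0 = sem_Sigma (mdl m (\<theta>0 m)) \<and>
           \<theta>0 m \<in> Euclidean_space (q m) interior_of \<Theta> m \<and> \<theta>bar m = \<theta>0 m"
    and "correct_models M \<Theta> mdl \<M>0 \<noteq> {}" and "{1..M} - correct_models M \<Theta> mdl \<M>0 \<noteq> {}"
    and "{m. is_arg_min q (\<lambda>m. m \<in> correct_models M \<Theta> mdl \<M>0) m} = {mopt}"
    \<comment> \<open>conditions [A], [B], [C2]\<close>
    and "condition_A P B1 \<xi>" and "condition_A P B2 \<delta>"
    and "condition_A P B3 \<epsilon>" and "condition_A P B4 \<zeta>"
    and "\<forall>m\<in>correct_models M \<Theta> mdl \<M>0. condition_B (q m) (\<Theta> m) (\<theta>0 m) (prior m)"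
    and "\<forall>m\<in>{1..M}.
           condition_C2 (q m) (sem_Sigma \<M>0) (\<Theta> m) (\<lambda>\<theta>. sem_Sigma (mdl m \<theta>)) (\<theta>bar m)"
  shows "\<forall>m \<in> {1..M} - correct_models M \<Theta> mdl \<M>0.
      (\<lambda>n. measure P {\<omega> \<in> space P.
          QBIC1 (q mopt) T n (\<lambda>t. X t \<omega>) (\<lambda>\<theta>. sem_Sigma (mdl mopt \<theta>)) (\<theta>hat mopt n \<omega>)
        < QBIC1 (q m) T n (\<lambda>t. X t \<omega>) (\<lambda>\<theta>. sem_Sigma (mdl m \<theta>)) (\<theta>hat m n \<omega>)}) \<longlonglongrightarrow> 1 \<and>
      (\<lambda>n. measure P {\<omega> \<in> space P.
          QBIC2 (q mopt) T n (\<lambda>t. X t \<omega>) (\<lambda>\<theta>. sem_Sigma (mdl mopt \<theta>)) (\<theta>hat mopt n \<omega>)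
        < QBIC2 (q m) T n (\<lambda>t. X t \<omega>) (\<lambda>\<theta>. sem_Sigma (mdl m \<theta>)) (\<theta>hat m n \<omega>)}) \<longlonglongrightarrow> 1"
proof
  fix m assume m: "m \<in> {1..M} - correct_models M \<Theta> mdl \<M>0"
  interpret prob_space P using assms(1) by (simp add: stochastic_basis_def)
  let ?Sm = "\<lambda>m \<theta>. sem_Sigma (mdl m \<theta>)" and ?Strue = "sem_Sigma \<M>0"
  let ?w = "\<lambda>t \<omega>. stack (W1 t \<omega>) (stack (W2 t \<omega>) (stack (W3 t \<omega>) (W4 t \<omega>)))"
  have "mopt \<in> {m. is_arg_min q (\<lambda>m. m \<in> correct_models M \<Theta> mdl \<M>0) m}" using assms(23) by simp
  then have opt: "mopt \<in> correct_models M \<Theta> mdl \<M>0" by (simp add: is_arg_min_def)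
  then have optM: "mopt \<in> {1..M}" by (simp add: correct_models_def)
  have mM: "m \<in> {1..M}" using m by simp
  have reg: "sem_regular (mdl j \<theta>)" if "j \<in> {1..M}" "\<theta> \<in> \<Theta> j" for j \<theta>
    using bspec[OF assms(16) that(1)] that(2) by (simp add: parametric_model_def)
  have tb: "\<theta>bar j \<in> \<Theta> j" if "j \<in> {1..M}" for j
    using bspec[OF assms(19) that] by (simp add: optimal_parameter_def)
  have "?Sm mopt (\<theta>bar mopt) = ?Strue" using bspec[OF assms(20) opt] by simp
  then have ll_opt: "limit_loglik ?Strue (?Sm mopt) (\<theta>bar mopt) =
      - 1 / 2 * real CARD('p1 + 'p2) - 1 / 2 * ln (Determinants.det ?Strue)"
    by (intro limit_loglik_truth(2) assms(9) reg optM tb)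
  \<comment> \<open>Misspecification excludes every parameter of the model, in particular the
    optimal one; the strict case of the Gibbs inequality applies.\<close>
  have "?Sm m (\<theta>bar m) \<noteq> ?Strue" using m tb[OF mM] by (auto simp: correct_models_def)
  then have "limit_loglik ?Strue (?Sm m) (\<theta>bar m) <
      - 1 / 2 * real CARD('p1 + 'p2) - 1 / 2 * ln (Determinants.det ?Strue)"
    by (intro limit_loglik_truth(1) assms(9) reg mM tb)
  then have "limit_loglik ?Strue (?Sm m) (\<theta>bar m) < limit_loglik ?Strue (?Sm mopt) (\<theta>bar mopt)"
    by (simp only: ll_opt)
  then have gap: "- 2 * limit_loglik ?Strue (?Sm mopt) (\<theta>bar mopt) < - 2 * limit_loglik ?Strue (?Sm m) (\<theta>bar m)"
    by simp
  have inv: "invertible (Psi \<M>0)" using assms(9) by (simp add: sem_regular_def)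
  have obs: "\<eta> t \<omega> = Bmat \<M>0 *v \<eta> t \<omega> + Gam \<M>0 *v \<xi> t \<omega> + \<zeta> t \<omega> \<and>
        X t \<omega> = stack (Lam1 \<M>0 *v \<xi> t \<omega> + \<delta> t \<omega>) (Lam2 \<M>0 *v \<eta> t \<omega> + \<epsilon> t \<omega>)" if "0 \<le> t" "\<omega> \<in> space P" for t \<omega>
    by (rule assms(14)[unfolded sem_observation_def, rule_format, OF that])
  have X: "X t \<in> borel_measurable P" if t: "0 \<le> t" for t
  proof -
    have [measurable]: "\<xi> t \<in> borel_measurable P" "\<delta> t \<in> borel_measurable P" "\<epsilon> t \<in> borel_measurable P" "\<zeta> t \<in> borel_measurable P"
      using assms(10-13) t by (auto simp: sde_solution_def intro: measurable_stochastic_basis(1)[OF assms(1) t])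
    \<comment> \<open>Measurability is given for the SDE solutions but not for \<eta>, so \<eta> is
      eliminated by solving the structural equation.\<close>
    have "X t \<omega> = stack (Lam1 \<M>0 *v \<xi> t \<omega> + \<delta> t \<omega>)
        (Lam2 \<M>0 *v (matrix_inv (Psi \<M>0) *v (Gam \<M>0 *v \<xi> t \<omega> + \<zeta> t \<omega>)) + \<epsilon> t \<omega>)" if "\<omega> \<in> space P" for \<omega>
      using obs[OF t that] sem_observation_eq[OF inv, of "\<eta> t \<omega>" "\<xi> t \<omega>" "\<zeta> t \<omega>"] by simp
    moreover have "(\<lambda>\<omega>. stack (Lam1 \<M>0 *v \<xi> t \<omega> + \<delta> t \<omega>)
        (Lam2 \<M>0 *v (matrix_inv (Psi \<M>0) *v (Gam \<M>0 *v \<xi> t \<omega> + \<zeta> t \<omega>)) + \<epsilon> t \<omega>)) \<in> borel_measurable P"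
      by measurable
    ultimately show ?thesis by (simp cong: measurable_cong)
  qed
  have lip: "AE \<omega> in P. \<forall>i. \<exists>C. C-lipschitz_on {0..T} (\<lambda>t. (X t \<omega> - sem_factor \<M>0 *v ?w t \<omega>) $ i)"
  proof -
    have sde: "AE \<omega> in P. \<exists>C. C-lipschitz_on {0..T} (\<lambda>t. Z t \<omega> - S *v W t \<omega>)"
      if "sde_solution P F W B S c Z" "condition_A P B Z"
      for W :: "real \<Rightarrow> 'w \<Rightarrow> real ^ 'r::finite" and B c S and Z :: "real \<Rightarrow> 'w \<Rightarrow> real ^ 'd::finite"
    proof -
      have B: "\<exists>L. L-lipschitz_on UNIV B" using that(2) by (simp add: condition_A_def)
      have "AE \<omega> in P. continuous_on {0..} (\<lambda>t. Z t \<omega>) \<and>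
        (\<forall>t\<ge>0. (\<lambda>s. B (Z s \<omega>)) integrable_on {0..t} \<and>
           Z t \<omega> = c + integral {0..t} (\<lambda>s. B (Z s \<omega>)) + S *v W t \<omega>)"
        using that(1) by (simp add: sde_solution_def)
      then show ?thesis
        by eventually_elim (rule sde_lipschitz_part[OF B], auto)
    qed
    show ?thesis
      using sde[OF assms(10,24)] sde[OF assms(11,25)] sde[OF assms(12,26)] sde[OF assms(13,27)] AE_space
    proof eventually_elim
      case (elim \<omega>)
      show ?case
        by (rule allI) (rule sem_path_lipschitz[OF inv obs[OF _ elim(5)] elim(1-4)])
    qed
  qed
  \<comment> \<open>Stated for arbitrary \<open>Q1\<close> and \<open>Q2\<close>, so that one
    argument covers both criteria; they enter only through measurability and their limits after
    division by \<open>n\<close>.\<close>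
  have conv: "(\<lambda>n. prob {\<omega> \<in> space P. Q1 n \<omega> < Q2 n \<omega>}) \<longlonglongrightarrow> 1"
    if meas: "\<And>n. 1 \<le> n \<Longrightarrow> Q1 n \<in> borel_measurable P" "\<And>n. 1 \<le> n \<Longrightarrow> Q2 n \<in> borel_measurable P"
      and lim1: "\<And>N \<omega>. \<lbrakk>\<And>k. 1 \<le> N k; filterlim N at_top sequentially; \<omega> \<in> space P; (\<lambda>k. rel_cov T (N k) (\<lambda>t. X t \<omega>)) \<longlonglongrightarrow> ?Strue\<rbrakk>
          \<Longrightarrow> (\<lambda>k. Q1 (N k) \<omega> / real (N k)) \<longlonglongrightarrow> - 2 * limit_loglik ?Strue (?Sm mopt) (\<theta>bar mopt)"
      and lim2: "\<And>N \<omega>. \<lbrakk>\<And>k. 1 \<le> N k; filterlim N at_top sequentially; \<omega> \<in> space P; (\<lambda>k. rel_cov T (N k) (\<lambda>t. X t \<omega>)) \<longlonglongrightarrow> ?Strue\<rbrakk>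
          \<Longrightarrow> (\<lambda>k. Q2 (N k) \<omega> / real (N k)) \<longlonglongrightarrow> - 2 * limit_loglik ?Strue (?Sm m) (\<theta>bar m)"
    for Q1 Q2 :: "nat \<Rightarrow> 'w \<Rightarrow> real"
  proof -
    let ?E = "\<lambda>n. {\<omega> \<in> space P. Q1 n \<omega> < Q2 n \<omega>}"
    \<comment> \<open>The shift avoids \<open>n = 0\<close>, about which the hypotheses on the
      estimators are silent; it does not affect the limit.\<close>
    have "(\<lambda>n. prob (?E (Suc n))) \<longlonglongrightarrow> 1"
    proof (rule tendsto_subseqI)
      fix r :: "nat \<Rightarrow> nat" assume r: "strict_mono r"
      obtain s :: "nat \<Rightarrow> nat" where s: "strict_mono s"
        and W: "AE \<omega> in P. (\<lambda>k. rel_cov T (Suc (r (s k))) (\<lambda>t. ?w t \<omega>)) \<longlonglongrightarrow> Finite_Cartesian_Product.mat 1"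
        using wiener_rel_cov_AE_subseq[OF assms(1-6,15) r] by blast
      define N where "N = (\<lambda>k. Suc (r (s k)))"
      have N1: "1 \<le> N k" for k by (simp add: N_def)
      have "strict_mono N" using strict_mono_o[OF r s] by (simp add: N_def strict_mono_def)
      then have N: "filterlim N at_top sequentially" by (rule filterlim_subseq)
      \<comment> \<open>On almost every path both normalized criteria converge, to limits separated
        by \<open>gap\<close>; so the inequality holds from some index on, which may depend on the
        path.\<close>
      have ev: "AE \<omega> in P. \<forall>\<^sub>F k in sequentially. \<omega> \<in> ?E (N k)"
        using W lip AE_space
      proof eventually_elim
        case (elim \<omega>)
        have "(\<lambda>k. rel_cov T (N k) (\<lambda>t. sem_factor \<M>0 *v ?w t \<omega>)) \<longlonglongrightarrow> ?Strue"
          unfolding sem_Sigma_factor using tendsto_rel_cov_mult[OF elim(1)] by (simp add: N_def)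
        then have "(\<lambda>k. rel_cov T (N k) (\<lambda>t. X t \<omega>)) \<longlonglongrightarrow> ?Strue"
          by (rule tendsto_rel_cov_perturb[OF assms(15) N1 N elim(2)[rule_format]])
        from eventually_less_of_ratio[OF lim1[OF N1 N elim(3) this] lim2[OF N1 N elim(3) this] gap N1] elim(3)
        show ?case by simp
      qed
      have "(\<lambda>k. prob (?E (N k))) \<longlonglongrightarrow> 1"
        by (rule prob_tendsto_1[OF _ ev]) (intro borel_measurable_less meas N1)
      then show "\<exists>s :: nat \<Rightarrow> nat. strict_mono s \<and> (\<lambda>k. prob (?E (Suc (r (s k))))) \<longlonglongrightarrow> 1"
        using s unfolding N_def by blast
    qed
    then show ?thesis by (rule LIMSEQ_imp_Suc)
  qed
  note Q = model_QBIC[OF bspec[OF assms(16)] assms(15) X bspec[OF assms(18)]]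
  note C = bspec[OF assms(19)] bspec[OF assms(29)]
  show "(\<lambda>n. measure P {\<omega> \<in> space P.
          QBIC1 (q mopt) T n (\<lambda>t. X t \<omega>) (\<lambda>\<theta>. sem_Sigma (mdl mopt \<theta>)) (\<theta>hat mopt n \<omega>)
        < QBIC1 (q m) T n (\<lambda>t. X t \<omega>) (\<lambda>\<theta>. sem_Sigma (mdl m \<theta>)) (\<theta>hat m n \<omega>)}) \<longlonglongrightarrow> 1 \<and>
      (\<lambda>n. measure P {\<omega> \<in> space P.
          QBIC2 (q mopt) T n (\<lambda>t. X t \<omega>) (\<lambda>\<theta>. sem_Sigma (mdl mopt \<theta>)) (\<theta>hat mopt n \<omega>)
        < QBIC2 (q m) T n (\<lambda>t. X t \<omega>) (\<lambda>\<theta>. sem_Sigma (mdl m \<theta>)) (\<theta>hat m n \<omega>)}) \<longlonglongrightarrow> 1"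
    by (intro conjI; rule conv;
      (rule Q(1)[OF optM _ optM] Q(1)[OF mM _ mM] Q(2)[OF optM _ optM] Q(2)[OF mM _ mM]
        Q(3)[OF optM _ optM C(1)[OF optM] C(2)[OF optM]] Q(3)[OF mM _ mM C(1)[OF mM] C(2)[OF mM]]
        Q(4)[OF optM _ optM C(1)[OF optM] C(2)[OF optM]] Q(4)[OF mM _ mM C(1)[OF mM] C(2)[OF mM]]); assumption)
qed

end
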